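(* Let $\mathbf A=(A_n)\in\mathcal S_{\mathcal Y}({\sf BDO}(\Gamma))$ and $A:=\mathrm{s\text{-}lim}\,A_nP_{Y_n}$. Then every limit operator of $\mathrm{Op}(\mathbf A)+P_{\Gamma'}$ is one of the following: (a) the identity operator $I$; (b) an operator $R_{v^*}^{-1}AR_{v^*}$ with $v^*\in\Gamma$; (c) a limit operator of $A$; (d) an operator of the form \[\mathrm{s\text{-}lim}_{j\to\infty}R_{w_*}^{-1}R_{\eta_j}^{-1}A_{k_j}P_{Y_{k_j}}R_{\eta_j}R_{w_*}+(P_{\Gamma'})_g,\] where $(k_j)$ is a strictly increasing sequence of positive integers, $\eta_j\in(\partial_\Omega Y_{k_j})^{-1}$, $w_*\in\Gamma$, $g(j)=v_{k_j}\eta_jw_*$, and the strong limit and the limit operator $(P_{\Gamma'})_g$ exist. Moreover, every operator in (b) and every operator in (c) is a limit operator of $\mathrm{Op}(\mathbf A)+P_{\Gamma'}$.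
   Context: $\Gamma$ is a countable discrete group with identity $e$. For $X\subseteq\Gamma$, $P_X$ is the orthogonal projection of $l^2(\Gamma)$ onto $l^2(X)$. For $r\in\Gamma$, $(L_ru)(t)=u(r^{-1}t)$ and $(R_ru)(t)=u(tr)$. ${\sf BDO}(\Gamma)$ is the smallest closed subalgebra of $L(l^2(\Gamma))$ containing all $L_r$ and all multiplication operators $aI$, $a\in l^\infty(\Gamma)$. $\Omega\subseteq\Gamma$ is finite, contains $e$, generates $\Gamma$ as a semigroup; $\Omega_0=\{e\}$, $\Omega_n$ = set of products of at most $n$ elements of $\Omega$. For $A\subseteq\Gamma$: $\mathrm{int}_\Omega A=\{a\in A:\Omega a\subseteq A\}$, $\partial_\Omega A=A\setminus\mathrm{int}_\Omega A$; set products and inverses are elementwise. $\mathcal Y=(Y_n)$ is an increasing sequence of finite subsets of $\Gamma$ with union $\Gamma$. $\mathcal S_{\mathcal Y}({\sf BDO}(\Gamma))$ is the smallest closed $C^*$-subalgebra of the $C^*$-algebra of bounded sequences $(A_n)$ of operators on $\mathrm{im}\,P_{Y_n}$ (componentwise operations, sup norm) containing all $(P_{Y_n}BP_{Y_n})$, $B\in{\sf BDO}(\Gamma)$; for its elements $\mathrm{s\text{-}lim}\,A_nP_{Y_n}$ exists. Fix $(v_n)$ in $\Gamma$ inflating for $Z_n:=(Y_n\cup\Omega_n)(Y_n\cup\Omega_n)^{-1}(Y_n\cup\Omega_n)$, i.e. $Z_mv_m^{-1}\cap Z_nv_n^{-1}=\emptyset$ for $m\ne n$. $\mathrm{Op}(\mathbf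 A):=\sum_nR_{v_n}A_nP_{Y_n}R_{v_n}^{-1}$ (strongly convergent) and $\Gamma':=\Gamma\setminus\bigcup_nY_nv_n^{-1}$. A sequence $h:\mathbb N\to\Gamma$ tends to infinity if for each finite $\Gamma_0$, $h(n)\notin\Gamma_0$ for large $n$. For $B\in L(l^2(\Gamma))$, $B_h$ is the limit operator of $B$ with respect to $h$ if $R_{h(m)}^{-1}BR_{h(m)}\to B_h$ and $R_{h(m)}^{-1}B^*R_{h(m)}\to B_h^*$ strongly. *)

theory Defs
  imports "HOL-Analysis.Analysis" "HOL-Library.Function_Algebras"
begin

text \<open>The discrete group Gamma is a type of class group_add (written additively, not
necessarily commutative): the paper's product r s is r + s, e is 0, r^{-1} is - r.
Vectors are complex-valued functions on Gamma; operators are maps on such functions,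
of which only the action on l^2 matters.\<close>

type_synonym 'g vec = "'g \<Rightarrow> complex"
type_synonym 'g op = "'g vec \<Rightarrow> 'g vec"

definition l2 :: "'g vec set" where
  "l2 = {u. (\<lambda>t. (cmod (u t))^2) summable_on UNIV}"

definition l2norm :: "'g vec \<Rightarrow> real" where
  "l2norm u = sqrt (\<Sum>\<^sub>\<infinity>t. (cmod (u t))^2)"

definition l2inner :: "'g vec \<Rightarrow> 'g vec \<Rightarrow> complex" where
  "l2inner u w = (\<Sum>\<^sub>\<infinity>t. u t * cnj (w t))"

definition bounded_op :: "'g op \<Rightarrow> bool" where
  "bounded_op B \<longleftrightarrow> (\<forall>u\<in>l2. B u \<in> l2)
     \<and> (\<forall>u\<in>l2. \<forall>w\<in>l2. \<forall>c. B (\<lambda>t. c * u t + w t) = (\<lambda>t. c * B u t + B w t))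
     \<and> (\<exists>C. \<forall>u\<in>l2. l2norm (B u) \<le> C * l2norm u)"

definition op_eq :: "'g op \<Rightarrow> 'g op \<Rightarrow> bool" where
  "op_eq B C \<longleftrightarrow> (\<forall>u\<in>l2. B u = C u)"

definition sconv :: "(nat \<Rightarrow> 'g op) \<Rightarrow> 'g op \<Rightarrow> bool" where
  "sconv Bs B \<longleftrightarrow> (\<forall>u\<in>l2. B u \<in> l2 \<and> (\<forall>m. Bs m u \<in> l2)
       \<and> (\<lambda>m. l2norm (Bs m u - B u)) \<longlonglongrightarrow> 0)"

definition is_adj :: "'g op \<Rightarrow> 'g op \<Rightarrow> bool" where
  "is_adj B C \<longleftrightarrow> (\<forall>u\<in>l2. B u \<in> l2 \<and> C u \<in> l2)
     \<and> (\<forall>u\<in>l2. \<forall>w\<in>l2. l2inner (B u) w = l2inner u (C w))"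

definition Pr :: "'g set \<Rightarrow> 'g op" where
  "Pr X u = (\<lambda>t. if t \<in> X then u t else 0)"

definition Lop :: "'g::group_add \<Rightarrow> 'g op" where
  "Lop r u = (\<lambda>t. u (- r + t))"

definition Rop :: "'g::group_add \<Rightarrow> 'g op" where
  "Rop r u = (\<lambda>t. u (t + r))"

definition Mop :: "'g vec \<Rightarrow> 'g op" where
  "Mop a u = (\<lambda>t. a t * u t)"

inductive_set bdo_alg :: "('g::group_add) op set" where
  gen_L: "Lop r \<in> bdo_alg"
| gen_M: "(\<exists>M. \<forall>t. cmod (a t) \<le> M) \<Longrightarrow> Mop a \<in> bdo_alg"
| add: "B \<in> bdo_alg \<Longrightarrow> C \<in> bdo_alg \<Longrightarrow> B + C \<in> bdo_alg"
| scale: "B \<in> bdo_alg \<Longrightarrow> (\<lambda>u t. c * B u t) \<in> bdo_alg"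
| mult: "B \<in> bdo_alg \<Longrightarrow> C \<in> bdo_alg \<Longrightarrow> B \<circ> C \<in> bdo_alg"

definition BDO :: "('g::group_add) op set" where
  "BDO = {B. bounded_op B \<and> (\<forall>\<epsilon>>0. \<exists>C\<in>bdo_alg. \<forall>u\<in>l2. l2norm (B u - C u) \<le> \<epsilon> * l2norm u)}"

text \<open>Adjoint of an operator on im P_Y (Y finite), via its matrix.\<close>
definition delta :: "'g \<Rightarrow> 'g vec" where
  "delta s = (\<lambda>x. if x = s then 1 else 0)"

definition adjY :: "'g set \<Rightarrow> 'g op \<Rightarrow> 'g op" where
  "adjY Y B u = (\<lambda>s. if s \<in> Y then (\<Sum>t\<in>Y. cnj (B (delta s) t) * u t) else 0)"

text \<open>Sequences (A_n) of operators on im P_{Y_n}; A_n is represented by a map with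
A_n u = P_{Y_n} (A_n (P_{Y_n} u)). The *-algebra generated by the (P_{Y_n} B P_{Y_n}).\<close>
inductive_set S_alg :: "(nat \<Rightarrow> 'g set) \<Rightarrow> (nat \<Rightarrow> ('g::group_add) op) set" for Y where
  gen: "B \<in> BDO \<Longrightarrow> (\<lambda>n. Pr (Y n) \<circ> B \<circ> Pr (Y n)) \<in> S_alg Y"
| add: "AA \<in> S_alg Y \<Longrightarrow> CC \<in> S_alg Y \<Longrightarrow> (\<lambda>n. AA n + CC n) \<in> S_alg Y"
| scale: "AA \<in> S_alg Y \<Longrightarrow> (\<lambda>n u t. c * AA n u t) \<in> S_alg Y"
| mult: "AA \<in> S_alg Y \<Longrightarrow> CC \<in> S_alg Y \<Longrightarrow> (\<lambda>n. AA n \<circ> CC n) \<in> S_alg Y"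
| adj: "AA \<in> S_alg Y \<Longrightarrow> (\<lambda>n. adjY (Y n) (AA n)) \<in> S_alg Y"

definition SY :: "(nat \<Rightarrow> 'g set) \<Rightarrow> (nat \<Rightarrow> ('g::group_add) op) set" where
  "SY Y = {AA. (\<forall>n u. AA n u = Pr (Y n) (AA n (Pr (Y n) u)))
     \<and> (\<forall>\<epsilon>>0. \<exists>CC\<in>S_alg Y. \<forall>n u. l2norm (AA n u - CC n u) \<le> \<epsilon> * l2norm (Pr (Y n) u))}"

definition setmul :: "'g::group_add set \<Rightarrow> 'g set \<Rightarrow> 'g set" where
  "setmul A B = {a + b | a b. a \<in> A \<and> b \<in> B}"

definition Omega_pow :: "'g::group_add set \<Rightarrow> nat \<Rightarrow> 'g set" where
  "Omega_pow \<Omega> n = {sum_list xs | xs. set xs \<subseteq> \<Omega> \<and> length xs \<le> n}"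

definition int_Om :: "'g::group_add set \<Rightarrow> 'g set \<Rightarrow> 'g set" where
  "int_Om \<Omega> A = {a \<in> A. \<forall>\<omega>\<in>\<Omega>. \<omega> + a \<in> A}"

definition bdry_Om :: "'g::group_add set \<Rightarrow> 'g set \<Rightarrow> 'g set" where
  "bdry_Om \<Omega> A = A - int_Om \<Omega> A"

text \<open>Z_n for the sequence index n (0-based; paper index n+1).\<close>
definition Zset :: "'g::group_add set \<Rightarrow> (nat \<Rightarrow> 'g set) \<Rightarrow> nat \<Rightarrow> 'g set" where
  "Zset \<Omega> Y n = (let W = Y n \<union> Omega_pow \<Omega> (Suc n) in setmul (setmul W (uminus ` W)) W)"

definition inflating :: "'g::group_add set \<Rightarrow> (nat \<Rightarrow> 'g set) \<Rightarrow> (nat \<Rightarrow> 'g) \<Rightarrow> bool" where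
  "inflating \<Omega> Y v \<longleftrightarrow> (\<forall>m n. m \<noteq> n \<longrightarrow>
     setmul (Zset \<Omega> Y m) {- v m} \<inter> setmul (Zset \<Omega> Y n) {- v n} = {})"

definition Gamma' :: "(nat \<Rightarrow> 'g::group_add set) \<Rightarrow> (nat \<Rightarrow> 'g) \<Rightarrow> 'g set" where
  "Gamma' Y v = UNIV - (\<Union>n. setmul (Y n) {- v n})"

definition tends_inf :: "(nat \<Rightarrow> 'g) \<Rightarrow> bool" where
  "tends_inf h \<longleftrightarrow> (\<forall>F. finite F \<longrightarrow> (\<forall>\<^sub>F m in sequentially. h m \<notin> F))"

definition limit_op :: "'g op \<Rightarrow> (nat \<Rightarrow> 'g::group_add) \<Rightarrow> 'g op \<Rightarrow> bool" where
  "limit_op B h Bh \<longleftrightarrow> bounded_op B \<and> tends_inf h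
     \<and> sconv (\<lambda>m. Rop (- h m) \<circ> B \<circ> Rop (h m)) Bh
     \<and> (\<exists>Bs Bhs. is_adj B Bs \<and> is_adj Bh Bhs
          \<and> sconv (\<lambda>m. Rop (- h m) \<circ> Bs \<circ> Rop (h m)) Bhs)"

end

theory Submission
  imports Defs "HOL-Library.Diagonal_Subsequence"
begin

text \<open>
  All convergence is tested on the basis vectors \<open>delta s\<close>: a uniformly bounded sequence of
  operators tends strongly to zero as soon as it does so on each of them.

  The elements of \<open>SY Y\<close> and their adjoints are uniformly quasi-local (the image of
  \<open>delta s\<close> is, up to \<open>\<epsilon>\<close>, supported on \<open>G + s\<close> with a finite \<open>G\<close> depending only on \<open>\<epsilon>\<close>), and
  consistent: \<open>AA m (delta s)\<close> and \<open>AA n (delta s)\<close> are \<open>\<epsilon>\<close>-close once \<open>G + s\<close> lies in \<open>Y m\<close> and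
  \<open>Y n\<close>. Quasi-locality is what makes consistency pass to products.

  Let \<open>h\<close> be a sequence defining a limit operator. If every point \<open>s - h m\<close> eventually lies in
  \<open>Gamma'\<close>, the limit operator is the identity. Otherwise a subsequence has the form
  \<open>h m = v (k m) + r m\<close> with \<open>f - r m\<close> in \<open>Y (k m)\<close> and \<open>k\<close> strictly increasing, and the inflating
  condition separates any fixed finite set, seen from \<open>h m\<close>, from all blocks but the \<open>k m\<close>-th one.
  If \<open>r\<close> does not tend to infinity one gets a translate of \<open>A\<close>. If it does, and every finite set
  translated by \<open>- r m\<close> eventually lies in \<open>Y (k m)\<close>, consistency allows \<open>AA (k m)\<close> to be replaced by \<open>A\<close>,
  which gives a limit operator of \<open>A\<close>. Otherwise some fixed point translated by \<open>- r m\<close> leaves \<open>Y (k m)\<close>, and a path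
  from \<open>f\<close> to it crosses the boundary at a bounded distance. Conversely, for given \<open>r\<close>, constant or
  tending to infinity, a fast growing \<open>k\<close> puts one in the situation where \<open>AA (k m)\<close> can be replaced by \<open>A\<close>.
\<close>

section \<open>The Hilbert space of square-summable functions\<close>

text \<open>Membership and norm are both governed by the supremum of partial sums over finite sets,
  so one bound on finite sections yields both. Norm estimates thereby reduce to the finite
  inequalities for \<open>L2_set\<close>.\<close>

lemma l2_boundI:
  assumes "0 \<le> K" and "\<And>F. finite F \<Longrightarrow> L2_set (\<lambda>t. cmod (u t)) F \<le> K"
  shows "u \<in> l2" and "l2norm u \<le> K"
proof -
  have b: "(\<Sum>t\<in>F. (cmod (u t))\<^sup>2) \<le> K\<^sup>2" if "finite F" for F
  proof -
    have "sqrt (\<Sum>t\<in>F. (cmod (u t))\<^sup>2) \<le> K" using assms(2)[OF that] by (simp add: L2_set_def)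
    then show ?thesis by (metis sqrt_le_D)
  qed
  show u: "u \<in> l2" unfolding l2_def mem_Collect_eq
    by (rule nonneg_bdd_above_summable_on) (auto intro!: bdd_aboveI[of _ "K\<^sup>2"] b)
  have "(\<Sum>\<^sub>\<infinity>t. (cmod (u t))\<^sup>2) \<le> K\<^sup>2"
    by (rule infsum_le_finite_sums) (use u b in \<open>auto simp: l2_def\<close>)
  then show "l2norm u \<le> K" unfolding l2norm_def using assms(1) real_le_lsqrt
    by (simp add: infsum_nonneg)
qed

lemma L2_set_le_l2norm:
  assumes "u \<in> l2" shows "L2_set (\<lambda>t. cmod (u t)) F \<le> l2norm u"
proof (cases "finite F")
  case True
  then show ?thesis unfolding L2_set_def l2norm_def
    by (intro real_sqrt_le_mono finite_sum_le_infsum) (use assms in \<open>auto simp: l2_def\<close>)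
qed (simp add: l2norm_def infsum_nonneg)

lemma l2norm_nonneg [simp]: "0 \<le> l2norm u"
  by (simp add: l2norm_def infsum_nonneg)

lemma cmod_le_l2norm: "u \<in> l2 \<Longrightarrow> cmod (u t) \<le> l2norm u"
  using L2_set_le_l2norm[of u "{t}"] by simp

lemma l2_add:
  assumes "u \<in> l2" "w \<in> l2"
  shows "u + w \<in> l2" and "l2norm (u + w) \<le> l2norm u + l2norm w"
proof -
  have "L2_set (\<lambda>t. cmod ((u + w) t)) F \<le> l2norm u + l2norm w" for F
  proof -
    have "L2_set (\<lambda>t. cmod ((u + w) t)) F \<le> L2_set (\<lambda>t. cmod (u t) + cmod (w t)) F"
      by (rule L2_set_mono) (auto intro: norm_triangle_ineq)
    also have "\<dots> \<le> L2_set (\<lambda>t. cmod (u t)) F + L2_set (\<lambda>t. cmod (w t)) F"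
      by (rule L2_set_triangle_ineq)
    also have "\<dots> \<le> l2norm u + l2norm w" using assms by (intro add_mono L2_set_le_l2norm)
    finally show ?thesis .
  qed
  then show "u + w \<in> l2" "l2norm (u + w) \<le> l2norm u + l2norm w"
    using l2_boundI[of "l2norm u + l2norm w" "u + w"] by auto
qed

lemma l2_scale: "u \<in> l2 \<Longrightarrow> (\<lambda>t. c * u t) \<in> l2"
  unfolding l2_def by (simp add: norm_mult power_mult_distrib summable_on_cmult_right)

lemma l2norm_scale: "l2norm (\<lambda>t. c * u t) = cmod c * l2norm u"
  unfolding l2norm_def
  by (simp add: norm_mult power_mult_distrib infsum_cmult_right' real_sqrt_mult)

lemma l2_uminus: "u \<in> l2 \<Longrightarrow> - u \<in> l2" and l2norm_uminus: "l2norm (- u) = l2norm u"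
  by (simp_all add: l2_def l2norm_def)

lemma l2_diff:
  assumes "u \<in> l2" "w \<in> l2"
  shows "u - w \<in> l2" and "l2norm (u - w) \<le> l2norm u + l2norm w"
  using l2_add[OF assms(1) l2_uminus[OF assms(2)]] by (simp_all add: l2norm_uminus)

lemma l2norm_minus_commute: "l2norm (u - w) = l2norm (w - u)"
  using l2norm_uminus[of "u - w"] by (simp add: minus_diff_eq)

lemma l2norm_diff_triangle:
  assumes "u \<in> l2" "x \<in> l2" "w \<in> l2"
  shows "l2norm (u - w) \<le> l2norm (u - x) + l2norm (x - w)"
  using l2_add(2)[OF l2_diff(1)[OF assms(1,2)] l2_diff(1)[OF assms(2,3)]] by simp

lemma l2norm_le_diff:
  assumes "u \<in> l2" "w \<in> l2"
  shows "l2norm u \<le> l2norm (u - w) + l2norm w"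
  using l2_add(2)[OF l2_diff(1)[OF assms] assms(2)] by simp

lemma zero_l2 [simp]: "0 \<in> l2" "(\<lambda>t. 0) \<in> l2" and l2norm_zero [simp]: "l2norm 0 = 0" "l2norm (\<lambda>t. 0) = 0"
  by (simp_all add: l2_def l2norm_def)

lemma l2norm_eq_0D: "u \<in> l2 \<Longrightarrow> l2norm u \<le> 0 \<Longrightarrow> u = 0"
  using cmod_le_l2norm[of u] by (auto intro!: ext) (metis norm_le_zero_iff order.trans)

text \<open>Fatou's lemma: on each finite set pointwise convergence lets the bound pass to the
  limit. It serves where only pointwise convergence is at hand.\<close>

lemma l2_fatou:
  assumes "\<And>j. w j \<in> l2" "\<forall>\<^sub>F j in sequentially. l2norm (w j) \<le> K" "\<And>t. (\<lambda>j. w j t) \<longlonglongrightarrow> x t"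
  shows "x \<in> l2" "l2norm x \<le> K"
proof -
  have "0 \<le> K" using assms(2) eventually_happens'[of sequentially "\<lambda>j. l2norm (w j) \<le> K"]
    by (auto intro: order.trans[OF l2norm_nonneg])
  moreover have "L2_set (\<lambda>t. cmod (x t)) F \<le> K" for F
  proof (rule LIMSEQ_le_const2)
    show "(\<lambda>j. L2_set (\<lambda>t. cmod (w j t)) F) \<longlonglongrightarrow> L2_set (\<lambda>t. cmod (x t)) F"
      unfolding L2_set_def by (intro tendsto_intros assms)
    obtain N where "\<forall>j\<ge>N. l2norm (w j) \<le> K" using assms(2) by (auto simp: eventually_sequentially)
    then have "\<forall>n\<ge>N. L2_set (\<lambda>t. cmod (w n t)) F \<le> K"
      using order.trans[OF L2_set_le_l2norm[OF assms(1)]] by simp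
    then show "\<exists>N. \<forall>n\<ge>N. L2_set (\<lambda>t. cmod (w n t)) F \<le> K" ..
  qed
  ultimately show "x \<in> l2" "l2norm x \<le> K" using l2_boundI[of K x] by simp_all
qed

lemma l2norm_null:
  assumes "\<And>m. l2norm (x m) \<le> b m" "b \<longlonglongrightarrow> 0" shows "(\<lambda>m. l2norm (x m)) \<longlonglongrightarrow> 0"
  by (rule Lim_null_comparison[OF _ assms(2)]) (simp add: assms)

lemma l2_tendsto_pointwise:
  assumes "\<And>m. x m \<in> l2" "y \<in> l2" "(\<lambda>m. l2norm (x m - y)) \<longlonglongrightarrow> 0"
  shows "(\<lambda>m. x m t) \<longlonglongrightarrow> y t"
proof -
  have "(\<lambda>m. x m t - y t) \<longlonglongrightarrow> 0"
    by (rule Lim_null_comparison[OF _ assms(3)])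
      (use cmod_le_l2norm[OF l2_diff(1)[OF assms(1,2)]] in \<open>auto simp: minus_apply\<close>)
  then show ?thesis using LIM_zero_iff by blast
qed

section \<open>Coordinate projections and basis vectors\<close>

lemma Pr_UNIV [simp]: "Pr UNIV u = u" and Pr_empty [simp]: "Pr {} u = 0"
  by (auto simp: Pr_def)

lemma Pr_zero [simp]: "Pr X 0 = 0"
  by (auto simp: Pr_def)

lemma Pr_Pr: "Pr X (Pr X' u) = Pr (X \<inter> X') u"
  by (auto simp: Pr_def)

lemma Pr_diff: "Pr X (u - w) = Pr X u - Pr X w" and Pr_add: "Pr X (u + w) = Pr X u + Pr X w"
  by (auto simp: Pr_def)

lemma Pr_mono_l2:
  assumes "Pr X' u \<in> l2" "X \<subseteq> X'" shows "Pr X u \<in> l2" "l2norm (Pr X u) \<le> l2norm (Pr X' u)"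
proof -
  have "L2_set (\<lambda>t. cmod (Pr X u t)) F \<le> l2norm (Pr X' u)" for F
    by (rule order.trans[OF L2_set_mono L2_set_le_l2norm[OF assms(1)]]) (use assms in \<open>auto simp: Pr_def\<close>)
  then show "Pr X u \<in> l2" "l2norm (Pr X u) \<le> l2norm (Pr X' u)"
    using l2_boundI[of "l2norm (Pr X' u)" "Pr X u"] by auto
qed

lemma Pr_l2: assumes "u \<in> l2" shows "Pr X u \<in> l2" "l2norm (Pr X u) \<le> l2norm u"
  using Pr_mono_l2[of UNIV u X] assms by auto

lemma Pr_finite_l2: assumes "finite X" shows "Pr X u \<in> l2"
proof (rule l2_boundI)
  show "0 \<le> (\<Sum>t\<in>X. cmod (u t))" by (simp add: sum_nonneg)
  fix F :: "'a set" assume "finite F"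
  have "L2_set (\<lambda>t. cmod (Pr X u t)) F \<le> (\<Sum>t\<in>F. cmod (Pr X u t))"
    by (rule L2_set_le_sum) auto
  also have "\<dots> = (\<Sum>t\<in>F \<inter> X. cmod (u t))" using \<open>finite F\<close>
    by (intro sum.mono_neutral_cong_right) (auto simp: Pr_def)
  also have "\<dots> \<le> (\<Sum>t\<in>X. cmod (u t))" by (rule sum_mono2) (use assms in auto)
  finally show "L2_set (\<lambda>t. cmod (Pr X u t)) F \<le> (\<Sum>t\<in>X. cmod (u t))" .
qed

lemma Pr_delta: "Pr X (delta s) = (if s \<in> X then delta s else 0)"
  by (auto simp: Pr_def delta_def)

lemma delta_eq_Pr: "delta s = Pr {s} (\<lambda>t. 1)"
  by (auto simp: Pr_def delta_def)

lemma delta_l2 [simp]: "delta s \<in> l2"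
  unfolding delta_eq_Pr by (rule Pr_finite_l2) simp

lemma Pr_insert: "s \<notin> F \<Longrightarrow> Pr (insert s F) u = (\<lambda>t. u s * delta s t + Pr F u t)"
  by (auto simp: Pr_def delta_def)

lemma l2norm_delta [simp]: "l2norm (delta s) = 1"
proof -
  have "(\<Sum>\<^sub>\<infinity>t. (cmod (delta s t))\<^sup>2) = (\<Sum>\<^sub>\<infinity>t\<in>{s}. 1)"
    by (rule infsum_cong_neutral) (auto simp: delta_def)
  then show ?thesis by (simp add: l2norm_def)
qed

lemma l2norm_disjoint_add:
  assumes "u \<in> l2" "w \<in> l2" "\<And>t. u t = 0 \<or> w t = 0"
  shows "(l2norm (u + w))\<^sup>2 = (l2norm u)\<^sup>2 + (l2norm w)\<^sup>2"
proof -
  have "(cmod ((u + w) t))\<^sup>2 = (cmod (u t))\<^sup>2 + (cmod (w t))\<^sup>2" for t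
    using assms(3)[of t] by auto
  then show ?thesis using assms(1,2) by (simp add: l2norm_def infsum_nonneg l2_def infsum_add)
qed

lemma l2_tail:
  assumes "u \<in> l2" "0 < \<epsilon>" obtains F where "finite F" "l2norm (u - Pr F u) \<le> \<epsilon>"
proof -
  let ?f = "\<lambda>t. (cmod (u t))\<^sup>2"
  have s: "?f summable_on UNIV" using assms by (simp add: l2_def)
  obtain F where F: "finite F" "dist (sum ?f F) (infsum ?f UNIV) \<le> \<epsilon>\<^sup>2"
    using infsum_finite_approximation[OF s, of "\<epsilon>\<^sup>2"] assms(2) by auto
  have PF: "(l2norm (Pr F u))\<^sup>2 = sum ?f F"
  proof -
    have "(\<Sum>\<^sub>\<infinity>t. (cmod (Pr F u t))\<^sup>2) = (\<Sum>\<^sub>\<infinity>t\<in>F. ?f t)"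
      by (rule infsum_cong_neutral) (auto simp: Pr_def)
    then show ?thesis using F(1) by (simp add: l2norm_def sum_nonneg)
  qed
  \<comment> \<open>By Pythagoras the squared norm of the tail is the total sum minus its part over
    \<open>F\<close>; this is why \<open>F\<close> was chosen with accuracy
    \<open>\<epsilon>\<^sup>2\<close>.\<close>
  have "(l2norm (Pr F u + (u - Pr F u)))\<^sup>2 = (l2norm (Pr F u))\<^sup>2 + (l2norm (u - Pr F u))\<^sup>2"
    by (rule l2norm_disjoint_add) (use assms in \<open>auto intro: Pr_l2 l2_diff\<close>, auto simp: Pr_def)
  moreover have "(l2norm u)\<^sup>2 = infsum ?f UNIV" by (simp add: l2norm_def infsum_nonneg)
  ultimately have "(l2norm (u - Pr F u))\<^sup>2 \<le> \<epsilon>\<^sup>2" using F(2) PF by (simp add: dist_real_def)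
  then have "l2norm (u - Pr F u) \<le> \<epsilon>" using assms(2) by (simp add: power2_le_iff_abs_le)
  then show thesis using that F(1) by blast
qed

section \<open>Translation operators\<close>

lemma Rop_l2:
  fixes u :: "'g::group_add vec"
  assumes "u \<in> l2" shows "Rop r u \<in> l2"
  using assms summable_on_reindex_bij_betw[of "\<lambda>t. t + r" UNIV UNIV "\<lambda>t. (cmod (u t))\<^sup>2"]
  by (simp add: l2_def Rop_def bij_plus_right)

lemma l2norm_Rop [simp]:
  fixes u :: "'g::group_add vec"
  shows "l2norm (Rop r u) = l2norm u"
  using infsum_reindex_bij_betw[of "\<lambda>t. t + r" UNIV UNIV "\<lambda>t. (cmod (u t))\<^sup>2"]
  by (simp add: l2norm_def Rop_def bij_plus_right)

lemma Lop_l2: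
  fixes u :: "'g::group_add vec"
  assumes "u \<in> l2" shows "Lop r u \<in> l2" "l2norm (Lop r u) = l2norm u"
proof -
  have b: "bij (\<lambda>t. - r + t)" by (rule bij_betw_byWitness[where f' = "\<lambda>t. r + t"]) (auto simp: add.assoc[symmetric])
  show "Lop r u \<in> l2" "l2norm (Lop r u) = l2norm u"
    using assms summable_on_reindex_bij_betw[OF b, of "\<lambda>t. (cmod (u t))\<^sup>2"]
      infsum_reindex_bij_betw[OF b, of "\<lambda>t. (cmod (u t))\<^sup>2"]
    by (simp_all add: l2_def l2norm_def Lop_def)
qed

lemma Rop_Rop: "Rop r (Rop s u) = Rop (r + s) u"
  by (simp add: Rop_def add.assoc)

lemma Rop_0 [simp]: "Rop 0 u = u" by (simp add: Rop_def)

lemma Rop_delta: "Rop r (delta s) = delta (s - r)"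
  by (auto simp: Rop_def delta_def fun_eq_iff eq_diff_eq)

lemma Rop_diff: "Rop r (u - w) = Rop r u - Rop r w"
  by (auto simp: Rop_def)

lemma Rop_Pr_Rop: "Rop (- r) (Pr X (Rop r u)) = Pr {t. t - r \<in> X} u"
  by (auto simp: Rop_def Pr_def)

section \<open>Inner products and adjoints\<close>

lemma l2inner_abs_summable:
  assumes "u \<in> l2" "w \<in> l2"
  shows "(\<lambda>t. norm (u t * cnj (w t))) summable_on UNIV" "cmod (l2inner u w) \<le> l2norm u * l2norm w"
proof -
  have b: "(\<Sum>t\<in>F. norm (u t * cnj (w t))) \<le> l2norm u * l2norm w" for F
  proof -
    have "(\<Sum>t\<in>F. norm (u t * cnj (w t))) \<le> L2_set (\<lambda>t. cmod (u t)) F * L2_set (\<lambda>t. cmod (w t)) F"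
      using L2_set_mult_ineq[of "\<lambda>t. cmod (u t)" "\<lambda>t. cmod (w t)" F] by (simp add: norm_mult)
    also have "\<dots> \<le> l2norm u * l2norm w" using assms by (intro mult_mono L2_set_le_l2norm) auto
    finally show ?thesis .
  qed
  show a: "(\<lambda>t. norm (u t * cnj (w t))) summable_on UNIV"
    by (rule nonneg_bdd_above_summable_on) (auto intro!: bdd_aboveI[of _ "l2norm u * l2norm w"] b)
  show "cmod (l2inner u w) \<le> l2norm u * l2norm w" unfolding l2inner_def
    by (rule order.trans[OF norm_infsum_bound[OF a] infsum_le_finite_sums[OF a]]) (rule b)
qed

lemma l2inner_summable:
  assumes "u \<in> l2" "w \<in> l2" shows "(\<lambda>t. u t * cnj (w t)) summable_on UNIV"
  by (rule abs_summable_summable[OF l2inner_abs_summable(1)[OF assms]])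

lemma l2inner_cnj: "l2inner w u = cnj (l2inner u w)"
  unfolding l2inner_def by (simp flip: infsum_cnj add: mult.commute)

lemma l2inner_lin:
  assumes "u \<in> l2" "w \<in> l2" "x \<in> l2"
  shows "l2inner (\<lambda>t. c * u t + w t) x = c * l2inner u x + l2inner w x"
  using infsum_add[OF summable_on_cmult_right[OF l2inner_summable[OF assms(1,3)], of c]
      l2inner_summable[OF assms(2,3)]]
  by (simp add: l2inner_def distrib_right mult.assoc infsum_cmult_right')

lemma l2inner_add_left:
  assumes "u \<in> l2" "w \<in> l2" "x \<in> l2"
  shows "l2inner (u + w) x = l2inner u x + l2inner w x"
  using l2inner_lin[OF assms, of 1] by (simp add: plus_fun_def)

lemma l2inner_diff_left:
  assumes "u \<in> l2" "w \<in> l2" "x \<in> l2"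
  shows "l2inner (u - w) x = l2inner u x - l2inner w x"
  using l2inner_add_left[OF l2_diff(1)[OF assms(1,2)] assms(2,3)] by simp

lemma l2inner_add_right:
  assumes "u \<in> l2" "w \<in> l2" "x \<in> l2"
  shows "l2inner x (u + w) = l2inner x u + l2inner x w"
  using l2inner_add_left[OF assms] by (metis complex_cnj_add l2inner_cnj)

lemma l2inner_diff_right:
  assumes "u \<in> l2" "w \<in> l2" "x \<in> l2"
  shows "l2inner x (u - w) = l2inner x u - l2inner x w"
  using l2inner_diff_left[OF assms] by (metis complex_cnj_diff l2inner_cnj)

lemma l2inner_scale_left: "l2inner (\<lambda>t. c * u t) x = c * l2inner u x"
  by (simp add: l2inner_def mult.assoc infsum_cmult_right')

lemma l2inner_scale_right: "l2inner x (\<lambda>t. c * u t) = cnj c * l2inner x u"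
  by (metis l2inner_scale_left l2inner_cnj complex_cnj_mult)

lemma l2inner_Pr_right:
  assumes "finite F" shows "l2inner u (Pr F w) = (\<Sum>t\<in>F. u t * cnj (w t))"
proof -
  have "l2inner u (Pr F w) = (\<Sum>\<^sub>\<infinity>t\<in>F. u t * cnj (w t))"
    unfolding l2inner_def by (rule infsum_cong_neutral) (auto simp: Pr_def)
  then show ?thesis using assms by simp
qed

lemma l2inner_Pr_left:
  assumes "finite F" shows "l2inner (Pr F u) w = (\<Sum>t\<in>F. u t * cnj (w t))"
proof -
  have "l2inner (Pr F u) w = (\<Sum>\<^sub>\<infinity>t\<in>F. u t * cnj (w t))"
    unfolding l2inner_def by (rule infsum_cong_neutral) (auto simp: Pr_def)
  then show ?thesis using assms by simp
qed

lemma l2inner_delta_right [simp]: "l2inner u (delta s) = u s"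
  unfolding delta_eq_Pr by (subst l2inner_Pr_right) auto

lemma l2inner_delta_left [simp]: "l2inner (delta s) u = cnj (u s)"
  by (subst l2inner_cnj) simp

lemma l2inner_self: "u \<in> l2 \<Longrightarrow> l2inner u u = complex_of_real ((l2norm u)\<^sup>2)"
proof -
  assume "u \<in> l2"
  then have "((\<lambda>t. (cmod (u t))\<^sup>2) has_sum (l2norm u)\<^sup>2) UNIV"
    by (simp add: l2_def l2norm_def infsum_nonneg)
  then have "((\<lambda>t. complex_of_real ((cmod (u t))\<^sup>2)) has_sum complex_of_real ((l2norm u)\<^sup>2)) UNIV"
    by (rule has_sum_of_real)
  then have "((\<lambda>t. u t * cnj (u t)) has_sum complex_of_real ((l2norm u)\<^sup>2)) UNIV"
    unfolding complex_norm_square .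
  then show ?thesis unfolding l2inner_def by (rule infsumI)
qed

section \<open>Bounded operators with an explicit constant\<close>

text \<open>Unlike \<open>bounded_op\<close>, the constant is a parameter, so that one bound can be
  asserted for all members of a sequence. Its nonnegativity is included because estimates are
  repeatedly multiplied by it.\<close>

definition opb :: "real \<Rightarrow> 'g op \<Rightarrow> bool" where
  "opb K B \<longleftrightarrow> 0 \<le> K \<and> (\<forall>u\<in>l2. B u \<in> l2 \<and> l2norm (B u) \<le> K * l2norm u)
     \<and> (\<forall>u\<in>l2. \<forall>w\<in>l2. \<forall>c. B (\<lambda>t. c * u t + w t) = (\<lambda>t. c * B u t + B w t))"

lemma bounded_op_iff_opb: "bounded_op B \<longleftrightarrow> (\<exists>K. opb K B)"
proof
  assume "bounded_op B"
  then obtain C where C: "\<forall>u\<in>l2. l2norm (B u) \<le> C * l2norm u" unfolding bounded_op_def by blast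
  have "l2norm (B u) \<le> max C 0 * l2norm u" if "u \<in> l2" for u
    by (rule order.trans[OF C[rule_format, OF that] mult_right_mono]) auto
  then show "\<exists>K. opb K B" using \<open>bounded_op B\<close>
    unfolding bounded_op_def opb_def by (intro exI[of _ "max C 0"]) auto
qed (auto simp: bounded_op_def opb_def)

lemma opbD:
  assumes "opb K B"
  shows "0 \<le> K" and "\<And>u. u \<in> l2 \<Longrightarrow> B u \<in> l2" and "\<And>u. u \<in> l2 \<Longrightarrow> l2norm (B u) \<le> K * l2norm u"
    and "\<And>u w c. u \<in> l2 \<Longrightarrow> w \<in> l2 \<Longrightarrow> B (\<lambda>t. c * u t + w t) = (\<lambda>t. c * B u t + B w t)"
  using assms by (auto simp: opb_def)

lemma l2_lin: "u \<in> l2 \<Longrightarrow> w \<in> l2 \<Longrightarrow> (\<lambda>t. c * u t + w t) \<in> l2"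
  using l2_add(1)[OF l2_scale[of u c], of w] by (simp add: plus_fun_def)

lemma opb_add_arg: "opb K B \<Longrightarrow> u \<in> l2 \<Longrightarrow> w \<in> l2 \<Longrightarrow> B (u + w) = B u + B w"
  using opbD(4)[of K B u w 1] by (simp add: plus_fun_def)

lemma opb_diff_arg: "opb K B \<Longrightarrow> u \<in> l2 \<Longrightarrow> w \<in> l2 \<Longrightarrow> B (u - w) = B u - B w"
  using opb_add_arg[of K B "u - w" w] by (simp add: l2_diff)

lemma opb_zero_arg: "opb K B \<Longrightarrow> B 0 = 0"
  using opb_diff_arg[of K B 0 0] by simp

lemma opb_add:
  assumes "opb K B" "opb L C" shows "opb (K + L) (B + C)"
  unfolding opb_def
proof (intro conjI ballI allI)
  show "0 \<le> K + L" using assms by (simp add: opbD)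
  fix u :: "'a vec" assume u: "u \<in> l2"
  show "(B + C) u \<in> l2" using u assms by (simp add: opbD l2_add)
  have "l2norm (B u + C u) \<le> l2norm (B u) + l2norm (C u)" using u assms by (simp add: opbD l2_add)
  also have "\<dots> \<le> K * l2norm u + L * l2norm u" by (rule add_mono[OF opbD(3)[OF assms(1) u] opbD(3)[OF assms(2) u]])
  finally show "l2norm ((B + C) u) \<le> (K + L) * l2norm u" by (simp add: distrib_right)
next
  fix u w :: "'a vec" and c assume "u \<in> l2" "w \<in> l2"
  then show "(B + C) (\<lambda>t. c * u t + w t) = (\<lambda>t. c * (B + C) u t + (B + C) w t)"
    using opbD(4)[OF assms(1)] opbD(4)[OF assms(2)] by (simp add: fun_eq_iff distrib_left add_ac)
qed

lemma opb_scale: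
  assumes "opb K B" shows "opb (cmod c * K) (\<lambda>u t. c * B u t)"
  unfolding opb_def
proof (intro conjI ballI allI)
  show "0 \<le> cmod c * K" using assms by (simp add: opbD)
  fix u :: "'a vec" assume u: "u \<in> l2"
  show "(\<lambda>t. c * B u t) \<in> l2" using u assms by (simp add: opbD l2_scale)
  show "l2norm (\<lambda>t. c * B u t) \<le> cmod c * K * l2norm u"
    using mult_left_mono[OF opbD(3)[OF assms u], of "cmod c"] by (simp add: l2norm_scale mult.assoc)
next
  fix u w :: "'a vec" and d assume "u \<in> l2" "w \<in> l2"
  then show "(\<lambda>t. c * B (\<lambda>t. d * u t + w t) t) = (\<lambda>t. d * (c * B u t) + c * B w t)"
    using opbD(4)[OF assms] by (simp add: distrib_left mult.left_commute)
qed

lemma opb_diff: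
  assumes "opb K B" "opb L C" shows "opb (K + L) (B - C)"
  using opb_add[OF assms(1) opb_scale[OF assms(2), of "-1"]]
  by (simp add: plus_fun_def fun_diff_def)

lemma opb_comp:
  assumes "opb K B" "opb L C" shows "opb (K * L) (B \<circ> C)"
proof -
  have "l2norm (B (C u)) \<le> K * L * l2norm u" if u: "u \<in> l2" for u
  proof -
    have "l2norm (B (C u)) \<le> K * l2norm (C u)" using u assms by (simp add: opbD)
    also have "\<dots> \<le> K * (L * l2norm u)" by (rule mult_left_mono[OF opbD(3)[OF assms(2) u] opbD(1)[OF assms(1)]])
    finally show ?thesis by simp
  qed
  then show ?thesis using assms by (simp add: opb_def)
qed

lemma opb_Pr: "opb 1 (Pr X)"
  by (auto simp: opb_def Pr_l2) (auto simp: Pr_def)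

lemma opb_Rop: "opb 1 (Rop r)"
  by (auto simp: opb_def Rop_l2) (auto simp: Rop_def)

lemma opb_Lop: "opb 1 (Lop r)"
  by (auto simp: opb_def Lop_l2) (auto simp: Lop_def)

lemma opb_conj: assumes "opb K B" shows "opb K (Rop (- h) \<circ> B \<circ> Rop h)"
  using opb_comp[OF opb_comp[OF opb_Rop assms] opb_Rop] by simp

text \<open>The bound survives by \<open>l2_fatou\<close> and linearity by uniqueness of pointwise
  limits, so no norm convergence is required.\<close>

lemma opb_limit:
  assumes "\<And>n. opb K (Bs n)" "\<And>u t. u \<in> l2 \<Longrightarrow> (\<lambda>n. Bs n u t) \<longlonglongrightarrow> B u t"
  shows "opb K B"
  unfolding opb_def
proof (intro conjI ballI allI)
  show "0 \<le> K" using assms(1) opbD(1) by blast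
  fix u :: "'a vec" assume u: "u \<in> l2"
  show "B u \<in> l2" "l2norm (B u) \<le> K * l2norm u"
    using l2_fatou[of "\<lambda>n. Bs n u" "K * l2norm u" "B u"] opbD(2,3)[OF assms(1) u] assms(2)[OF u] by simp_all
next
  fix u w :: "'a vec" and c assume uw: "u \<in> l2" "w \<in> l2"
  have l: "(\<lambda>t. c * u t + w t) \<in> l2" using uw by (rule l2_lin)
  show "B (\<lambda>t. c * u t + w t) = (\<lambda>t. c * B u t + B w t)"
  proof
    fix t
    have "(\<lambda>n. Bs n (\<lambda>t. c * u t + w t) t) \<longlonglongrightarrow> c * B u t + B w t"
      unfolding opbD(4)[OF assms(1) uw] by (intro tendsto_intros assms uw)
    then show "B (\<lambda>t. c * u t + w t) t = c * B u t + B w t"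
      using LIMSEQ_unique assms(2)[OF l] by blast
  qed
qed

text \<open>Split \<open>u\<close> into a finitely supported part, handled by linearity, and a small
  tail, on which the uniform bound acts for all \<open>m\<close> at once.\<close>

lemma opb_strong_null:
  assumes "\<And>m. opb K (D m)" "\<And>s. (\<lambda>m. l2norm (D m (delta s))) \<longlonglongrightarrow> 0" "u \<in> l2"
  shows "(\<lambda>m. l2norm (D m u)) \<longlonglongrightarrow> 0"
proof -
  have fin: "(\<lambda>m. l2norm (D m (Pr F u))) \<longlonglongrightarrow> 0" if "finite F" for F
    using that
  proof (induction F)
    case empty
    have "D m 0 = 0" for m using assms(1) opb_zero_arg by blast
    then show ?case by (simp add: zero_fun_def)
  next
    case (insert s F)
    have "l2norm (D m (Pr (insert s F) u)) \<le> cmod (u s) * l2norm (D m (delta s)) + l2norm (D m (Pr F u))" for m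
    proof -
      have e: "D m (Pr (insert s F) u) = (\<lambda>t. u s * D m (delta s) t) + D m (Pr F u)"
        using opbD(4)[OF assms(1) delta_l2 Pr_finite_l2] insert.hyps by (simp add: Pr_insert plus_fun_def)
      have "l2norm (D m (Pr (insert s F) u)) \<le> l2norm (\<lambda>t. u s * D m (delta s) t) + l2norm (D m (Pr F u))"
        unfolding e by (intro l2_add l2_scale opbD(2)[OF assms(1)] Pr_finite_l2 delta_l2 insert.hyps)
      then show ?thesis by (simp add: l2norm_scale)
    qed
    moreover have "(\<lambda>m. cmod (u s) * l2norm (D m (delta s)) + l2norm (D m (Pr F u))) \<longlonglongrightarrow> 0"
      by (rule tendsto_eq_intros tendsto_mult_right_zero assms insert.IH)+ simp
    ultimately show ?case by (rule l2norm_null)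
  qed
  have K: "0 \<le> K" using assms(1) opbD(1) by blast
  show ?thesis
  proof (rule LIMSEQ_I)
    fix e :: real assume e: "0 < e"
    \<comment> \<open>The tail is to cost at most \<open>e / 2\<close>; \<open>K + 1\<close> keeps
      the denominator positive when \<open>K = 0\<close>.\<close>
    then obtain F where F: "finite F" "l2norm (u - Pr F u) \<le> e / (2 * (K + 1))"
      using l2_tail[OF assms(3), of "e / (2 * (K + 1))"] K by auto
    have "\<forall>\<^sub>F m in sequentially. l2norm (D m (Pr F u)) < e / 2"
      using order_tendstoD(2)[OF fin[OF F(1)], of "e/2"] e by simp
    then obtain N where N: "\<And>m. N \<le> m \<Longrightarrow> l2norm (D m (Pr F u)) < e / 2"
      unfolding eventually_sequentially by blast
    have "l2norm (D m u) < e" if "N \<le> m" for m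
    proof -
      have "l2norm (D m u) \<le> l2norm (D m u - D m (Pr F u)) + l2norm (D m (Pr F u))"
        by (intro l2norm_le_diff opbD(2)[OF assms(1)] Pr_l2 assms)
      also have "D m u - D m (Pr F u) = D m (u - Pr F u)"
        using opb_diff_arg[OF assms(1) assms(3) Pr_l2(1)[OF assms(3)]] by simp
      also have "l2norm \<dots> \<le> K * l2norm (u - Pr F u)"
        by (intro opbD(3)[OF assms(1)] l2_diff Pr_l2 assms)
      also have "\<dots> \<le> (K + 1) * (e / (2 * (K + 1)))" using K F(2) by (intro mult_mono) auto
      also have "\<dots> = e / 2" using K by (simp add: field_simps)
      finally show ?thesis using N[OF that] by simp
    qed
    then show "\<exists>no. \<forall>n\<ge>no. norm (l2norm (D n u) - 0) < e" by auto
  qed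
qed

section \<open>Existence and uniqueness of adjoints\<close>

text \<open>The squared norm of \<open>C w\<close> equals the inner product of
  \<open>B (C w)\<close> with \<open>w\<close>; Cauchy-Schwarz bounds it, and one factor
  \<open>l2norm (C w)\<close> cancels. Linearity is read off from the matrix entries.\<close>

lemma is_adj_opb:
  assumes "is_adj B C" "opb K B" shows "opb K C"
proof -
  have l: "C u \<in> l2" "B u \<in> l2" if "u \<in> l2" for u using assms that by (auto simp: is_adj_def)
  have a: "l2inner (B u) w = l2inner u (C w)" if "u \<in> l2" "w \<in> l2" for u w
    using assms that by (auto simp: is_adj_def)
  have "l2norm (C w) \<le> K * l2norm w" if w: "w \<in> l2" for w
  proof -
    have "(l2norm (C w))\<^sup>2 = cmod (l2inner (B (C w)) w)"
      using a[OF l(1)[OF w] w] l2inner_self[OF l(1)[OF w]] by (simp add: norm_power)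
    also have "\<dots> \<le> l2norm (B (C w)) * l2norm w" using w l by (intro l2inner_abs_summable) auto
    also have "\<dots> \<le> K * l2norm (C w) * l2norm w" using w l by (intro mult_right_mono opbD(3)[OF assms(2)]) auto
    finally have *: "l2norm (C w) * l2norm (C w) \<le> l2norm (C w) * (K * l2norm w)"
      by (simp add: power2_eq_square mult_ac)
    show ?thesis
    proof (cases "l2norm (C w) = 0")
      case True
      then show ?thesis using opbD(1)[OF assms(2)] by simp
    next
      case False
      then have "0 < l2norm (C w)" using l2norm_nonneg[of "C w"] by linarith
      then show ?thesis using * mult_le_cancel_left_pos by blast
    qed
  qed
  moreover have "C (\<lambda>t. c * u t + w t) = (\<lambda>t. c * C u t + C w t)" if uw: "u \<in> l2" "w \<in> l2" for c u w
  proof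
    fix s
    have lin: "(\<lambda>t. c * u t + w t) \<in> l2" using uw by (rule l2_lin)
    have "cnj (C x s) = cnj (l2inner x (B (delta s)))" if "x \<in> l2" for x
      using a[OF delta_l2 that, of s] l2inner_cnj[of "B (delta s)" x] by simp
    then have "C x s = l2inner x (B (delta s))" if "x \<in> l2" for x using that complex_cnj_cancel_iff by blast
    then show "C (\<lambda>t. c * u t + w t) s = c * C u s + C w s"
      using uw lin l2inner_lin[OF uw l(2)[OF delta_l2]] by simp
  qed
  ultimately show ?thesis using l opbD(1)[OF assms(2)] by (auto simp: opb_def)
qed

text \<open>Testing the adjoint relation on \<open>delta s\<close> recovers the value at
  \<open>s\<close>. An adjoint is therefore determined on \<open>l2\<close>, and every later
  computation of an adjoint goes through this formula.\<close>

lemma is_adj_matrix: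
  assumes "is_adj B C" "w \<in> l2" shows "C w s = l2inner w (B (delta s))"
proof -
  have "l2inner (B (delta s)) w = l2inner (delta s) (C w)" using assms by (simp add: is_adj_def)
  then have "cnj (C w s) = cnj (l2inner w (B (delta s)))"
    using l2inner_cnj[of "B (delta s)" w] by simp
  then show ?thesis using complex_cnj_cancel_iff by blast
qed

lemma is_adj_unique: "is_adj B C \<Longrightarrow> is_adj B C' \<Longrightarrow> op_eq C C'"
  by (auto simp: op_eq_def is_adj_matrix)

lemma is_adj_sym: "is_adj B C \<Longrightarrow> is_adj C B"
  unfolding is_adj_def by (metis l2inner_cnj)

lemma is_adj_cong: "is_adj B C \<Longrightarrow> op_eq B B' \<Longrightarrow> op_eq C C' \<Longrightarrow> is_adj B' C'"
  by (auto simp: op_eq_def is_adj_def)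

text \<open>The matrix formula leaves only one candidate \<open>C\<close>. Square-summability of
  \<open>C w\<close> comes from duality, and the adjoint relation, clear for finitely supported
  vectors by linearity, extends to \<open>l2\<close> by cutting off tails.\<close>

lemma is_adj_exists:
  assumes "opb K B" shows "\<exists>C. is_adj B C"
proof -
  define C where "C w = (\<lambda>s. l2inner w (B (delta s)))" for w
  have fin: "l2inner w (B (Pr F u)) = (\<Sum>s\<in>F. cnj (u s) * C w s)" if "finite F" "w \<in> l2" for F u w
    using that(1)
  proof (induction F)
    case empty
    then show ?case using opb_zero_arg[OF assms] by (simp add: l2inner_def zero_fun_def)
  next
    case (insert s F)
    have e: "B (Pr (insert s F) u) = (\<lambda>t. u s * B (delta s) t) + B (Pr F u)"
      using opbD(4)[OF assms delta_l2 Pr_finite_l2] insert.hyps by (simp add: Pr_insert plus_fun_def)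
    have "l2inner w (B (Pr (insert s F) u)) = l2inner w (\<lambda>t. u s * B (delta s) t) + l2inner w (B (Pr F u))"
      unfolding e
      by (intro l2inner_add_right l2_scale opbD(2)[OF assms] Pr_finite_l2 delta_l2 insert.hyps that(2))
    then show ?case using insert by (simp add: l2inner_scale_right C_def)
  qed
  have Cl: "C w \<in> l2" if w: "w \<in> l2" for w
  proof (rule l2_boundI)
    show "0 \<le> K * l2norm w" using assms by (simp add: opbD)
    fix F :: "'a set" assume F: "finite F"
    \<comment> \<open>With this test vector the inner product of \<open>w\<close> with
      \<open>B ?x\<close> is exactly the squared norm of \<open>C w\<close> on \<open>F\<close>,
      while boundedness of \<open>B\<close> makes it at most \<open>K * l2norm w\<close> times that
      norm.\<close>
    let ?x = "Pr F (C w)" and ?N = "L2_set (\<lambda>t. cmod (C w t)) F"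
    have n: "l2norm ?x \<le> ?N"
    proof (rule l2_boundI)
      fix F' :: "'a set" assume "finite F'"
      have "(\<Sum>t\<in>F'. (cmod (?x t))\<^sup>2) = (\<Sum>t\<in>F' \<inter> F. (cmod (C w t))\<^sup>2)"
        using \<open>finite F'\<close> by (intro sum.mono_neutral_cong_right) (auto simp: Pr_def)
      also have "\<dots> \<le> (\<Sum>t\<in>F. (cmod (C w t))\<^sup>2)" using F by (intro sum_mono2) auto
      finally show "L2_set (\<lambda>t. cmod (?x t)) F' \<le> ?N" by (simp add: L2_set_def)
    qed simp
    have "(\<Sum>s\<in>F. cnj (C w s) * C w s) = complex_of_real (?N\<^sup>2)"
      by (simp add: L2_set_def sum_nonneg mult.commute complex_norm_square[symmetric])
    then have "?N\<^sup>2 = cmod (l2inner w (B ?x))" using fin[OF F w, of "C w"] by (simp add: norm_power)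
    also have "\<dots> \<le> l2norm w * l2norm (B ?x)"
      using w F assms by (intro l2inner_abs_summable) (auto intro: opbD(2)[OF assms] Pr_finite_l2)
    also have "\<dots> \<le> l2norm w * (K * ?N)"
      using opbD(3)[OF assms Pr_finite_l2[OF F, of "C w"]] mult_left_mono[OF n opbD(1)[OF assms]]
      by (intro mult_left_mono) auto
    finally have *: "?N * ?N \<le> ?N * (K * l2norm w)" by (simp add: power2_eq_square mult_ac)
    show "?N \<le> K * l2norm w"
    proof (cases "?N = 0")
      case True
      then show ?thesis using opbD(1)[OF assms] by simp
    next
      case False
      then have "0 < ?N" using L2_set_nonneg[of "\<lambda>t. cmod (C w t)" F] by linarith
      then show ?thesis using * mult_le_cancel_left_pos by blast
    qed
  qed
  have "l2inner (B u) w = l2inner u (C w)" if u: "u \<in> l2" and w: "w \<in> l2" for u w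
  proof -
    have "cmod (l2inner (B u) w - l2inner u (C w)) \<le> \<epsilon>" if "\<epsilon> > 0" for \<epsilon>
    proof -
      \<comment> \<open>Both sides of the relation are bounded linear functionals of
        \<open>u\<close>; \<open>M\<close> is the sum of their bounds, so a tail of norm at most
        \<open>\<epsilon> / (M + 1)\<close> changes the difference by at most \<epsilon>.\<close>
      define M where "M = K * l2norm w + l2norm (C w)"
      have M: "0 \<le> M" using assms by (simp add: opbD M_def)
      obtain F where F: "finite F" "l2norm (u - Pr F u) \<le> \<epsilon> / (M + 1)"
        using l2_tail[OF u, of "\<epsilon> / (M + 1)"] M \<open>\<epsilon> > 0\<close> by auto
      let ?d = "u - Pr F u"
      have d: "?d \<in> l2" and PF: "Pr F u \<in> l2" using u by (auto intro: l2_diff Pr_l2)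
      have eq: "l2inner (B (Pr F u)) w = l2inner (Pr F u) (C w)"
        using fin[OF F(1) w, of u] by (subst l2inner_cnj) (simp add: l2inner_Pr_left F)
      have "l2inner (B u) w - l2inner u (C w) = l2inner (B ?d) w - l2inner ?d (C w)"
        using eq u w PF Cl assms by (simp add: opb_diff_arg[OF assms] l2inner_diff_left opbD)
      also have "cmod \<dots> \<le> cmod (l2inner (B ?d) w) + cmod (l2inner ?d (C w))" by (rule norm_triangle_ineq4)
      also have "\<dots> \<le> l2norm (B ?d) * l2norm w + l2norm ?d * l2norm (C w)"
        using d w Cl assms by (intro add_mono l2inner_abs_summable) (auto intro: opbD(2)[OF assms])
      also have "\<dots> \<le> (K * l2norm ?d) * l2norm w + l2norm ?d * l2norm (C w)"
        using d by (intro add_mono mult_right_mono opbD(3)[OF assms]) auto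
      also have "\<dots> = l2norm ?d * M" by (simp add: M_def algebra_simps)
      also have "\<dots> \<le> \<epsilon> / (M + 1) * (M + 1)" using F(2) M \<open>\<epsilon> > 0\<close> by (intro mult_mono) auto
      also have "\<dots> = \<epsilon>" using M by simp
      finally show ?thesis .
    qed
    then have "cmod (l2inner (B u) w - l2inner u (C w)) \<le> 0" by (rule dense_ge)
    then show ?thesis by simp
  qed
  then show ?thesis using Cl assms unfolding is_adj_def by (auto intro: opbD(2)[OF assms])
qed

lemma is_adj_add:
  assumes "is_adj B Bs" "is_adj C Cs" shows "is_adj (B + C) (Bs + Cs)"
  using assms by (simp add: is_adj_def l2_add l2inner_add_left l2inner_add_right)

lemma is_adj_diff:
  assumes "is_adj B Bs" "is_adj C Cs" shows "is_adj (B - C) (Bs - Cs)"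
  using assms by (simp add: is_adj_def l2_diff l2inner_diff_left l2inner_diff_right)

lemma is_adj_scale:
  assumes "is_adj B Bs" shows "is_adj (\<lambda>u t. c * B u t) (\<lambda>u t. cnj c * Bs u t)"
  using assms by (simp add: is_adj_def l2_scale l2inner_scale_left l2inner_scale_right)

lemma is_adj_comp:
  assumes "is_adj B Bs" "is_adj C Cs" shows "is_adj (B \<circ> C) (Cs \<circ> Bs)"
  using assms by (simp add: is_adj_def)

lemma is_adj_Pr: "is_adj (Pr X) (Pr X)"
  by (simp add: is_adj_def Pr_l2, auto simp: l2inner_def Pr_def intro!: infsum_cong)

lemma is_adj_Rop: "is_adj (Rop r) (Rop (- r :: 'g::group_add))"
proof -
  have "(\<Sum>\<^sub>\<infinity>t. u (t + r) * cnj (w t)) = (\<Sum>\<^sub>\<infinity>t. u t * cnj (w (t + - r)))" for u w :: "'g vec"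
    using infsum_reindex_bij_betw[OF bij_plus_right[of r], of "\<lambda>t. u t * cnj (w (t + - r))"]
    by (simp add: add.assoc)
  then show ?thesis by (simp add: is_adj_def Rop_l2, simp add: l2inner_def Rop_def)
qed

lemma is_adj_Lop: "is_adj (Lop r) (Lop (- r :: 'g::group_add))"
proof -
  have b: "bij (\<lambda>t. - r + t)" by (rule bij_betw_byWitness[where f' = "\<lambda>t. r + t"]) (auto simp: add.assoc[symmetric])
  have "(\<Sum>\<^sub>\<infinity>t. u (- r + t) * cnj (w t)) = (\<Sum>\<^sub>\<infinity>t. u t * cnj (w (r + t)))" for u w :: "'g vec"
    using infsum_reindex_bij_betw[OF b, of "\<lambda>t. u t * cnj (w (r + t))"]
    by (simp add: add.assoc[symmetric])
  then show ?thesis by (simp add: is_adj_def Lop_l2, simp add: l2inner_def Lop_def)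
qed

lemma is_adj_conj: "is_adj B Bs \<Longrightarrow> is_adj (Rop (- h) \<circ> B \<circ> Rop h) (Rop (- h) \<circ> Bs \<circ> Rop h)"
  using is_adj_comp[OF is_adj_comp[OF is_adj_Rop[of "- h"], of B Bs] is_adj_Rop[of h]]
  by (simp add: comp_assoc)

section \<open>Uniformly quasi-local sequences\<close>

text \<open>Decay of the matrix columns away from the diagonal, uniform in \<open>n\<close> and
  \<open>s\<close>. The offset \<open>t - s\<close> is the one left unchanged when \<open>t\<close>
  and \<open>s\<close> are moved by a common right translation, hence it is adapted to conjugation
  by \<open>Rop h\<close>.\<close>

definition quasi_local :: "(nat \<Rightarrow> 'g::group_add op) \<Rightarrow> bool" where
  "quasi_local T \<longleftrightarrow> (\<forall>\<epsilon>>0. \<exists>G. finite G \<and>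
     (\<forall>n s. l2norm (Pr {t. t - s \<notin> G} (T n (delta s))) \<le> \<epsilon>))"

text \<open>A Cauchy condition in two indices: it can be verified for sums and products without
  knowing any limit operator. The set \<open>G\<close> must not depend on \<open>s\<close>, since
  later \<open>s\<close> moves off to infinity.\<close>

definition consistent :: "(nat \<Rightarrow> 'g set) \<Rightarrow> (nat \<Rightarrow> 'g::group_add op) \<Rightarrow> bool" where
  "consistent Y T \<longleftrightarrow> (\<forall>\<epsilon>>0. \<exists>G. finite G \<and>
     (\<forall>m n s. (\<forall>g\<in>G. g + s \<in> Y m \<and> g + s \<in> Y n) \<longrightarrow> l2norm (T m (delta s) - T n (delta s)) \<le> \<epsilon>))"

lemma quasi_localI:
  assumes "\<And>\<epsilon>. \<epsilon> > 0 \<Longrightarrow> \<exists>G. finite G \<and> (\<forall>n s. l2norm (Pr {t. t - s \<notin> G} (T n (delta s))) \<le> \<epsilon>)"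
  shows "quasi_local T"
  using assms by (simp add: quasi_local_def)

lemma quasi_localE:
  assumes "quasi_local T" "\<epsilon> > 0"
  obtains G where "finite G" "\<And>n s. l2norm (Pr {t. t - s \<notin> G} (T n (delta s))) \<le> \<epsilon>"
  using assms unfolding quasi_local_def by blast

lemma consistentI:
  assumes "\<And>\<epsilon>. \<epsilon> > 0 \<Longrightarrow> \<exists>G. finite G \<and>
     (\<forall>m n s. (\<forall>g\<in>G. g + s \<in> Y m \<and> g + s \<in> Y n) \<longrightarrow> l2norm (T m (delta s) - T n (delta s)) \<le> \<epsilon>)"
  shows "consistent Y T"
  using assms by (simp add: consistent_def)

lemma consistentE:
  assumes "consistent Y T" "\<epsilon> > 0"
  obtains G where "finite G"
    "\<And>m n s. (\<And>g. g \<in> G \<Longrightarrow> g + s \<in> Y m \<and> g + s \<in> Y n) \<Longrightarrow> l2norm (T m (delta s) - T n (delta s)) \<le> \<epsilon>"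
proof -
  from assms obtain G where "finite G" "\<forall>m n s. (\<forall>g\<in>G. g + s \<in> Y m \<and> g + s \<in> Y n)
      \<longrightarrow> l2norm (T m (delta s) - T n (delta s)) \<le> \<epsilon>"
    unfolding consistent_def by meson
  then show thesis by (intro that[of G]) auto
qed

lemma opb_Pr_arg_bound:
  fixes K L e :: real
  assumes "opb K D" "finite F" "\<And>q. q \<in> F \<Longrightarrow> l2norm (D (delta q)) \<le> e" "\<And>q. q \<in> F \<Longrightarrow> cmod (x q) \<le> L"
  shows "l2norm (D (Pr F x)) \<le> card F * (L * e)"
  using assms(2-4)
proof (induction F)
  case empty
  then show ?case using opb_zero_arg[OF assms(1)] by (simp add: zero_fun_def)
next
  case (insert s F)
  have e: "D (Pr (insert s F) x) = (\<lambda>t. x s * D (delta s) t) + D (Pr F x)"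
    using opbD(4)[OF assms(1) delta_l2 Pr_finite_l2] insert.hyps by (simp add: Pr_insert plus_fun_def)
  have "l2norm (D (Pr (insert s F) x)) \<le> l2norm (\<lambda>t. x s * D (delta s) t) + l2norm (D (Pr F x))"
    unfolding e by (intro l2_add l2_scale opbD(2)[OF assms(1)] Pr_finite_l2 delta_l2 insert.hyps)
  also have "l2norm (\<lambda>t. x s * D (delta s) t) \<le> L * e"
    unfolding l2norm_scale using insert.prems(1,2)[of s] norm_ge_zero[of "x s"]
    by (intro mult_mono) (auto intro: order.trans[OF norm_ge_zero])
  also have "l2norm (D (Pr F x)) \<le> card F * (L * e)" using insert by simp
  finally show ?case using insert.hyps by (simp add: algebra_simps)
qed

text \<open>The estimate behind all products: off \<open>F\<close> the vector is small and
  \<open>D\<close> bounded, on \<open>F\<close> the operator is small on each of finitely many basis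
  vectors. The crude factor \<open>card F\<close> is harmless because \<open>F\<close> is fixed
  before \<open>e\<close> is chosen.\<close>

lemma opb_split_bound:
  fixes M L e e' :: real
  assumes "opb M D" "x \<in> l2" "l2norm x \<le> L" "finite F" "l2norm (Pr (- F) x) \<le> e'"
    "\<And>q. q \<in> F \<Longrightarrow> l2norm (D (delta q)) \<le> e"
  shows "l2norm (D x) \<le> M * e' + card F * (L * e)"
proof -
  have x: "x = Pr (- F) x + Pr F x" by (auto simp: Pr_def fun_eq_iff)
  have "D x = D (Pr (- F) x) + D (Pr F x)"
    using opb_add_arg[OF assms(1) Pr_l2(1)[OF assms(2)] Pr_l2(1)[OF assms(2)], of "- F" F] x by simp
  then have "l2norm (D x) \<le> l2norm (D (Pr (- F) x)) + l2norm (D (Pr F x))"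
    using l2_add(2) opbD(2)[OF assms(1)] Pr_l2(1)[OF assms(2)] by metis
  also have "l2norm (D (Pr (- F) x)) \<le> M * l2norm (Pr (- F) x)"
    by (rule opbD(3)[OF assms(1) Pr_l2(1)[OF assms(2)]])
  also have "\<dots> \<le> M * e'" by (rule mult_left_mono[OF assms(5) opbD(1)[OF assms(1)]])
  also have "l2norm (D (Pr F x)) \<le> card F * (L * e)"
    by (rule opb_Pr_arg_bound[OF assms(1,4,6) order.trans[OF cmod_le_l2norm[OF assms(2)] assms(3)]])
  finally show ?thesis by simp
qed

lemma finite_setmul: "finite A \<Longrightarrow> finite B \<Longrightarrow> finite (setmul A B)"
  unfolding setmul_def by (simp add: finite_image_set2)

lemma translate_eq: "{t. t - s \<in> G} = (\<lambda>g. g + s) ` (G :: 'g::group_add set)"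
  by (force simp: image_iff)

text \<open>The cardinality is independent of \<open>s\<close>; this keeps the factor
  \<open>card F\<close> of \<open>opb_split_bound\<close> uniform in the base point.\<close>

lemma translate_finite: "finite G \<Longrightarrow> finite {t. t - s \<in> (G :: 'g::group_add set)}"
  and translate_card: "card {t. t - s \<in> (G :: 'g::group_add set)} = card G"
  unfolding translate_eq by (auto intro: card_image inj_onI)

text \<open>The accuracies to be fed into \<open>opb_split_bound\<close> so that each of its two
  terms is at most \<open>\<epsilon> / 2\<close>; the added 1 keeps the denominators
  positive.\<close>

lemma split_constants:
  fixes K L \<epsilon> :: real
  assumes "0 \<le> K" "0 \<le> L" "0 < \<epsilon>"
  shows "K * (\<epsilon> / (2 * (K + 1))) + real N * (L * (\<epsilon> / (2 * (real N * L + 1)))) \<le> \<epsilon>"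
proof -
  have "K * (\<epsilon> / (2 * (K + 1))) \<le> \<epsilon> / 2" using assms by (simp add: field_simps)
  moreover have "real N * (L * (\<epsilon> / (2 * (real N * L + 1)))) \<le> \<epsilon> / 2"
  proof -
    have "0 < real N * L + 1" using assms by (simp add: add_nonneg_pos)
    then show ?thesis using assms by (simp add: field_simps)
  qed
  ultimately show ?thesis by linarith
qed

section \<open>Permanence properties of quasi-locality\<close>

lemma quasi_local_approx:
  assumes "\<And>n s. T n (delta s) \<in> l2"
    and "\<And>\<epsilon>. \<epsilon> > 0 \<Longrightarrow> \<exists>T'. quasi_local T' \<and> (\<forall>n s. T' n (delta s) \<in> l2 \<and> l2norm (T n (delta s) - T' n (delta s)) \<le> \<epsilon>)"
  shows "quasi_local T"
proof (rule quasi_localI)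
  fix \<epsilon> :: real assume "\<epsilon> > 0"
  then obtain T' where T': "quasi_local T'" "\<And>n s. T' n (delta s) \<in> l2"
    "\<And>n s. l2norm (T n (delta s) - T' n (delta s)) \<le> \<epsilon> / 2"
    using assms(2)[of "\<epsilon> / 2"] by auto
  obtain G where G: "finite G" "\<And>n s. l2norm (Pr {t. t - s \<notin> G} (T' n (delta s))) \<le> \<epsilon> / 2"
    using quasi_localE[OF T'(1), of "\<epsilon> / 2"] \<open>\<epsilon> > 0\<close> by auto
  have "l2norm (Pr {t. t - s \<notin> G} (T n (delta s))) \<le> \<epsilon>" for n s
  proof -
    let ?P = "Pr {t. t - s \<notin> G}"
    have "l2norm (?P (T n (delta s))) \<le> l2norm (?P (T n (delta s)) - ?P (T' n (delta s))) + l2norm (?P (T' n (delta s)))"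
      by (intro l2norm_le_diff Pr_l2 assms T')
    also have "?P (T n (delta s)) - ?P (T' n (delta s)) = ?P (T n (delta s) - T' n (delta s))" by (simp add: Pr_diff)
    also have "l2norm \<dots> \<le> l2norm (T n (delta s) - T' n (delta s))" by (intro Pr_l2 l2_diff assms T')
    finally show ?thesis using G(2)[of s n] T'(3)[of n s] by simp
  qed
  then show "\<exists>G. finite G \<and> (\<forall>n s. l2norm (Pr {t. t - s \<notin> G} (T n (delta s))) \<le> \<epsilon>)" using G(1) by blast
qed

lemma quasi_local_add:
  assumes "quasi_local T" "quasi_local T'" "\<And>n s. T n (delta s) \<in> l2" "\<And>n s. T' n (delta s) \<in> l2"
  shows "quasi_local (\<lambda>n. T n + T' n)"
proof (rule quasi_localI)
  fix \<epsilon> :: real assume "\<epsilon> > 0"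
  then obtain G G' where G: "finite G" "\<And>n s. l2norm (Pr {t. t - s \<notin> G} (T n (delta s))) \<le> \<epsilon> / 2"
    and G': "finite G'" "\<And>n s. l2norm (Pr {t. t - s \<notin> G'} (T' n (delta s))) \<le> \<epsilon> / 2"
    using quasi_localE[OF assms(1), of "\<epsilon> / 2"] quasi_localE[OF assms(2), of "\<epsilon> / 2"] half_gt_zero by metis
  have "l2norm (Pr {t. t - s \<notin> G \<union> G'} ((T n + T' n) (delta s))) \<le> \<epsilon>" for n s
  proof -
    let ?P = "Pr {t. t - s \<notin> G \<union> G'}"
    have "l2norm (?P (T n (delta s)) + ?P (T' n (delta s))) \<le> l2norm (?P (T n (delta s))) + l2norm (?P (T' n (delta s)))"
      by (intro l2_add Pr_l2 assms)
    also have "l2norm (?P (T n (delta s))) \<le> \<epsilon> / 2"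
      by (rule order.trans[OF Pr_mono_l2(2) G(2)]) (auto intro: Pr_l2 assms)
    also have "l2norm (?P (T' n (delta s))) \<le> \<epsilon> / 2"
      by (rule order.trans[OF Pr_mono_l2(2) G'(2)]) (auto intro: Pr_l2 assms)
    finally show ?thesis by (simp add: Pr_add)
  qed
  then show "\<exists>G. finite G \<and> (\<forall>n s. l2norm (Pr {t. t - s \<notin> G} ((T n + T' n) (delta s))) \<le> \<epsilon>)"
    using G(1) G'(1) by (intro exI[of _ "G \<union> G'"]) simp
qed

lemma scale_le:
  fixes \<epsilon> :: real assumes "0 < \<epsilon>" "y \<le> \<epsilon> / (cmod c + 1)" "0 \<le> y" shows "cmod c * y \<le> \<epsilon>"
proof -
  have "cmod c * y \<le> (cmod c + 1) * (\<epsilon> / (cmod c + 1))" using assms by (intro mult_mono) auto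
  also have "\<dots> = \<epsilon>" using norm_ge_zero[of c] by (simp add: field_simps add_nonneg_eq_0_iff)
  finally show ?thesis .
qed

lemma quasi_local_scale:
  assumes "quasi_local T" shows "quasi_local (\<lambda>n u t. c * T n u t)"
proof (rule quasi_localI)
  fix \<epsilon> :: real assume e: "\<epsilon> > 0"
  then have "0 < \<epsilon> / (cmod c + 1)" by (simp add: add_nonneg_pos)
  then obtain G where G: "finite G" "\<And>n s. l2norm (Pr {t. t - s \<notin> G} (T n (delta s))) \<le> \<epsilon> / (cmod c + 1)"
    using quasi_localE[OF assms] by blast
  have "l2norm (Pr X (\<lambda>t. c * u t)) = cmod c * l2norm (Pr X u)" for X and u :: "'a vec"
  proof -
    have "Pr X (\<lambda>t. c * u t) = (\<lambda>t. c * Pr X u t)" by (auto simp: Pr_def)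
    then show ?thesis by (simp add: l2norm_scale)
  qed
  then show "\<exists>G. finite G \<and> (\<forall>n s. l2norm (Pr {t. t - s \<notin> G} (\<lambda>t. c * T n (delta s) t)) \<le> \<epsilon>)"
    using scale_le[OF e G(2)] G(1) by auto
qed

text \<open>\<open>T' n\<close> spreads \<open>delta s\<close> over \<open>G' + s\<close> up to a
  small error, and \<open>T n\<close> spreads each point \<open>q\<close> of that set over
  \<open>G + q\<close>. The product is thus concentrated on the sum of \<open>G\<close> and
  \<open>G'\<close> translated by \<open>s\<close>. First \<open>G'\<close> is fixed, then
  \<open>G\<close> with an accuracy divided by \<open>card G'\<close>.\<close>

lemma quasi_local_comp:
  assumes "quasi_local T" "quasi_local T'" "\<And>n. opb K (T n)" "\<And>n. opb L (T' n)"
  shows "quasi_local (\<lambda>n. T n \<circ> T' n)"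
proof (rule quasi_localI)
  fix \<epsilon> :: real assume e: "\<epsilon> > 0"
  have K: "0 \<le> K" and L: "0 \<le> L" using opbD(1)[OF assms(3)] opbD(1)[OF assms(4)] by auto
  have "0 < \<epsilon> / (2 * (K + 1))" using e K by simp
  then obtain G' where G': "finite G'" "\<And>n s. l2norm (Pr {t. t - s \<notin> G'} (T' n (delta s))) \<le> \<epsilon> / (2 * (K + 1))"
    using quasi_localE[OF assms(2)] by blast
  have "0 < \<epsilon> / (2 * (real (card G') * L + 1))" using e L by (simp add: add_nonneg_pos)
  then obtain G where G: "finite G"
    "\<And>n s. l2norm (Pr {t. t - s \<notin> G} (T n (delta s))) \<le> \<epsilon> / (2 * (real (card G') * L + 1))"
    using quasi_localE[OF assms(1)] by blast
  have "l2norm (Pr {t. t - s \<notin> setmul G G'} ((T n \<circ> T' n) (delta s))) \<le> \<epsilon>" for n s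
  proof -
    let ?H = "{t. t - s \<notin> setmul G G'}" and ?F = "{t. t - s \<in> G'}"
    \<comment> \<open>A point outside \<open>setmul G G'\<close> as seen from \<open>s\<close> is
      outside \<open>G\<close> as seen from every \<open>q\<close> in \<open>?F\<close>, because the
      offset from \<open>s\<close> is the offset from \<open>q\<close> plus that of \<open>q\<close>
      from \<open>s\<close>.\<close>
    have H: "?H \<subseteq> {t. t - q \<notin> G}" if "q \<in> ?F" for q
    proof safe
      fix t assume "t - s \<notin> setmul G G'" "t - q \<in> G"
      moreover have "t - s = (t - q) + (q - s)" by (simp only: add_diff_eq diff_add_cancel)
      ultimately show False using that unfolding setmul_def by blast
    qed
    have "opb K (Pr ?H \<circ> T n)" using opb_comp[OF opb_Pr assms(3)] by simp
    then have "l2norm ((Pr ?H \<circ> T n) (T' n (delta s))) \<le> K * (\<epsilon> / (2 * (K + 1)))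
        + card ?F * (L * (\<epsilon> / (2 * (real (card G') * L + 1))))"
    proof (rule opb_split_bound)
      show "T' n (delta s) \<in> l2" "l2norm (T' n (delta s)) \<le> L"
        using opbD(2,3)[OF assms(4) delta_l2, of n s] by auto
      show "finite ?F" using translate_finite[OF G'(1)] .
      show "l2norm (Pr (- ?F) (T' n (delta s))) \<le> \<epsilon> / (2 * (K + 1))"
        using G'(2)[of s n] by (simp add: Collect_neg_eq)
      fix q assume "q \<in> ?F"
      from order.trans[OF Pr_mono_l2(2)[OF Pr_l2(1)[OF opbD(2)[OF assms(3) delta_l2]] H[OF this]] G(2)]
      show "l2norm ((Pr ?H \<circ> T n) (delta q)) \<le> \<epsilon> / (2 * (real (card G') * L + 1))"
        unfolding o_def .
    qed
    then show ?thesis using split_constants[OF K L e, of "card G'"] by (simp add: translate_card)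
  qed
  then show "\<exists>G. finite G \<and> (\<forall>n s. l2norm (Pr {t. t - s \<notin> G} ((T n \<circ> T' n) (delta s))) \<le> \<epsilon>)"
    using finite_setmul[OF G(1) G'(1)] by blast
qed

lemma quasi_local_compress:
  assumes "quasi_local T" "\<And>n. opb (K n) (T n)"
  shows "quasi_local (\<lambda>n. Pr (X n) \<circ> T n \<circ> Pr (X n))"
proof (rule quasi_localI)
  fix \<epsilon> :: real assume e: "\<epsilon> > 0"
  obtain G where G: "finite G" "\<And>n s. l2norm (Pr {t. t - s \<notin> G} (T n (delta s))) \<le> \<epsilon>"
    using quasi_localE[OF assms(1) e] by blast
  have "l2norm (Pr {t. t - s \<notin> G} ((Pr (X n) \<circ> T n \<circ> Pr (X n)) (delta s))) \<le> \<epsilon>" for n s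
  proof (cases "s \<in> X n")
    case True
    then show ?thesis
      by (simp add: Pr_delta Pr_Pr)
         (auto intro!: order.trans[OF Pr_mono_l2(2) G(2)] Pr_l2 opbD(2)[OF assms(2)])
  next
    case False
    then show ?thesis using e opb_zero_arg[OF assms(2)] by (simp add: Pr_delta)
  qed
  then show "\<exists>G. finite G \<and> (\<forall>n s. l2norm (Pr {t. t - s \<notin> G} ((Pr (X n) \<circ> T n \<circ> Pr (X n)) (delta s))) \<le> \<epsilon>)"
    using G(1) by blast
qed

section \<open>Permanence properties of consistency\<close>

lemma consistent_approx:
  assumes "\<And>n s. T n (delta s) \<in> l2"
    and "\<And>\<epsilon>. \<epsilon> > 0 \<Longrightarrow> \<exists>T'. consistent Y T' \<and> (\<forall>n s. T' n (delta s) \<in> l2 \<and> l2norm (T n (delta s) - T' n (delta s)) \<le> \<epsilon>)"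
  shows "consistent Y T"
proof (rule consistentI)
  fix \<epsilon> :: real assume "\<epsilon> > 0"
  then obtain T' where T': "consistent Y T'" "\<And>n s. T' n (delta s) \<in> l2"
    "\<And>n s. l2norm (T n (delta s) - T' n (delta s)) \<le> \<epsilon> / 3"
    using assms(2)[of "\<epsilon> / 3"] by auto
  obtain G where G: "finite G" "\<And>m n s. (\<And>g. g \<in> G \<Longrightarrow> g + s \<in> Y m \<and> g + s \<in> Y n)
      \<Longrightarrow> l2norm (T' m (delta s) - T' n (delta s)) \<le> \<epsilon> / 3"
    using consistentE[OF T'(1), of "\<epsilon> / 3"] \<open>\<epsilon> > 0\<close> by auto
  have "l2norm (T m (delta s) - T n (delta s)) \<le> \<epsilon>" if "\<forall>g\<in>G. g + s \<in> Y m \<and> g + s \<in> Y n" for m n s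
  proof -
    have "l2norm (T m (delta s) - T n (delta s))
        \<le> l2norm (T m (delta s) - T' m (delta s)) + l2norm (T' m (delta s) - T n (delta s))"
      by (intro l2norm_diff_triangle assms T')
    also have "l2norm (T' m (delta s) - T n (delta s))
        \<le> l2norm (T' m (delta s) - T' n (delta s)) + l2norm (T' n (delta s) - T n (delta s))"
      by (intro l2norm_diff_triangle assms T')
    also have "l2norm (T' n (delta s) - T n (delta s)) \<le> \<epsilon> / 3"
      using T'(3)[of n s] by (subst l2norm_minus_commute)
    also have "l2norm (T' m (delta s) - T' n (delta s)) \<le> \<epsilon> / 3" using that by (intro G) auto
    finally show ?thesis using T'(3)[of m s] by linarith
  qed
  then show "\<exists>G. finite G \<and> (\<forall>m n s. (\<forall>g\<in>G. g + s \<in> Y m \<and> g + s \<in> Y n)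
      \<longrightarrow> l2norm (T m (delta s) - T n (delta s)) \<le> \<epsilon>)" using G(1) by blast
qed

lemma consistent_add:
  assumes "consistent Y T" "consistent Y T'" "\<And>n s. T n (delta s) \<in> l2" "\<And>n s. T' n (delta s) \<in> l2"
  shows "consistent Y (\<lambda>n. T n + T' n)"
proof (rule consistentI)
  fix \<epsilon> :: real assume "\<epsilon> > 0"
  then have e: "\<epsilon> / 2 > 0" by simp
  obtain G where G: "finite G" "\<And>m n s. (\<And>g. g \<in> G \<Longrightarrow> g + s \<in> Y m \<and> g + s \<in> Y n)
      \<Longrightarrow> l2norm (T m (delta s) - T n (delta s)) \<le> \<epsilon> / 2"
    using consistentE[OF assms(1) e] by auto
  obtain G' where G': "finite G'" "\<And>m n s. (\<And>g. g \<in> G' \<Longrightarrow> g + s \<in> Y m \<and> g + s \<in> Y n)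
      \<Longrightarrow> l2norm (T' m (delta s) - T' n (delta s)) \<le> \<epsilon> / 2"
    using consistentE[OF assms(2) e] by auto
  have "l2norm ((T m + T' m) (delta s) - (T n + T' n) (delta s)) \<le> \<epsilon>"
    if *: "\<forall>g\<in>G \<union> G'. g + s \<in> Y m \<and> g + s \<in> Y n" for m n s
  proof -
    have eq: "(T m + T' m) (delta s) - (T n + T' n) (delta s)
        = (T m (delta s) - T n (delta s)) + (T' m (delta s) - T' n (delta s))" by simp
    have "l2norm ((T m + T' m) (delta s) - (T n + T' n) (delta s))
        \<le> l2norm (T m (delta s) - T n (delta s)) + l2norm (T' m (delta s) - T' n (delta s))"
      unfolding eq by (intro l2_add l2_diff assms)
    also have "\<dots> \<le> \<epsilon> / 2 + \<epsilon> / 2" by (intro add_mono G G') (use * in auto)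
    finally show ?thesis by simp
  qed
  then show "\<exists>G. finite G \<and> (\<forall>m n s. (\<forall>g\<in>G. g + s \<in> Y m \<and> g + s \<in> Y n)
      \<longrightarrow> l2norm ((T m + T' m) (delta s) - (T n + T' n) (delta s)) \<le> \<epsilon>)"
    using G(1) G'(1) by (intro exI[of _ "G \<union> G'"]) blast
qed

lemma consistent_scale:
  assumes "consistent Y T" shows "consistent Y (\<lambda>n u t. c * T n u t)"
proof (rule consistentI)
  fix \<epsilon> :: real assume e: "\<epsilon> > 0"
  then have "0 < \<epsilon> / (cmod c + 1)" by (simp add: add_nonneg_pos)
  then obtain G where G: "finite G" "\<And>m n s. (\<And>g. g \<in> G \<Longrightarrow> g + s \<in> Y m \<and> g + s \<in> Y n)
      \<Longrightarrow> l2norm (T m (delta s) - T n (delta s)) \<le> \<epsilon> / (cmod c + 1)"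
    using consistentE[OF assms] by blast
  have "l2norm ((\<lambda>t. c * u t) - (\<lambda>t. c * w t)) = cmod c * l2norm (u - w)" for u w :: "'a vec"
  proof -
    have "(\<lambda>t. c * u t) - (\<lambda>t. c * w t) = (\<lambda>t. c * (u - w) t)" by (simp add: fun_eq_iff right_diff_distrib)
    then show ?thesis by (simp only: l2norm_scale)
  qed
  then show "\<exists>G. finite G \<and> (\<forall>m n s. (\<forall>g\<in>G. g + s \<in> Y m \<and> g + s \<in> Y n)
      \<longrightarrow> l2norm ((\<lambda>t. c * T m (delta s) t) - (\<lambda>t. c * T n (delta s) t)) \<le> \<epsilon>)"
    using scale_le[OF e G(2)] G(1) by (intro exI[of _ G]) simp
qed

text \<open>Telescoping: first \<open>T'\<close> is exchanged under \<open>T m\<close>, which only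
  needs consistency of \<open>T'\<close> at \<open>s\<close>; then \<open>T m\<close> is exchanged
  for \<open>T n\<close> on the vector \<open>T' n (delta s)\<close>. By quasi-locality this vector
  is concentrated on \<open>G' + s\<close>, so consistency of \<open>T\<close> is needed only at
  these finitely many points, whose \<open>G\<close>-neighbourhoods are covered by
  \<open>setmul G G'\<close> translated by \<open>s\<close>.\<close>

lemma consistent_comp:
  assumes "consistent Y T" "consistent Y T'" "quasi_local T'" "\<And>n. opb K (T n)" "\<And>n. opb L (T' n)"
  shows "consistent Y (\<lambda>n. T n \<circ> T' n)"
proof (rule consistentI)
  fix \<epsilon> :: real assume "\<epsilon> > 0"
  then have e: "\<epsilon> / 2 > 0" by simp
  have K: "0 \<le> K" "0 \<le> K + K" and L: "0 \<le> L" using opbD(1)[OF assms(4)] opbD(1)[OF assms(5)] by auto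
  have "0 < \<epsilon> / 2 / (2 * (K + K + 1))" using e K by simp
  then obtain G' where G': "finite G'"
      "\<And>n s. l2norm (Pr {t. t - s \<notin> G'} (T' n (delta s))) \<le> \<epsilon> / 2 / (2 * (K + K + 1))"
    using quasi_localE[OF assms(3)] by blast
  have "0 < \<epsilon> / 2 / (2 * (real (card G') * L + 1))" using e L by (simp add: add_nonneg_pos)
  then obtain G where G: "finite G" "\<And>m n s. (\<And>g. g \<in> G \<Longrightarrow> g + s \<in> Y m \<and> g + s \<in> Y n)
      \<Longrightarrow> l2norm (T m (delta s) - T n (delta s)) \<le> \<epsilon> / 2 / (2 * (real (card G') * L + 1))"
    using consistentE[OF assms(1)] by blast
  have "0 < \<epsilon> / (2 * (K + 1))" using e K by simp
  then obtain G2 where G2: "finite G2" "\<And>m n s. (\<And>g. g \<in> G2 \<Longrightarrow> g + s \<in> Y m \<and> g + s \<in> Y n)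
      \<Longrightarrow> l2norm (T' m (delta s) - T' n (delta s)) \<le> \<epsilon> / (2 * (K + 1))"
    using consistentE[OF assms(2)] by blast
  have "l2norm ((T m \<circ> T' m) (delta s) - (T n \<circ> T' n) (delta s)) \<le> \<epsilon>"
    if *: "\<forall>g\<in>G2 \<union> setmul G G'. g + s \<in> Y m \<and> g + s \<in> Y n" for m n s
  proof -
    let ?F = "{t. t - s \<in> G'}"
    have l: "T' m (delta s) \<in> l2" for m by (intro opbD(2)[OF assms(5)] delta_l2)
    have l': "T m u \<in> l2" if "u \<in> l2" for m u by (intro opbD(2)[OF assms(4)] that)
    have "l2norm ((T m \<circ> T' m) (delta s) - (T n \<circ> T' n) (delta s))
      \<le> l2norm (T m (T' m (delta s)) - T m (T' n (delta s))) + l2norm (T m (T' n (delta s)) - T n (T' n (delta s)))"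
      unfolding o_def by (intro l2norm_diff_triangle l l')
    also have "T m (T' m (delta s)) - T m (T' n (delta s)) = T m (T' m (delta s) - T' n (delta s))"
      using opb_diff_arg[OF assms(4) l l] by simp
    also have "l2norm \<dots> \<le> K * l2norm (T' m (delta s) - T' n (delta s))"
      by (intro opbD(3)[OF assms(4)] l2_diff l)
    also have "\<dots> \<le> K * (\<epsilon> / (2 * (K + 1)))" using * K G2(2)[of s m n] by (intro mult_left_mono) auto
    also have "\<dots> \<le> \<epsilon> / 2" using K e by (simp add: field_simps)
    also have "l2norm (T m (T' n (delta s)) - T n (T' n (delta s))) = l2norm ((T m - T n) (T' n (delta s)))"
      by simp
    also have "\<dots> \<le> (K + K) * (\<epsilon> / 2 / (2 * (K + K + 1))) + card ?F * (L * (\<epsilon> / 2 / (2 * (real (card G') * L + 1))))"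
    proof (rule opb_split_bound[OF opb_diff[OF assms(4) assms(4)]])
      show "T' n (delta s) \<in> l2" "l2norm (T' n (delta s)) \<le> L"
        using opbD(2,3)[OF assms(5) delta_l2, of n s] by auto
      show "finite ?F" using translate_finite[OF G'(1)] .
      show "l2norm (Pr (- ?F) (T' n (delta s))) \<le> \<epsilon> / 2 / (2 * (K + K + 1))"
        using G'(2)[of s n] by (simp add: Collect_neg_eq)
      fix q assume q: "q \<in> ?F"
      have "g + q \<in> Y m \<and> g + q \<in> Y n" if "g \<in> G" for g
      proof -
        have "g + (q - s) \<in> setmul G G'" using that q unfolding setmul_def by blast
        then show ?thesis using * by (force simp: add.assoc)
      qed
      then show "l2norm ((T m - T n) (delta q)) \<le> \<epsilon> / 2 / (2 * (real (card G') * L + 1))"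
        using G(2)[of q m n] by simp
    qed
    also have "\<dots> \<le> \<epsilon> / 2" using split_constants[OF K(2) L e, of "card G'"] by (simp only: translate_card)
    finally show ?thesis by linarith
  qed
  then show "\<exists>G. finite G \<and> (\<forall>m n s. (\<forall>g\<in>G. g + s \<in> Y m \<and> g + s \<in> Y n)
      \<longrightarrow> l2norm ((T m \<circ> T' m) (delta s) - (T n \<circ> T' n) (delta s)) \<le> \<epsilon>)"
    using G2(1) finite_setmul[OF G(1) G'(1)] by (intro exI[of _ "G2 \<union> setmul G G'"]) blast
qed

text \<open>Deep inside \<open>Y n\<close> the compression only removes a tail of
  \<open>B (delta s)\<close> that quasi-locality makes small; two compressions are then compared
  through \<open>B\<close> itself.\<close>

lemma consistent_compress:
  assumes "quasi_local (\<lambda>_. B)" "opb K B"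
  shows "consistent Y (\<lambda>n. Pr (Y n) \<circ> B \<circ> Pr (Y n))"
proof (rule consistentI)
  fix \<epsilon> :: real assume "\<epsilon> > 0"
  then have "\<epsilon> / 2 > 0" by simp
  then obtain G where G: "finite G" "\<And>s. l2norm (Pr {t. t - s \<notin> G} (B (delta s))) \<le> \<epsilon> / 2"
    using quasi_localE[OF assms(1)] by metis
  have Bl: "B (delta s) \<in> l2" for s by (rule opbD(2)[OF assms(2) delta_l2])
  \<comment> \<open>Inserting 0 ensures that \<open>s\<close> itself lies in \<open>Y n\<close>, so
    that the inner projection leaves \<open>delta s\<close> alone.\<close>
  have c: "l2norm (B (delta s) - (Pr (Y n) \<circ> B \<circ> Pr (Y n)) (delta s)) \<le> \<epsilon> / 2"
    if "\<forall>g\<in>insert 0 G. g + s \<in> Y n" for n s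
  proof -
    have eq: "B (delta s) - (Pr (Y n) \<circ> B \<circ> Pr (Y n)) (delta s) = Pr (- Y n) (B (delta s))"
      using that by (auto simp: Pr_delta) (auto simp: Pr_def)
    have "l2norm (B (delta s) - (Pr (Y n) \<circ> B \<circ> Pr (Y n)) (delta s)) \<le> l2norm (Pr {t. t - s \<notin> G} (B (delta s)))"
      unfolding eq by (rule Pr_mono_l2) (use that in \<open>auto intro: Pr_l2 Bl\<close>)
    then show ?thesis using G(2)[of s] by linarith
  qed
  have "l2norm ((Pr (Y m) \<circ> B \<circ> Pr (Y m)) (delta s) - (Pr (Y n) \<circ> B \<circ> Pr (Y n)) (delta s)) \<le> \<epsilon>"
    if *: "\<forall>g\<in>insert 0 G. g + s \<in> Y m \<and> g + s \<in> Y n" for m n s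
  proof -
    have l: "(Pr (Y n) \<circ> B \<circ> Pr (Y n)) (delta s) \<in> l2" for n
      by (intro opbD(2)[OF opb_comp[OF opb_comp[OF opb_Pr assms(2)] opb_Pr]] delta_l2)
    have "l2norm ((Pr (Y m) \<circ> B \<circ> Pr (Y m)) (delta s) - (Pr (Y n) \<circ> B \<circ> Pr (Y n)) (delta s))
     \<le> l2norm ((Pr (Y m) \<circ> B \<circ> Pr (Y m)) (delta s) - B (delta s)) + l2norm (B (delta s) - (Pr (Y n) \<circ> B \<circ> Pr (Y n)) (delta s))"
      by (intro l2norm_diff_triangle l Bl)
    also have "\<dots> \<le> \<epsilon> / 2 + \<epsilon> / 2" using * c[of s m] c[of s n]
      by (intro add_mono) (auto simp: l2norm_minus_commute[of _ "B (delta s)"])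
    finally show ?thesis by simp
  qed
  then show "\<exists>G. finite G \<and> (\<forall>m n s. (\<forall>g\<in>G. g + s \<in> Y m \<and> g + s \<in> Y n)
      \<longrightarrow> l2norm ((Pr (Y m) \<circ> B \<circ> Pr (Y m)) (delta s) - (Pr (Y n) \<circ> B \<circ> Pr (Y n)) (delta s)) \<le> \<epsilon>)"
    using G(1) by (intro exI[of _ "insert 0 G"]) blast
qed

section \<open>Localised operators and tame sequences\<close>

text \<open>An operator on the image of \<open>Pr X\<close>, extended by zero. The condition ranges
  over all functions, matching the first clause of \<open>SY\<close>, so identities between
  localised operators can hold literally and not only on \<open>l2\<close>.\<close>

definition localised :: "'g set \<Rightarrow> 'g op \<Rightarrow> bool" where
  "localised X B \<longleftrightarrow> (\<forall>u. B u = Pr X (B (Pr X u)))"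

text \<open>The invariant carried through the generation of the sequence algebra: each clause is
  needed to push another one through products.\<close>

definition tame :: "(nat \<Rightarrow> 'g set) \<Rightarrow> (nat \<Rightarrow> 'g::group_add op) \<Rightarrow> bool" where
  "tame Y T \<longleftrightarrow> (\<exists>K. \<forall>n. opb K (T n)) \<and> (\<forall>n. localised (Y n) (T n))
     \<and> quasi_local T \<and> consistent Y T"

lemma localisedD: "localised X B \<Longrightarrow> Pr X (B (Pr X u)) = B u"
  unfolding localised_def by (erule allE, erule sym)

lemma localised_Pr:
  assumes "localised X B"
  shows "Pr X (B u) = B u" "B (Pr X u) = B u"
proof -
  show "Pr X (B u) = B u" using localisedD[OF assms, of u] Pr_Pr[of X X "B (Pr X u)"] by simp
  show "B (Pr X u) = B u" using localisedD[OF assms, of u] localisedD[OF assms, of "Pr X u"] by (simp add: Pr_Pr)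
qed

lemma adjY_localised: "localised X (adjY X B)"
  by (auto simp: localised_def adjY_def Pr_def fun_eq_iff intro!: sum.cong)

lemma localised_delta:
  assumes "opb K B" "localised X B"
  shows "s \<notin> X \<Longrightarrow> B (delta s) = 0"
  using localised_Pr(2)[OF assms(2), of "delta s"] opb_zero_arg[OF assms(1)] by (simp add: Pr_delta)

text \<open>Some adjoint exists by the general result; since it is determined by its matrix, it
  suffices to compute its values and to compare them with \<open>adjY\<close>.\<close>

lemma is_adj_adjY:
  assumes "finite X" "opb K B" "localised X B"
  shows "is_adj B (adjY X B)"
proof -
  obtain C where C: "is_adj B C" using is_adj_exists[OF assms(2)] by blast
  have "C w s = adjY X B w s" if "w \<in> l2" for w s
  proof -
    have "C w s = l2inner w (Pr X (B (delta s)))"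
      using is_adj_matrix[OF C that] localised_Pr(1)[OF assms(3)] by simp
    also have "\<dots> = (\<Sum>t\<in>X. w t * cnj (B (delta s) t))" using l2inner_Pr_right[OF assms(1)] .
    \<comment> \<open>For \<open>s\<close> outside \<open>X\<close> the column
      \<open>B (delta s)\<close> vanishes, in agreement with the default value 0 in
      \<open>adjY\<close>.\<close>
    also have "\<dots> = adjY X B w s"
      using localised_delta[OF assms(2,3), of s] by (auto simp: adjY_def mult.commute)
    finally show ?thesis .
  qed
  then have "op_eq C (adjY X B)" by (auto simp: op_eq_def fun_eq_iff)
  then show ?thesis using is_adj_cong[OF C] by (simp add: op_eq_def)
qed

text \<open>Uniqueness of adjoints only gives agreement on \<open>l2\<close>. Since both sides
  factor through \<open>Pr X\<close> with \<open>X\<close> finite, and \<open>Pr X u\<close> is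
  always in \<open>l2\<close>, this becomes an equality of functions, which allows rewriting inside
  sequences.\<close>

lemma adjY_eqI:
  assumes "finite X" "opb K B" "localised X B" "is_adj B C" "localised X C"
  shows "adjY X B = C"
proof
  fix u
  have "adjY X B u = Pr X (adjY X B (Pr X u))" by (simp only: localisedD[OF adjY_localised])
  also have "adjY X B (Pr X u) = C (Pr X u)"
    using is_adj_unique[OF is_adj_adjY[OF assms(1-3)] assms(4)] Pr_finite_l2[OF assms(1)] by (auto simp: op_eq_def)
  also have "Pr X (C (Pr X u)) = C u" using localisedD[OF assms(5)] .
  finally show "adjY X B u = C u" .
qed

lemma opb_adjY:
  assumes "finite X" "opb K B" "localised X B" shows "opb K (adjY X B)"
  using is_adj_opb[OF is_adj_adjY[OF assms] assms(2)] .

lemma tameI: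
  assumes "\<And>n. opb K (T n)" "\<And>n. localised (Y n) (T n)" "quasi_local T" "consistent Y T"
  shows "tame Y T"
  using assms unfolding tame_def by blast

lemma tameE:
  assumes "tame Y T"
  obtains K where "\<And>n. opb K (T n)" "\<And>n. localised (Y n) (T n)" "quasi_local T" "consistent Y T"
  using assms unfolding tame_def by blast

lemma localised_add:
  assumes "localised X B" "localised X C" shows "localised X (B + C)"
  unfolding localised_def plus_fun_apply Pr_add using localisedD[OF assms(1)] localisedD[OF assms(2)] by simp

lemma localised_scale:
  assumes "localised X B" shows "localised X (\<lambda>u t. c * B u t)"
  unfolding localised_def
proof (intro allI ext)
  fix u t show "c * B u t = Pr X (\<lambda>t. c * B (Pr X u) t) t"
    by (subst localisedD[OF assms, symmetric]) (simp add: Pr_def)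
qed

lemma localised_comp:
  assumes "localised X B" "localised X C" shows "localised X (B \<circ> C)"
  unfolding localised_def using localised_Pr[OF assms(1)] localised_Pr[OF assms(2)] by simp

lemma localised_compress: "localised X (Pr X \<circ> B \<circ> Pr X)"
  by (simp add: localised_def Pr_Pr)

lemma tame_add:
  assumes "tame Y T" "tame Y T'" shows "tame Y (\<lambda>n. T n + T' n)"
proof -
  obtain K where K: "\<And>n. opb K (T n)" "\<And>n. localised (Y n) (T n)" "quasi_local T" "consistent Y T"
    using tameE[OF assms(1)] by blast
  obtain L where L: "\<And>n. opb L (T' n)" "\<And>n. localised (Y n) (T' n)" "quasi_local T'" "consistent Y T'"
    using tameE[OF assms(2)] by blast
  have l: "T n (delta s) \<in> l2" "T' n (delta s) \<in> l2" for n s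
    by (intro opbD(2)[OF K(1)] opbD(2)[OF L(1)] delta_l2)+
  show ?thesis
    by (intro tameI[where K = "K + L"] opb_add[OF K(1) L(1)] localised_add[OF K(2) L(2)]
        quasi_local_add[OF K(3) L(3)] consistent_add[OF K(4) L(4)] l)
qed

lemma tame_scale:
  assumes "tame Y T" shows "tame Y (\<lambda>n u t. c * T n u t)"
proof -
  obtain K where K: "\<And>n. opb K (T n)" "\<And>n. localised (Y n) (T n)" "quasi_local T" "consistent Y T"
    using tameE[OF assms(1)] by blast
  show ?thesis
    by (intro tameI[where K = "cmod c * K"] opb_scale[OF K(1)] localised_scale[OF K(2)]
        quasi_local_scale[OF K(3)] consistent_scale[OF K(4)])
qed

lemma tame_comp:
  assumes "tame Y T" "tame Y T'" shows "tame Y (\<lambda>n. T n \<circ> T' n)"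
proof -
  obtain K where K: "\<And>n. opb K (T n)" "\<And>n. localised (Y n) (T n)" "quasi_local T" "consistent Y T"
    using tameE[OF assms(1)] by blast
  obtain L where L: "\<And>n. opb L (T' n)" "\<And>n. localised (Y n) (T' n)" "quasi_local T'" "consistent Y T'"
    using tameE[OF assms(2)] by blast
  show ?thesis
    by (intro tameI[where K = "K * L"] opb_comp[OF K(1) L(1)] localised_comp[OF K(2) L(2)]
        quasi_local_comp[OF K(3) L(3) K(1) L(1)] consistent_comp[OF K(4) L(4) L(3) K(1) L(1)])
qed

text \<open>Basis vectors have norm 1, so an operator-norm error of \<epsilon> is an error of at
  most \<epsilon> on every \<open>delta s\<close>, uniformly in \<open>n\<close> and
  \<open>s\<close>; quasi-locality and consistency tolerate such errors.\<close>

lemma tame_approx: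
  assumes "\<And>n. opb K (T n)" "\<And>n. localised (Y n) (T n)"
    and approx: "\<And>\<epsilon>. \<epsilon> > 0 \<Longrightarrow> \<exists>T'. tame Y T' \<and> (\<forall>n. opb \<epsilon> (T n - T' n))"
  shows "tame Y T"
proof -
  have l: "T n (delta s) \<in> l2" for n s by (intro opbD(2)[OF assms(1)] delta_l2)
  have "\<exists>T'. quasi_local T' \<and> consistent Y T' \<and> (\<forall>n s. T' n (delta s) \<in> l2 \<and> l2norm (T n (delta s) - T' n (delta s)) \<le> \<epsilon>)"
    if e: "\<epsilon> > 0" for \<epsilon>
  proof -
    obtain T' where T': "tame Y T'" "\<And>n. opb \<epsilon> (T n - T' n)" using approx[OF e] by blast
    obtain L where L: "\<And>n. opb L (T' n)" "quasi_local T'" "consistent Y T'"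
      using tameE[OF T'(1)] by blast
    have "T' n (delta s) \<in> l2" for n s by (intro opbD(2)[OF L(1)] delta_l2)
    moreover have "l2norm (T n (delta s) - T' n (delta s)) \<le> \<epsilon>" for n s
      using opbD(3)[OF T'(2) delta_l2, of n s] by simp
    ultimately show ?thesis using L by blast
  qed
  note ex = this
  have "quasi_local T" by (rule quasi_local_approx[of T]) (rule l, use ex in blast)
  moreover have "consistent Y T" by (rule consistent_approx[of T]) (rule l, use ex in blast)
  ultimately show ?thesis using assms(1,2) by (intro tameI)
qed

section \<open>Band-dominated operators\<close>

lemma opb_Mop: assumes "\<And>t. cmod (a t) \<le> M" shows "opb M (Mop a)"
proof -
  have M: "0 \<le> M" using assms[of undefined] norm_ge_zero order.trans by blast
  have "Mop a u \<in> l2 \<and> l2norm (Mop a u) \<le> M * l2norm u" if u: "u \<in> l2" for u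
  proof -
    have "L2_set (\<lambda>t. cmod (Mop a u t)) F \<le> M * l2norm u" for F
    proof -
      have "L2_set (\<lambda>t. cmod (Mop a u t)) F \<le> L2_set (\<lambda>t. M * cmod (u t)) F"
        by (rule L2_set_mono) (auto simp: Mop_def norm_mult intro: mult_right_mono assms)
      also have "\<dots> = M * L2_set (\<lambda>t. cmod (u t)) F" using M by (simp add: L2_set_right_distrib)
      also have "\<dots> \<le> M * l2norm u" by (rule mult_left_mono[OF L2_set_le_l2norm[OF u] M])
      finally show ?thesis .
    qed
    then show ?thesis using l2_boundI[of "M * l2norm u" "Mop a u"] M by simp
  qed
  then show ?thesis using M by (simp add: opb_def) (simp add: Mop_def fun_eq_iff algebra_simps)
qed

lemma is_adj_Mop:
  assumes "\<And>t. cmod (a t) \<le> M" shows "is_adj (Mop a) (Mop (\<lambda>t. cnj (a t)))"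
proof -
  have "Mop a u \<in> l2" "Mop (\<lambda>t. cnj (a t)) u \<in> l2" if "u \<in> l2" for u
    using opbD(2)[OF opb_Mop] assms that by (metis, metis complex_mod_cnj)
  then show ?thesis unfolding is_adj_def
    by (auto simp: l2inner_def Mop_def mult_ac)
qed

lemma quasi_local_band:
  assumes "finite G" "\<And>n s t. t - s \<notin> G \<Longrightarrow> T n (delta s) t = 0"
  shows "quasi_local T"
proof (rule quasi_localI)
  fix \<epsilon> :: real assume "0 < \<epsilon>"
  have "Pr {t. t - s \<notin> G} (T n (delta s)) = 0" for n s using assms(2) by (auto simp: Pr_def)
  then show "\<exists>G. finite G \<and> (\<forall>n s. l2norm (Pr {t. t - s \<notin> G} (T n (delta s))) \<le> \<epsilon>)"
    using assms(1) \<open>0 < \<epsilon>\<close> by (intro exI[of _ G]) simp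
qed

text \<open>The bound is carried along because products of quasi-local operators require it. The
  adjoint inside \<open>bdo_alg\<close> is constructed as well, as the generating rules mention no
  adjoints: on generators it is \<open>Lop (- r)\<close> or multiplication by the conjugate.\<close>

lemma bdo_alg_quasi_local:
  assumes "C \<in> bdo_alg" shows "quasi_local (\<lambda>_. C) \<and> (\<exists>K. opb K C) \<and> (\<exists>Cs\<in>bdo_alg. is_adj C Cs)"
  using assms
proof induction
  case (gen_L r)
  \<comment> \<open>\<open>Lop r\<close> sends \<open>delta s\<close> to
    \<open>delta (r + s)\<close>, so its matrix lives on the single offset \<open>r\<close>;
    multiplication operators below live on the offset 0.\<close>
  have "quasi_local (\<lambda>_. Lop r)"
  proof (rule quasi_local_band[of "{r}"])
    fix s t assume "t - s \<notin> {r}"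
    then have "- r + t \<noteq> s" by (metis add_diff_cancel add_minus_cancel insertI1)
    then show "Lop r (delta s) t = 0" by (simp add: Lop_def delta_def)
  qed simp
  then show ?case using opb_Lop is_adj_Lop bdo_alg.gen_L by blast
next
  case (gen_M a)
  then obtain M where M: "\<And>t. cmod (a t) \<le> M" by blast
  have "quasi_local (\<lambda>_. Mop a)"
    by (rule quasi_local_band[of "{0}"]) (auto simp: Mop_def delta_def)
  moreover have "Mop (\<lambda>t. cnj (a t)) \<in> bdo_alg" using M by (intro bdo_alg.gen_M) auto
  ultimately show ?case using opb_Mop[of a M] is_adj_Mop[of a M] M by blast
next
  case (add B C)
  then obtain K L Bs Cs where *: "opb K B" "opb L C" "Bs \<in> bdo_alg" "Cs \<in> bdo_alg" "is_adj B Bs" "is_adj C Cs" by blast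
  have "B (delta s) \<in> l2" "C (delta s) \<in> l2" for s
    by (intro opbD(2)[OF *(1)] opbD(2)[OF *(2)] delta_l2)+
  then have "quasi_local (\<lambda>_. B + C)" using add.IH by (intro quasi_local_add) auto
  then show ?case using opb_add[OF *(1,2)] is_adj_add[OF *(5,6)] bdo_alg.add[OF *(3,4)] by blast
next
  case (scale B c)
  then obtain K Bs where *: "opb K B" "Bs \<in> bdo_alg" "is_adj B Bs" by blast
  have "quasi_local (\<lambda>_ u t. c * B u t)" using scale.IH by (intro quasi_local_scale) auto
  then show ?case using opb_scale[OF *(1), of c] is_adj_scale[OF *(3), of c] bdo_alg.scale[OF *(2), of "cnj c"] by blast
next
  case (mult B C)
  then obtain K L Bs Cs where *: "opb K B" "opb L C" "Bs \<in> bdo_alg" "Cs \<in> bdo_alg" "is_adj B Bs" "is_adj C Cs" by blast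
  have "quasi_local (\<lambda>_. B \<circ> C)" using mult.IH * by (intro quasi_local_comp[where K=K and L=L]) auto
  then show ?case using opb_comp[OF *(1,2)] is_adj_comp[OF *(5,6)] bdo_alg.mult[OF *(4,3)] by blast
qed

lemma opb_sharpen:
  assumes "opb K B" "0 \<le> \<epsilon>" "\<And>u. u \<in> l2 \<Longrightarrow> l2norm (B u) \<le> \<epsilon> * l2norm u" shows "opb \<epsilon> B"
  using assms by (simp add: opb_def)

lemma BDO_approx:
  assumes "B \<in> BDO" "\<epsilon> > 0"
  obtains C where "C \<in> bdo_alg" "opb \<epsilon> (B - C)"
proof -
  obtain C where C: "C \<in> bdo_alg" "\<forall>u\<in>l2. l2norm (B u - C u) \<le> \<epsilon> * l2norm u"
    using assms unfolding BDO_def by blast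
  obtain K L where "opb K B" "opb L C" using assms bdo_alg_quasi_local[OF C(1)]
    unfolding BDO_def bounded_op_iff_opb by blast
  then have "opb \<epsilon> (B - C)" using C(2) assms(2) opb_sharpen[OF opb_diff[of K B L C]] by simp
  then show thesis using that C by blast
qed

text \<open>The adjoint of the approximation error obeys the same bound, so adjoints of approximants
  approximate the adjoint.\<close>

lemma BDO_adj:
  assumes "B \<in> BDO" "is_adj B Bs" shows "Bs \<in> BDO"
proof -
  obtain K where "opb K B" using assms unfolding BDO_def bounded_op_iff_opb by blast
  then have "bounded_op Bs" using is_adj_opb[OF assms(2)] bounded_op_iff_opb by blast
  moreover have "\<exists>C\<in>bdo_alg. \<forall>u\<in>l2. l2norm (Bs u - C u) \<le> \<epsilon> * l2norm u" if e: "\<epsilon> > 0" for \<epsilon>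
  proof -
    obtain C where C: "C \<in> bdo_alg" "opb \<epsilon> (B - C)" using BDO_approx[OF assms(1) e] .
    obtain Cs where Cs: "Cs \<in> bdo_alg" "is_adj C Cs" using bdo_alg_quasi_local[OF C(1)] by blast
    have "opb \<epsilon> (Bs - Cs)" using is_adj_opb[OF is_adj_diff[OF assms(2) Cs(2)] C(2)] .
    then have "\<forall>u\<in>l2. l2norm (Bs u - Cs u) \<le> \<epsilon> * l2norm u" using opbD(3)[of \<epsilon> "Bs - Cs"] by simp
    then show ?thesis using Cs(1) by blast
  qed
  ultimately show ?thesis unfolding BDO_def by blast
qed

lemma BDO_quasi_local:
  assumes "B \<in> BDO" shows "quasi_local (\<lambda>_. B)"
proof (rule quasi_local_approx)
  obtain K where K: "opb K B" using assms unfolding BDO_def bounded_op_iff_opb by blast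
  show "B (delta s) \<in> l2" for s by (intro opbD(2)[OF K] delta_l2)
  fix \<epsilon> :: real assume "\<epsilon> > 0"
  then obtain C where C: "C \<in> bdo_alg" "opb \<epsilon> (B - C)" using BDO_approx[OF assms] by blast
  obtain L where L: "opb L C" "quasi_local (\<lambda>_. C)" using bdo_alg_quasi_local[OF C(1)] by blast
  have "C (delta s) \<in> l2" for s by (intro opbD(2)[OF L(1)] delta_l2)
  moreover have "l2norm (B (delta s) - C (delta s)) \<le> \<epsilon>" for s
    using opbD(3)[OF C(2) delta_l2, of s] by simp
  ultimately show "\<exists>T'. quasi_local T' \<and> (\<forall>n s. T' n (delta s) \<in> l2 \<and> l2norm (B (delta s) - T' n (delta s)) \<le> \<epsilon>)"
    using L(2) by (intro exI[of _ "\<lambda>_. C"]) blast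
qed

lemma tame_compress:
  assumes "B \<in> BDO" shows "tame Y (\<lambda>n. Pr (Y n) \<circ> B \<circ> Pr (Y n))"
proof -
  obtain K where K: "opb K B" using assms unfolding BDO_def bounded_op_iff_opb by blast
  have "opb K (Pr (Y n) \<circ> B \<circ> Pr (Y n))" for n
    using opb_comp[OF opb_comp[OF opb_Pr K] opb_Pr] by simp
  moreover have "quasi_local (\<lambda>n. Pr (Y n) \<circ> B \<circ> Pr (Y n))"
    by (rule quasi_local_compress[OF BDO_quasi_local[OF assms] K])
  moreover have "consistent Y (\<lambda>n. Pr (Y n) \<circ> B \<circ> Pr (Y n))"
    by (rule consistent_compress[OF BDO_quasi_local[OF assms] K])
  ultimately show ?thesis unfolding tame_def using localised_compress by blast
qed

section \<open>Tameness of the generated sequence algebra\<close>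

text \<open>Carrying the adjoint sequence in the induction turns the case \<open>adj\<close> into an
  exchange of the two conjuncts, \<open>adjY\<close> being an involution on localised operators. In
  the other cases the adjoint is computed in closed form and has the same shape.\<close>

lemma S_alg_tame:
  assumes "\<And>n. finite (Y n)" "AA \<in> S_alg Y"
  shows "tame Y AA \<and> tame Y (\<lambda>n. adjY (Y n) (AA n))"
  using assms(2)
proof induction
  case (gen B)
  obtain K where K: "opb K B" using gen unfolding BDO_def bounded_op_iff_opb by blast
  obtain Bs where Bs: "is_adj B Bs" using is_adj_exists[OF K] by blast
  have "adjY (Y n) (Pr (Y n) \<circ> B \<circ> Pr (Y n)) = Pr (Y n) \<circ> Bs \<circ> Pr (Y n)" for n
  proof (rule adjY_eqI[OF assms(1)])
    show "opb (1 * K * 1) (Pr (Y n) \<circ> B \<circ> Pr (Y n))" by (intro opb_comp opb_Pr K)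
    show "is_adj (Pr (Y n) \<circ> B \<circ> Pr (Y n)) (Pr (Y n) \<circ> Bs \<circ> Pr (Y n))"
      using is_adj_comp[OF is_adj_comp[OF is_adj_Pr Bs] is_adj_Pr] by (simp add: comp_assoc)
  qed (rule localised_compress)+
  then show ?case using tame_compress[OF gen, of Y] tame_compress[OF BDO_adj[OF gen Bs], of Y] by (simp only: simp_thms)
next
  case (add AA CC)
  obtain K where K: "\<And>n. opb K (AA n)" "\<And>n. localised (Y n) (AA n)"
    using add.IH tameE by blast
  obtain L where L: "\<And>n. opb L (CC n)" "\<And>n. localised (Y n) (CC n)"
    using add.IH tameE by blast
  have "adjY (Y n) (AA n + CC n) = adjY (Y n) (AA n) + adjY (Y n) (CC n)" for n
    by (rule adjY_eqI[OF assms(1) opb_add[OF K(1) L(1)] localised_add[OF K(2) L(2)]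
          is_adj_add[OF is_adj_adjY[OF assms(1) K] is_adj_adjY[OF assms(1) L]]
          localised_add[OF adjY_localised adjY_localised]])
  then show ?case using add.IH tame_add[of Y AA CC] tame_add[of Y "\<lambda>n. adjY (Y n) (AA n)" "\<lambda>n. adjY (Y n) (CC n)"]
    by (simp only: simp_thms)
next
  case (scale AA c)
  obtain K where K: "\<And>n. opb K (AA n)" "\<And>n. localised (Y n) (AA n)"
    using scale.IH tameE by blast
  have "adjY (Y n) (\<lambda>u t. c * AA n u t) = (\<lambda>u t. cnj c * adjY (Y n) (AA n) u t)" for n
    by (rule adjY_eqI[OF assms(1) opb_scale[OF K(1)] localised_scale[OF K(2)]
          is_adj_scale[OF is_adj_adjY[OF assms(1) K]]
          localised_scale[OF adjY_localised]])
  then show ?case using scale.IH tame_scale[of Y AA c] tame_scale[of Y "\<lambda>n. adjY (Y n) (AA n)" "cnj c"]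
    by (simp only: simp_thms)
next
  case (mult AA CC)
  obtain K where K: "\<And>n. opb K (AA n)" "\<And>n. localised (Y n) (AA n)"
    using mult.IH tameE by blast
  obtain L where L: "\<And>n. opb L (CC n)" "\<And>n. localised (Y n) (CC n)"
    using mult.IH tameE by blast
  have "adjY (Y n) (AA n \<circ> CC n) = adjY (Y n) (CC n) \<circ> adjY (Y n) (AA n)" for n
    by (rule adjY_eqI[OF assms(1) opb_comp[OF K(1) L(1)] localised_comp[OF K(2) L(2)]
          is_adj_comp[OF is_adj_adjY[OF assms(1) K] is_adj_adjY[OF assms(1) L]]
          localised_comp[OF adjY_localised adjY_localised]])
  then show ?case using mult.IH tame_comp[of Y AA CC] tame_comp[of Y "\<lambda>n. adjY (Y n) (CC n)" "\<lambda>n. adjY (Y n) (AA n)"]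
    by (simp only: simp_thms)
next
  case (adj AA)
  obtain K where K: "\<And>n. opb K (AA n)" "\<And>n. localised (Y n) (AA n)"
    using adj.IH tameE by blast
  have "adjY (Y n) (adjY (Y n) (AA n)) = AA n" for n
    by (rule adjY_eqI[OF assms(1) opb_adjY[OF assms(1) K] adjY_localised
          is_adj_sym[OF is_adj_adjY[OF assms(1) K]] K(2)])
  then show ?case using adj.IH by simp
qed

text \<open>Membership in \<open>SY\<close> does not mention linearity or a uniform bound; both are
  inherited by \<open>AA n\<close> from approximants in \<open>S_alg Y\<close>. Only then are
  adjoints available, and both sequences are approximated simultaneously.\<close>

lemma SY_tame:
  assumes fin: "\<And>n. finite (Y n)" and AA: "AA \<in> SY Y"
  shows "tame Y AA" "tame Y (\<lambda>n. adjY (Y n) (AA n))"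
proof -
  have loc: "localised (Y n) (AA n)" for n using AA unfolding SY_def localised_def by blast
  have approx: "\<exists>CC\<in>S_alg Y. \<forall>n u. l2norm (AA n u - CC n u) \<le> \<epsilon> * l2norm (Pr (Y n) u)" if "\<epsilon> > 0" for \<epsilon>
    using AA that unfolding SY_def by blast
  have AAl: "AA n u \<in> l2" for n u by (subst localised_Pr(1)[OF loc, symmetric]) (rule Pr_finite_l2[OF fin])
  have "\<exists>CC. \<forall>j. CC j \<in> S_alg Y \<and> (\<forall>n u. l2norm (AA n u - CC j n u) \<le> inverse (real (Suc j)) * l2norm (Pr (Y n) u))"
  proof (rule choice, rule allI)
    fix j :: nat
    have "0 < inverse (real (Suc j))" by simp
    from approx[OF this] show "\<exists>C. C \<in> S_alg Y \<and> (\<forall>n u. l2norm (AA n u - C n u) \<le> inverse (real (Suc j)) * l2norm (Pr (Y n) u))"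
      by blast
  qed
  then obtain CC where CC: "\<And>j. CC j \<in> S_alg Y"
    "\<And>j n u. l2norm (AA n u - CC j n u) \<le> inverse (real (Suc j)) * l2norm (Pr (Y n) u)" by blast
  have CCb: "\<exists>K. \<forall>n. opb K (CC j n)" for j using S_alg_tame[OF fin CC(1)] unfolding tame_def by blast
  obtain K where K: "\<And>n. opb K (CC 0 n)" using CCb by blast
  have bound: "l2norm (AA n u - CC j n u) \<le> inverse (real (Suc j)) * l2norm u" if "u \<in> l2" for j n u
    by (rule order.trans[OF CC(2) mult_left_mono[OF Pr_l2(2)[OF that]]]) simp
  \<comment> \<open>Every \<open>CC j n\<close> is within 1 of \<open>AA n\<close>, which is within
    1 of \<open>CC 0 n\<close>, and the latter has bound \<open>K\<close>; this explains
    \<open>K + 2\<close> and its independence of \<open>j\<close> and \<open>n\<close>.\<close>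
  have unif: "opb (K + 2) (CC j n)" for j n
  proof -
    obtain L where L: "\<And>n. opb L (CC j n)" using CCb by blast
    show ?thesis
    proof (rule opb_sharpen[OF L])
      show "0 \<le> K + 2" using opbD(1)[OF K] by simp
      fix u :: "'a vec" assume u: "u \<in> l2"
      have l: "CC i n u \<in> l2" for i using opbD(2)[OF _ u] CCb by metis
      have "l2norm (CC j n u) \<le> l2norm (CC j n u - AA n u) + l2norm (AA n u)"
        by (intro l2norm_le_diff l AAl)
      also have "l2norm (AA n u) \<le> l2norm (AA n u - CC 0 n u) + l2norm (CC 0 n u)"
        by (intro l2norm_le_diff l AAl)
      also have "l2norm (CC j n u - AA n u) \<le> 1 * l2norm u"
        unfolding l2norm_minus_commute[of "CC j n u"]
        by (rule order.trans[OF bound[OF u] mult_right_mono]) (auto simp: field_simps)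
      also have "l2norm (AA n u - CC 0 n u) \<le> 1 * l2norm u" using bound[OF u, of n 0] by simp
      also have "l2norm (CC 0 n u) \<le> K * l2norm u" by (rule opbD(3)[OF K u])
      finally show "l2norm (CC j n u) \<le> (K + 2) * l2norm u" by (simp add: algebra_simps)
    qed
  qed
  have AAb: "opb (K + 2) (AA n)" for n
  proof (rule opb_limit[where Bs = "\<lambda>j. CC j n", OF unif])
    fix u :: "'a vec" and t assume u: "u \<in> l2"
    show "(\<lambda>j. CC j n u t) \<longlonglongrightarrow> AA n u t"
    proof (rule l2_tendsto_pointwise[OF opbD(2)[OF unif u] AAl])
      have "(\<lambda>j. inverse (real (Suc j)) * l2norm u) \<longlonglongrightarrow> 0"
        by (intro tendsto_mult_left_zero LIMSEQ_inverse_real_of_nat)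
      then show "(\<lambda>j. l2norm (CC j n u - AA n u)) \<longlonglongrightarrow> 0"
        by (rule l2norm_null[rotated]) (subst l2norm_minus_commute, rule bound[OF u])
    qed
  qed
  \<comment> \<open>One approximant serves for both sequences, since the adjoint error inherits its
    bound through \<open>is_adj_opb\<close>.\<close>
  have ex: "\<exists>CC\<in>S_alg Y. \<forall>n. opb \<epsilon> (AA n - CC n) \<and> opb \<epsilon> (adjY (Y n) (AA n) - adjY (Y n) (CC n))"
    if e: "\<epsilon> > 0" for \<epsilon>
  proof -
    obtain CC where CC: "CC \<in> S_alg Y" "\<And>n u. l2norm (AA n u - CC n u) \<le> \<epsilon> * l2norm (Pr (Y n) u)"
      using approx[OF e] by blast
    obtain L where L: "\<And>n. opb L (CC n)" "\<And>n. localised (Y n) (CC n)"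
      using S_alg_tame[OF fin CC(1)] tameE by blast
    have "opb \<epsilon> (AA n - CC n)" for n
    proof (rule opb_sharpen[OF opb_diff[OF AAb L(1)]])
      fix u :: "'a vec" assume u: "u \<in> l2"
      show "l2norm ((AA n - CC n) u) \<le> \<epsilon> * l2norm u"
        using order.trans[OF CC(2)[of n u] mult_left_mono[OF Pr_l2(2)[OF u]]] e by simp
    qed (use e in simp)
    moreover have "is_adj (AA n - CC n) (adjY (Y n) (AA n) - adjY (Y n) (CC n))" for n
      by (intro is_adj_diff is_adj_adjY[OF fin AAb loc] is_adj_adjY[OF fin L])
    ultimately show ?thesis using CC(1) is_adj_opb by blast
  qed
  show "tame Y AA"
  proof (rule tame_approx[OF AAb loc])
    fix \<epsilon> :: real assume "\<epsilon> > 0"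
    then show "\<exists>T'. tame Y T' \<and> (\<forall>n. opb \<epsilon> (AA n - T' n))" using ex S_alg_tame[of Y] fin by blast
  qed
  show "tame Y (\<lambda>n. adjY (Y n) (AA n))"
  proof (rule tame_approx[OF opb_adjY[OF fin AAb loc] adjY_localised])
    fix \<epsilon> :: real assume "\<epsilon> > 0"
    then obtain CC where "CC \<in> S_alg Y" "\<forall>n. opb \<epsilon> (adjY (Y n) (AA n) - adjY (Y n) (CC n))" using ex by blast
    then show "\<exists>T'. tame Y T' \<and> (\<forall>n. opb \<epsilon> (adjY (Y n) (AA n) - T' n))" using S_alg_tame[of Y CC] fin
      by (intro exI[of _ "\<lambda>n. adjY (Y n) (CC n)"]) blast
  qed
qed

text \<open>Let one index of the consistency condition tend to infinity: as \<open>Y\<close>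
  increases, the hypothesis on \<open>G + s\<close> persists for all later indices, and
  \<open>l2_fatou\<close> needs only entrywise convergence. The same \<open>G\<close> serves for
  every \<open>s\<close>.\<close>

lemma consistent_limit:
  assumes "consistent Y T" "\<And>n. opb K (T n)" "mono Y" "(\<Union>n. Y n) = UNIV"
    "\<And>s t. (\<lambda>n. T n (delta s) t) \<longlonglongrightarrow> C (delta s) t" "\<epsilon> > 0"
  obtains G where "finite G" "\<And>n s. (\<And>g. g \<in> G \<Longrightarrow> g + s \<in> Y n) \<Longrightarrow> l2norm (T n (delta s) - C (delta s)) \<le> \<epsilon>"
proof -
  obtain G where G: "finite G" "\<And>m n s. (\<And>g. g \<in> G \<Longrightarrow> g + s \<in> Y m \<and> g + s \<in> Y n)
      \<Longrightarrow> l2norm (T m (delta s) - T n (delta s)) \<le> \<epsilon>"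
    using consistentE[OF assms(1,6)] by blast
  have "l2norm (T n (delta s) - C (delta s)) \<le> \<epsilon>" if *: "\<And>g. g \<in> G \<Longrightarrow> g + s \<in> Y n" for n s
  proof (rule l2_fatou[where w = "\<lambda>j. T n (delta s) - T j (delta s)"])
    show "T n (delta s) - T j (delta s) \<in> l2" for j by (intro l2_diff opbD(2)[OF assms(2)] delta_l2)
    show "\<forall>\<^sub>F j in sequentially. l2norm (T n (delta s) - T j (delta s)) \<le> \<epsilon>"
      unfolding eventually_sequentially
    proof (intro exI allI impI G)
      fix j g assume "n \<le> j" "g \<in> G"
      then show "g + s \<in> Y n \<and> g + s \<in> Y j" using * monoD[OF assms(3), of n j] by blast
    qed
    show "(\<lambda>j. (T n (delta s) - T j (delta s)) t) \<longlonglongrightarrow> (T n (delta s) - C (delta s)) t" for t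
      unfolding minus_apply by (intro tendsto_intros assms)
  qed
  then show thesis using that G(1) by blast
qed

section \<open>Asymptotic equality of operator sequences\<close>

text \<open>Strong convergence of differences, where neither sequence has to converge. This allows
  chains of replacements along moving shifts before any limit is identified.\<close>

definition sasym :: "(nat \<Rightarrow> 'g op) \<Rightarrow> (nat \<Rightarrow> 'g op) \<Rightarrow> bool" where
  "sasym Bs Cs \<longleftrightarrow> (\<forall>u\<in>l2. (\<forall>m. Bs m u \<in> l2 \<and> Cs m u \<in> l2) \<and> (\<lambda>m. l2norm (Bs m u - Cs m u)) \<longlonglongrightarrow> 0)"

lemma sconv_iff_sasym: "sconv Bs B \<longleftrightarrow> sasym Bs (\<lambda>_. B)"
  by (auto simp: sconv_def sasym_def)

lemma sasym_sym: "sasym Bs Cs \<Longrightarrow> sasym Cs Bs"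
  unfolding sasym_def by (subst l2norm_minus_commute) blast

lemma sasym_trans [trans]:
  assumes "sasym Bs Cs" "sasym Cs Ds" shows "sasym Bs Ds"
  unfolding sasym_def
proof (intro ballI conjI allI)
  fix u :: "'a vec" assume u: "u \<in> l2"
  have l: "Bs m u \<in> l2" "Cs m u \<in> l2" "Ds m u \<in> l2" for m using assms u by (auto simp: sasym_def)
  show "Bs m u \<in> l2" "Ds m u \<in> l2" for m by (rule l)+
  have "(\<lambda>m. l2norm (Bs m u - Cs m u)) \<longlonglongrightarrow> 0" "(\<lambda>m. l2norm (Cs m u - Ds m u)) \<longlonglongrightarrow> 0"
    using assms u by (auto simp: sasym_def)
  from tendsto_add_zero[OF this] show "(\<lambda>m. l2norm (Bs m u - Ds m u)) \<longlonglongrightarrow> 0"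
    by (rule l2norm_null[rotated]) (rule l2norm_diff_triangle[OF l])
qed

lemma sasym_add:
  assumes "sasym Bs Cs" "sasym Bs' Cs'" shows "sasym (\<lambda>m. Bs m + Bs' m) (\<lambda>m. Cs m + Cs' m)"
  unfolding sasym_def
proof (intro ballI conjI allI)
  fix u :: "'a vec" assume u: "u \<in> l2"
  have l: "Bs m u \<in> l2" "Cs m u \<in> l2" "Bs' m u \<in> l2" "Cs' m u \<in> l2" for m using assms u by (auto simp: sasym_def)
  show "(Bs m + Bs' m) u \<in> l2" "(Cs m + Cs' m) u \<in> l2" for m using l by (simp_all add: l2_add)
  have "(\<lambda>m. l2norm (Bs m u - Cs m u)) \<longlonglongrightarrow> 0" "(\<lambda>m. l2norm (Bs' m u - Cs' m u)) \<longlonglongrightarrow> 0"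
    using assms u by (auto simp: sasym_def)
  from tendsto_add_zero[OF this] show "(\<lambda>m. l2norm ((Bs m + Bs' m) u - (Cs m + Cs' m) u)) \<longlonglongrightarrow> 0"
  proof (rule l2norm_null[rotated])
    fix m
    have e: "(Bs m + Bs' m) u - (Cs m + Cs' m) u = (Bs m u - Cs m u) + (Bs' m u - Cs' m u)" by simp
    show "l2norm ((Bs m + Bs' m) u - (Cs m + Cs' m) u) \<le> l2norm (Bs m u - Cs m u) + l2norm (Bs' m u - Cs' m u)"
      unfolding e by (intro l2_add l2_diff l)
  qed
qed

lemma sasym_diff:
  assumes "sasym Bs Cs" "sasym Bs' Cs'" shows "sasym (\<lambda>m. Bs m - Bs' m) (\<lambda>m. Cs m - Cs' m)"
  unfolding sasym_def
proof (intro ballI conjI allI)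
  fix u :: "'a vec" assume u: "u \<in> l2"
  have l: "Bs m u \<in> l2" "Cs m u \<in> l2" "Bs' m u \<in> l2" "Cs' m u \<in> l2" for m using assms u by (auto simp: sasym_def)
  show "(Bs m - Bs' m) u \<in> l2" "(Cs m - Cs' m) u \<in> l2" for m using l by (simp_all add: l2_diff)
  have "(\<lambda>m. l2norm (Bs m u - Cs m u)) \<longlonglongrightarrow> 0" "(\<lambda>m. l2norm (Bs' m u - Cs' m u)) \<longlonglongrightarrow> 0"
    using assms u by (auto simp: sasym_def)
  from tendsto_add_zero[OF this] show "(\<lambda>m. l2norm ((Bs m - Bs' m) u - (Cs m - Cs' m) u)) \<longlonglongrightarrow> 0"
  proof (rule l2norm_null[rotated])
    fix m
    have e: "(Bs m - Bs' m) u - (Cs m - Cs' m) u = (Bs m u - Cs m u) - (Bs' m u - Cs' m u)"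
      by (simp add: algebra_simps)
    show "l2norm ((Bs m - Bs' m) u - (Cs m - Cs' m) u) \<le> l2norm (Bs m u - Cs m u) + l2norm (Bs' m u - Cs' m u)"
      unfolding e by (intro l2_diff l)
  qed
qed

lemma sasym_subseq: "sasym Bs Cs \<Longrightarrow> strict_mono \<sigma> \<Longrightarrow> sasym (\<lambda>m. Bs (\<sigma> m)) (\<lambda>m. Cs (\<sigma> m))"
  unfolding sasym_def using LIMSEQ_subseq_LIMSEQ[of _ 0 \<sigma>] by (fastforce simp: o_def)

lemma sasym_cong:
  assumes "sasym Bs Cs" "\<And>m. op_eq (Bs m) (Bs' m)" "\<And>m. op_eq (Cs m) (Cs' m)"
  shows "sasym Bs' Cs'"
  using assms by (simp add: sasym_def op_eq_def)

lemma sasymI_delta: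
  assumes "\<And>m. opb K (Bs m)" "\<And>m. opb L (Cs m)"
    "\<And>s. (\<lambda>m. l2norm (Bs m (delta s) - Cs m (delta s))) \<longlonglongrightarrow> 0"
  shows "sasym Bs Cs"
  unfolding sasym_def
proof (intro ballI conjI allI)
  fix u :: "'a vec" assume u: "u \<in> l2"
  show "Bs m u \<in> l2" "Cs m u \<in> l2" for m by (intro opbD(2)[OF assms(1)] opbD(2)[OF assms(2)] u)+
  show "(\<lambda>m. l2norm (Bs m u - Cs m u)) \<longlonglongrightarrow> 0"
    using opb_strong_null[where D = "\<lambda>m. Bs m - Cs m", OF opb_diff[OF assms(1,2)] _ u] assms(3) by simp
qed

lemma sconv_unique: assumes "sconv Bs B" "sconv Bs C" shows "op_eq B C"
  unfolding op_eq_def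
proof
  fix u :: "'a vec" assume u: "u \<in> l2"
  have "sasym (\<lambda>_. B) (\<lambda>_. C)"
    using sasym_trans[OF sasym_sym] assms unfolding sconv_iff_sasym by blast
  then have l: "B u - C u \<in> l2" "(\<lambda>m::nat. l2norm (B u - C u)) \<longlonglongrightarrow> 0"
    using u by (auto simp: sasym_def l2_diff)
  then have "B u - C u = 0" by (intro l2norm_eq_0D) (auto simp: LIMSEQ_const_iff)
  then show "B u = C u" by simp
qed

section \<open>Shifted operators and limit operators\<close>

abbreviation shift_conj :: "'g::group_add \<Rightarrow> 'g op \<Rightarrow> 'g op" where
  "shift_conj h B \<equiv> Rop (- h) \<circ> B \<circ> Rop h"

lemma shift_conj_add: "shift_conj h (B + C) = shift_conj h B + shift_conj h C"
  by (simp add: fun_eq_iff Rop_def)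

lemma op_eq_shift_conj: "op_eq B C \<Longrightarrow> op_eq (shift_conj h B) (shift_conj h C)"
  by (simp add: op_eq_def Rop_l2)

lemma tends_inf_subseq: "tends_inf h \<Longrightarrow> strict_mono \<sigma> \<Longrightarrow> tends_inf (\<lambda>m. h (\<sigma> m))"
  unfolding tends_inf_def using eventually_subseq by blast

lemma limit_op_subseq:
  assumes "limit_op B h C" "strict_mono \<sigma>" shows "limit_op B (\<lambda>m. h (\<sigma> m)) C"
proof -
  have "sconv (\<lambda>m. shift_conj (h (\<sigma> m)) B') C'" if "sconv (\<lambda>m. shift_conj (h m) B') C'" for B' C'
    using sasym_subseq[OF that[unfolded sconv_iff_sasym] assms(2)] unfolding sconv_iff_sasym .
  then show ?thesis using assms tends_inf_subseq unfolding limit_op_def by blast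
qed

text \<open>Limit operators require convergence of the adjoints too, so asymptotic equality is
  demanded for an operator and for its adjoint.\<close>

lemma limit_op_transfer:
  assumes "limit_op B h C" "is_adj B Bs" "bounded_op B'" "is_adj B' Bs'" "tends_inf r"
    "sasym (\<lambda>m. shift_conj (r m) B') (\<lambda>m. shift_conj (h m) B)"
    "sasym (\<lambda>m. shift_conj (r m) Bs') (\<lambda>m. shift_conj (h m) Bs)"
  shows "limit_op B' r C"
proof -
  obtain Bs0 Cs where *: "sconv (\<lambda>m. shift_conj (h m) B) C" "is_adj B Bs0" "is_adj C Cs"
    "sconv (\<lambda>m. shift_conj (h m) Bs0) Cs"
    using assms(1) unfolding limit_op_def by blast
  \<comment> \<open>The adjoint hidden in \<open>limit_op\<close> may differ from \<open>Bs\<close>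
    off \<open>l2\<close>; it is replaced by uniqueness up to \<open>op_eq\<close>.\<close>
  have "sasym (\<lambda>m. shift_conj (h m) Bs) (\<lambda>_. Cs)"
    by (rule sasym_cong[OF *(4)[unfolded sconv_iff_sasym] op_eq_shift_conj[OF is_adj_unique[OF *(2) assms(2)]]])
       (simp add: op_eq_def)
  then have "sconv (\<lambda>m. shift_conj (r m) Bs') Cs"
    using sasym_trans[OF assms(7)] unfolding sconv_iff_sasym by blast
  moreover have "sconv (\<lambda>m. shift_conj (r m) B') C"
    using sasym_trans[OF assms(6)] *(1) unfolding sconv_iff_sasym by blast
  ultimately show ?thesis unfolding limit_op_def using assms *(3) by blast
qed

lemma shift_conj_Pr: "shift_conj h (Pr X) = Pr {t. t - h \<in> X}"
  by (simp add: fun_eq_iff Rop_Pr_Rop)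

lemma sconv_Pr:
  assumes "\<And>s. \<forall>\<^sub>F m in sequentially. s \<in> X m \<longleftrightarrow> s \<in> Z"
  shows "sconv (\<lambda>m. Pr (X m)) (Pr Z)"
  unfolding sconv_iff_sasym
proof (rule sasymI_delta[OF opb_Pr opb_Pr])
  fix s
  show "(\<lambda>m. l2norm (Pr (X m) (delta s) - Pr Z (delta s))) \<longlonglongrightarrow> 0"
    by (rule tendsto_eventually) (use assms[of s] in eventually_elim, simp add: Pr_delta)
qed

section \<open>Inflated sequences\<close>

locale inflated =
  fixes \<Omega> :: "'g::{group_add,countable} set" and Y :: "nat \<Rightarrow> 'g set" and v :: "nat \<Rightarrow> 'g"
  assumes zero_Om: "0 \<in> \<Omega>" and generates: "\<forall>g. \<exists>xs. set xs \<subseteq> \<Omega> \<and> sum_list xs = g"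
    and finY: "\<And>n. finite (Y n)" and incY: "\<And>n. Y n \<subseteq> Y (Suc n)" and unY: "(\<Union>n. Y n) = UNIV"
    and infl: "inflating \<Omega> Y v"
begin

lemma monoY: "mono Y"
  using incY by (simp add: mono_iff_le_Suc)

lemma Y_eventually: "\<forall>\<^sub>F n in sequentially. g \<in> Y n"
proof -
  obtain N where "g \<in> Y N" using unY by blast
  then show ?thesis unfolding eventually_sequentially using monoD[OF monoY, of N] by blast
qed

lemma Omega_pow_eventually: "\<forall>\<^sub>F n in sequentially. g \<in> Omega_pow \<Omega> (Suc n)"
proof -
  obtain xs where "set xs \<subseteq> \<Omega>" "sum_list xs = g" using generates by blast
  then have "g \<in> Omega_pow \<Omega> (Suc n)" if "length xs \<le> n" for n
    using that unfolding Omega_pow_def by force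
  then show ?thesis unfolding eventually_sequentially by blast
qed

text \<open>The empty word puts 0 into the middle factor of \<open>Zset\<close>, which leaves a sum
  of a point of \<open>Omega_pow\<close> and a point of \<open>Y n\<close>. So \<open>Zset\<close>
  contains a growing neighbourhood of the block.\<close>

lemma Zset_I: assumes "x \<in> Omega_pow \<Omega> (Suc n)" "y \<in> Y n" shows "x + y \<in> Zset \<Omega> Y n"
proof -
  let ?W = "Y n \<union> Omega_pow \<Omega> (Suc n)"
  have "0 \<in> ?W" unfolding Omega_pow_def by (auto intro!: exI[of _ "[]"])
  then have "- 0 \<in> uminus ` ?W" by (rule imageI)
  then have "x + - 0 \<in> setmul ?W (uminus ` ?W)" using assms unfolding setmul_def by blast
  then have "(x + - 0) + y \<in> setmul (setmul ?W (uminus ` ?W)) ?W" using assms unfolding setmul_def[of "setmul _ _"] by blast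
  then show ?thesis by (simp add: Zset_def Let_def)
qed

lemma Y_subset_Zset: "y \<in> Y n \<Longrightarrow> y \<in> Zset \<Omega> Y n"
  using Zset_I[of 0 n y] unfolding Omega_pow_def by (force intro!: exI[of _ "[]"])

lemma Zset_disjoint:
  assumes "p + v m \<in> Zset \<Omega> Y m" "p + v n \<in> Zset \<Omega> Y n" shows "m = n"
proof (rule ccontr)
  assume "m \<noteq> n"
  have "p \<in> setmul (Zset \<Omega> Y k) {- v k}" if "p + v k \<in> Zset \<Omega> Y k" for k
  proof -
    have "p = (p + v k) + - v k" by (simp add: add.assoc)
    then show ?thesis using that unfolding setmul_def by blast
  qed
  then show False using assms \<open>m \<noteq> n\<close> infl unfolding inflating_def by blast
qed

lemma block_unique: "t + v m \<in> Y m \<Longrightarrow> t + v n \<in> Y n \<Longrightarrow> m = n"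
  using Zset_disjoint Y_subset_Zset by blast

lemma Gamma'_iff: "t \<in> Gamma' Y v \<longleftrightarrow> (\<forall>n. t + v n \<notin> Y n)"
proof -
  have "t \<in> setmul (Y n) {- v n} \<longleftrightarrow> t + v n \<in> Y n" for n
  proof
    assume "t \<in> setmul (Y n) {- v n}"
    then show "t + v n \<in> Y n" by (auto simp: setmul_def add.assoc)
  next
    assume *: "t + v n \<in> Y n"
    have "t = (t + v n) + - v n" by (simp add: add.assoc)
    then show "t \<in> setmul (Y n) {- v n}" using * unfolding setmul_def by blast
  qed
  then show ?thesis by (simp add: Gamma'_def)
qed

section \<open>Block diagonal operators\<close>

text \<open>The pointwise form of the sum of the operators \<open>T n\<close> transplanted to the
  disjoint blocks \<open>Y n\<close> shifted by \<open>- v n\<close>. It replaces the series, so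
  that the adjoint can be treated without a second convergence argument.\<close>

definition block_diag :: "(nat \<Rightarrow> 'g op) \<Rightarrow> 'g op \<Rightarrow> bool" where
  "block_diag T D \<longleftrightarrow> (\<forall>u\<in>l2. (\<forall>n t. t + v n \<in> Y n \<longrightarrow> D u t = T n (Rop (- v n) u) (t + v n))
     \<and> (\<forall>t\<in>Gamma' Y v. D u t = 0))"

text \<open>All blocks other than \<open>k\<close> annihilate \<open>delta p\<close>. The point
  \<open>p\<close> need not lie in block \<open>k\<close> either: if it lies in no block, both sides
  vanish and \<open>k\<close> is arbitrary.\<close>

lemma block_diag_delta:
  assumes "block_diag T D" "\<And>n. opb K (T n)" "\<And>n. localised (Y n) (T n)"
    and "\<And>l. l \<noteq> k \<Longrightarrow> p + v l \<notin> Y l"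
  shows "D (delta p) = Rop (v k) (T k (delta (p + v k)))"
proof
  fix t
  have out: "T n u x = 0" if "x \<notin> Y n" for n u x
    using localised_Pr(1)[OF assms(3), of n u] that by (metis Pr_def)
  have R: "Rop (- v n) (delta p) = delta (p + v n)" for n by (simp add: Rop_delta)
  show "D (delta p) t = Rop (v k) (T k (delta (p + v k))) t"
  proof (cases "t \<in> Gamma' Y v")
    case True
    then show ?thesis using assms(1) out[of "t + v k" k] by (simp add: block_diag_def Gamma'_iff Rop_def)
  next
    case False
    then obtain n where n: "t + v n \<in> Y n" by (auto simp: Gamma'_iff)
    then have D: "D (delta p) t = T n (delta (p + v n)) (t + v n)"
      using assms(1) by (auto simp: block_diag_def R)
    show ?thesis
    proof (cases "n = k")
      case True
      then show ?thesis using D by (simp add: Rop_def)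
    next
      case False
      then have "T n (delta (p + v n)) = 0" using localised_delta[OF assms(2,3)] assms(4) by blast
      moreover have "t + v k \<notin> Y k" using block_unique[OF n] False by blast
      ultimately show ?thesis using D out by (simp add: Rop_def)
    qed
  qed
qed

text \<open>The column of \<open>D\<close> at a point is a shifted column of the one block
  containing it, so the matrix formula for the adjoint only sees that block.\<close>

lemma block_diag_adj:
  assumes "block_diag T D" "\<And>n. opb K (T n)" "\<And>n. localised (Y n) (T n)" "is_adj D Ds"
  shows "block_diag (\<lambda>n. adjY (Y n) (T n)) Ds"
  unfolding block_diag_def
proof (intro ballI conjI allI impI)
  fix w :: "'g vec" assume w: "w \<in> l2"
  have m: "Ds w s = l2inner w (D (delta s))" for s by (rule is_adj_matrix[OF assms(4) w])
  {
    fix n s assume s: "s + v n \<in> Y n"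
    have "D (delta s) = Rop (v n) (T n (delta (s + v n)))"
      by (rule block_diag_delta[OF assms(1-3)]) (use block_unique[OF s] in blast)
    then have "Ds w s = l2inner w (Rop (v n) (T n (delta (s + v n))))" using m by simp
    also have "\<dots> = l2inner (Rop (- v n) w) (T n (delta (s + v n)))"
      using is_adj_Rop[of "- v n"] w opbD(2)[OF assms(2) delta_l2] by (simp add: is_adj_def)
    also have "\<dots> = adjY (Y n) (T n) (Rop (- v n) w) (s + v n)"
      using is_adj_matrix[OF is_adj_adjY[OF finY assms(2,3)] Rop_l2[OF w]] by simp
    finally show "Ds w s = adjY (Y n) (T n) (Rop (- v n) w) (s + v n)" .
  }
  fix s assume s: "s \<in> Gamma' Y v"
  \<comment> \<open>As \<open>s\<close> lies in no block, any index may be used; 0 is an arbitrary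
    choice.\<close>
  have "D (delta s) = Rop (v 0) (T 0 (delta (s + v 0)))"
    by (rule block_diag_delta[OF assms(1-3)]) (use s in \<open>simp add: Gamma'_iff\<close>)
  also have "T 0 (delta (s + v 0)) = 0" using localised_delta[OF assms(2,3)] s by (simp add: Gamma'_iff)
  finally show "Ds w s = 0" using m by (simp add: Rop_def l2inner_def)
qed

text \<open>Relative to block \<open>k m\<close>, a fixed point \<open>s\<close> is seen at
  \<open>s - r m\<close>, which is \<open>s - f\<close> added to a point of \<open>Y (k m)\<close>.
  For large \<open>m\<close> the word length of \<open>s - f\<close> is admissible, so this position
  is in \<open>Zset\<close>, and disjointness keeps it away from every other block. On each
  \<open>delta s\<close> the two sides are then eventually equal.\<close>

lemma block_diag_sasym:
  assumes "block_diag T D" "opb L D" "\<And>n. opb K (T n)" "\<And>n. localised (Y n) (T n)"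
    and "strict_mono k" "\<forall>\<^sub>F m in sequentially. f - r m \<in> Y (k m)"
  shows "sasym (\<lambda>m. shift_conj (v (k m) + r m) D) (\<lambda>m. shift_conj (r m) (T (k m)))"
proof (rule sasymI_delta[OF opb_conj[OF assms(2)] opb_conj[OF assms(3)]])
  fix s
  have "\<forall>\<^sub>F m in sequentially. s - f \<in> Omega_pow \<Omega> (Suc (k m))"
    using eventually_subseq[OF assms(5) Omega_pow_eventually] .
  with assms(6) have "\<forall>\<^sub>F m in sequentially.
     shift_conj (v (k m) + r m) D (delta s) = shift_conj (r m) (T (k m)) (delta s)"
  proof eventually_elim
    case (elim m)
    let ?k = "k m" and ?h = "v (k m) + r m"
    have sh: "s - ?h + v ?k = s - r m" by (simp add: diff_conv_add_uminus minus_add add.assoc del: add_uminus_conv_diff)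
    have "(s - f) + (f - r m) \<in> Zset \<Omega> Y ?k" using Zset_I[OF elim(2,1)] .
    then have "s - ?h + v ?k \<in> Zset \<Omega> Y ?k" unfolding sh by (simp only: add_diff_eq diff_add_cancel)
    then have "s - ?h + v l \<notin> Y l" if "l \<noteq> ?k" for l using Zset_disjoint Y_subset_Zset that by blast
    then have "D (delta (s - ?h)) = Rop (v ?k) (T ?k (delta (s - r m)))"
      using block_diag_delta[OF assms(1,3,4), of ?k "s - ?h"] sh by simp
    moreover have "- ?h + v ?k = - r m" by (simp add: minus_add add.assoc)
    ultimately show ?case by (simp add: Rop_delta Rop_Rop)
  qed
  then show "(\<lambda>m. l2norm (shift_conj (v (k m) + r m) D (delta s) - shift_conj (r m) (T (k m)) (delta s))) \<longlonglongrightarrow> 0"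
    by (intro tendsto_eventually) (auto elim!: eventually_mono)
qed

text \<open>The estimate of \<open>consistent_limit\<close> is uniform in the base point and can be
  applied at the moving points \<open>s - r m\<close>; the hypothesis, used for finitely many
  \<open>g + s\<close>, provides its premise.\<close>

lemma deep_sasym:
  assumes "tame Y T" "opb K C" "\<And>s t. (\<lambda>n. T n (delta s) t) \<longlonglongrightarrow> C (delta s) t"
    and "\<And>s. \<forall>\<^sub>F m in sequentially. s - r m \<in> Y (k m)"
  shows "sasym (\<lambda>m. shift_conj (r m) (T (k m))) (\<lambda>m. shift_conj (r m) C)"
proof -
  obtain L where L: "\<And>n. opb L (T n)" "\<And>n. localised (Y n) (T n)" "quasi_local T" "consistent Y T"
    using tameE[OF assms(1)] by blast
  show ?thesis
  proof (rule sasymI_delta[OF opb_conj[OF L(1)] opb_conj[OF assms(2)]])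
    fix s
    show "(\<lambda>m. l2norm (shift_conj (r m) (T (k m)) (delta s) - shift_conj (r m) C (delta s))) \<longlonglongrightarrow> 0"
    proof (rule tendstoI)
      fix e :: real assume e: "e > 0"
      then have "e / 2 > 0" by simp
      then obtain G where G: "finite G"
        "\<And>n s. (\<And>g. g \<in> G \<Longrightarrow> g + s \<in> Y n) \<Longrightarrow> l2norm (T n (delta s) - C (delta s)) \<le> e / 2"
        using consistent_limit[OF L(4,1) monoY unY assms(3)] by blast
      have "\<forall>\<^sub>F m in sequentially. \<forall>g\<in>G. (g + s) - r m \<in> Y (k m)"
        using G(1) assms(4) by (simp add: eventually_ball_finite)
      then show "\<forall>\<^sub>F m in sequentially.
        dist (l2norm (shift_conj (r m) (T (k m)) (delta s) - shift_conj (r m) C (delta s))) 0 < e"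
      proof eventually_elim
        case (elim m)
        have "shift_conj (r m) (T (k m)) (delta s) - shift_conj (r m) C (delta s)
          = Rop (- r m) (T (k m) (delta (s - r m)) - C (delta (s - r m)))" by (simp add: Rop_delta Rop_diff)
        moreover have "l2norm (T (k m) (delta (s - r m)) - C (delta (s - r m))) \<le> e / 2"
          using elim by (intro G) (simp add: add_diff_eq)
        ultimately show ?case using e by (simp only: l2norm_Rop dist_real_def) simp
      qed
    qed
  qed
qed

text \<open>The summands have disjoint supports and read disjoint parts of \<open>u\<close>, so
  Pythagoras bounds every partial sum by \<open>K\<close> itself, without growth in the number of
  summands.\<close>

lemma block_diag_of_sconv:
  assumes "\<And>n. opb K (T n)" "\<And>n. localised (Y n) (T n)"
    and "sconv (\<lambda>N. \<Sum>n<N. Rop (v n) \<circ> T n \<circ> Pr (Y n) \<circ> Rop (- v n)) D"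
  shows "block_diag T D" "opb K D"
proof -
  define S where "S N = (\<Sum>n<N. Rop (v n) \<circ> T n \<circ> Pr (Y n) \<circ> Rop (- v n))" for N
  define U where "U N = {t. \<exists>n<N. t + v n \<in> Y n}" for N
  have out: "T n u x = 0" if "x \<notin> Y n" for n u x
    using localised_Pr(1)[OF assms(2), of n u] that by (metis Pr_def)
  have Sap: "S N u t = (\<Sum>n<N. T n (Rop (- v n) u) (t + v n))" for N u t
    by (induction N) (simp_all add: S_def Rop_def[of "v _"] localised_Pr(2)[OF assms(2)])
  \<comment> \<open>This bound may depend on \<open>N\<close>; it supplies linearity and membership
    in \<open>l2\<close>, and its constant is sharpened to \<open>K\<close> below.\<close>
  have S_opb: "\<exists>M. opb M (S N)" for N
  proof (induction N)
    case 0
    have "opb 0 (S 0)" by (simp add: S_def opb_def zero_fun_def)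
    then show ?case by blast
  next
    case (Suc N)
    have "S (Suc N) = S N + (Rop (v N) \<circ> T N \<circ> Pr (Y N) \<circ> Rop (- v N))" by (simp add: S_def)
    then show ?case using Suc opb_add[OF _ opb_comp[OF opb_comp[OF opb_comp[OF opb_Rop assms(1)] opb_Pr] opb_Rop]]
      by metis
  qed
  have K: "0 \<le> K" using opbD(1)[OF assms(1)] .
  \<comment> \<open>Squares are additive over disjoint supports, and only the part of
    \<open>u\<close> on the first \<open>N\<close> blocks, \<open>U N\<close>, enters; this makes
    the induction close with a fixed constant.\<close>
  have S_le: "(l2norm (S N u))\<^sup>2 \<le> K\<^sup>2 * (l2norm (Pr (U N) u))\<^sup>2" if u: "u \<in> l2" for N u
  proof (induction N)
    case 0
    then show ?case by (simp add: S_def)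
  next
    case (Suc N)
    define b where "b = Rop (v N) (T N (Rop (- v N) u))"
    define X where "X = {t. t + v N \<in> Y N}"
    have bl: "b \<in> l2" unfolding b_def by (intro Rop_l2 opbD(2)[OF assms(1)] u)
    have Sl: "S N u \<in> l2" using S_opb opbD(2)[OF _ u] by blast
    have e: "S (Suc N) u = S N u + b" by (simp add: fun_eq_iff Sap b_def Rop_def[of "v N"])
    have dis: "S N u t = 0 \<or> b t = 0" for t
    proof (cases "t + v N \<in> Y N")
      case True
      then have "T n (Rop (- v n) u) (t + v n) = 0" if "n < N" for n
        using out block_unique[OF True, of n] that by blast
      then show ?thesis by (simp add: Sap)
    next
      case False
      then show ?thesis by (simp add: b_def Rop_def[of "v N"] out)
    qed
    have bX: "l2norm b \<le> K * l2norm (Pr X u)"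
    proof -
      have "l2norm b = l2norm (T N (Pr (Y N) (Rop (- v N) u)))"
        by (simp add: b_def localised_Pr(2)[OF assms(2)])
      also have "\<dots> \<le> K * l2norm (Pr (Y N) (Rop (- v N) u))"
        by (intro opbD(3)[OF assms(1)] Pr_finite_l2 finY)
      also have "l2norm (Pr (Y N) (Rop (- v N) u)) = l2norm (Rop (- (- v N)) (Pr (Y N) (Rop (- v N) u)))"
        by (simp only: l2norm_Rop)
      also have "\<dots> = l2norm (Pr X u)" by (simp only: Rop_Pr_Rop X_def) simp
      finally show ?thesis .
    qed
    have PU: "Pr (U (Suc N)) u = Pr (U N) u + Pr X u" and dU: "Pr (U N) u t = 0 \<or> Pr X u t = 0" for t
    proof -
      have "t \<in> X \<Longrightarrow> t \<notin> U N" for t using block_unique by (auto simp: X_def U_def)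
      moreover have "U (Suc N) = U N \<union> X" by (auto simp: X_def U_def less_Suc_eq)
      ultimately show "Pr (U (Suc N)) u = Pr (U N) u + Pr X u" "Pr (U N) u t = 0 \<or> Pr X u t = 0"
        by (auto simp: Pr_def fun_eq_iff)
    qed
    have "(l2norm (S (Suc N) u))\<^sup>2 = (l2norm (S N u))\<^sup>2 + (l2norm b)\<^sup>2"
      unfolding e by (rule l2norm_disjoint_add[OF Sl bl dis])
    also have "\<dots> \<le> K\<^sup>2 * (l2norm (Pr (U N) u))\<^sup>2 + (K * l2norm (Pr X u))\<^sup>2"
      by (intro add_mono Suc power_mono bX) simp
    also have "\<dots> = K\<^sup>2 * (l2norm (Pr (U (Suc N)) u))\<^sup>2"
      unfolding PU l2norm_disjoint_add[OF Pr_l2(1)[OF u] Pr_l2(1)[OF u] dU]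
      by (simp add: power_mult_distrib distrib_left)
    finally show ?case .
  qed
  have SK: "opb K (S N)" for N
  proof -
    obtain M where M: "opb M (S N)" using S_opb by blast
    show ?thesis
    proof (rule opb_sharpen[OF M K])
      fix u :: "'g vec" assume u: "u \<in> l2"
      have "(l2norm (S N u))\<^sup>2 \<le> (K * l2norm (Pr (U N) u))\<^sup>2" using S_le[OF u] by (simp add: power_mult_distrib)
      then have "l2norm (S N u) \<le> K * l2norm (Pr (U N) u)" using K by (simp add: power2_le_iff_abs_le)
      also have "\<dots> \<le> K * l2norm u" by (rule mult_left_mono[OF Pr_l2(2)[OF u] K])
      finally show "l2norm (S N u) \<le> K * l2norm u" .
    qed
  qed
  have lim: "(\<lambda>N. S N u t) \<longlonglongrightarrow> D u t" if "u \<in> l2" for u t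
    using assms(3) that unfolding sconv_def S_def[symmetric] by (intro l2_tendsto_pointwise) auto
  show "opb K D" by (rule opb_limit[OF SK lim])
  show "block_diag T D" unfolding block_diag_def
  proof (intro ballI conjI allI impI)
    fix u :: "'g vec" assume u: "u \<in> l2"
    {
      fix n t assume t: "t + v n \<in> Y n"
      \<comment> \<open>At a point of block \<open>n\<close> a single summand is nonzero, so the
        partial sums are constant for \<open>N\<close> beyond \<open>n\<close> and their limit is
        that summand.\<close>
      have "S N u t = T n (Rop (- v n) u) (t + v n)" if "n < N" for N
      proof -
        have "T i (Rop (- v i) u) (t + v i) = (if i = n then T n (Rop (- v n) u) (t + v n) else 0)" for i
        proof (cases "i = n")
          case False
          then have "t + v i \<notin> Y i" using block_unique[OF t] by blast
          then show ?thesis using False out by simp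
        qed simp
        then have "S N u t = (\<Sum>i<N. if i = n then T n (Rop (- v n) u) (t + v n) else 0)"
          unfolding Sap by (intro sum.cong refl)
        then show ?thesis using that by simp
      qed
      then have "\<forall>\<^sub>F N in sequentially. S N u t = T n (Rop (- v n) u) (t + v n)"
        by (intro eventually_mono[OF eventually_gt_at_top[of n]])
      then show "D u t = T n (Rop (- v n) u) (t + v n)"
        using LIMSEQ_unique[OF lim[OF u] tendsto_eventually] by blast
    }
    fix t assume "t \<in> Gamma' Y v"
    then have "S N u t = 0" for N using out by (simp add: Sap Gamma'_iff)
    then show "D u t = 0" using lim[OF u, of t] by (simp add: LIMSEQ_const_iff)
  qed
qed

end

section \<open>Extraction of subsequences\<close>

text \<open>If every label in the finite set \<open>F\<close> eventually failed, all would
  eventually fail together; hence one label holds infinitely often.\<close>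

lemma pigeonhole_subseq:
  assumes "finite F" "\<not> (\<forall>\<^sub>F m in sequentially. \<forall>c\<in>F. \<not> Q m c)"
  obtains c \<tau> where "c \<in> F" "strict_mono (\<tau> :: nat \<Rightarrow> nat)" "\<And>m. Q (\<tau> m) c"
proof -
  obtain c where "c \<in> F" "\<not> (\<forall>\<^sub>F m in sequentially. \<not> Q m c)"
    using assms eventually_ball_finite[OF assms(1), of "\<lambda>m c. \<not> Q m c"] by blast
  then show thesis using not_eventually_sequentiallyD[of "\<lambda>m. \<not> Q m c"] that by blast
qed

lemma strict_mono_subseq:
  fixes n :: "nat \<Rightarrow> nat"
  assumes "\<And>N. \<forall>\<^sub>F m in sequentially. N < n m"
  obtains \<tau> :: "nat \<Rightarrow> nat" where "strict_mono \<tau>" "strict_mono (\<lambda>m. n (\<tau> m))"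
proof -
  have "\<exists>\<tau>. \<forall>i. True \<and> (\<tau> i < \<tau> (Suc i) \<and> n (\<tau> i) < n (\<tau> (Suc i)))"
  proof (rule dependent_nat_choice[where P = "\<lambda>_ _. True"])
    fix x i :: nat
    have "\<forall>\<^sub>F m in sequentially. x < m \<and> n x < n m"
      using assms eventually_gt_at_top by (intro eventually_conj) auto
    then show "\<exists>y. True \<and> x < y \<and> n x < n y"
      using eventually_happens'[OF sequentially_bot] by blast
  qed simp
  then obtain \<tau> where "\<forall>i. \<tau> i < \<tau> (Suc i) \<and> n (\<tau> i) < n (\<tau> (Suc i))" by blast
  then show thesis by (intro that[of \<tau>]) (simp_all add: strict_mono_Suc_iff)
qed

text \<open>Sequential compactness of the power set of a countable set, by a diagonal argument over
  the enumerated points. It will make the shifted projections onto \<open>Gamma'\<close>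
  converge.\<close>

lemma convergent_sets_subseq:
  fixes X :: "nat \<Rightarrow> 'a::countable set"
  obtains \<kappa> Z where "strict_mono (\<kappa> :: nat \<Rightarrow> nat)" "\<And>t. \<forall>\<^sub>F m in sequentially. t \<in> X (\<kappa> m) \<longleftrightarrow> t \<in> Z"
proof -
  let ?P = "\<lambda>n s. \<exists>b. \<forall>\<^sub>F m in sequentially. (from_nat n \<in> X (s m)) = b"
  interpret subseqs ?P
  proof
    fix n :: nat and s :: "nat \<Rightarrow> nat" assume "strict_mono s"
    show "\<exists>r'. strict_mono r' \<and> ?P n (s \<circ> r')"
    proof (cases "\<forall>\<^sub>F m in sequentially. from_nat n \<in> X (s m)")
      case True
      then have "?P n (s \<circ> id)" by (intro exI[of _ True]) simp
      then show ?thesis using strict_mono_id by blast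
    next
      case False
      then obtain r :: "nat \<Rightarrow> nat" where "strict_mono r" "\<forall>m. from_nat n \<notin> X (s (r m))"
        using not_eventually_sequentiallyD[OF False] by blast
      moreover then have "?P n (s \<circ> r)" by (intro exI[of _ False]) simp
      ultimately show ?thesis by blast
    qed
  qed
  have "\<exists>b. \<forall>\<^sub>F m in sequentially. (t \<in> X (diagseq m)) = b" for t
  proof -
    let ?n = "to_nat t"
    \<comment> \<open>The diagonal sequence is a subsequence of the one stabilising the point number
      \<open>?n\<close> only after an initial segment, hence the shift by
      \<open>Suc ?n\<close>.\<close>
    have "?P ?n (diagseq \<circ> (+) (Suc ?n))"
    proof (rule diagseq_holds)
      fix r s :: "nat \<Rightarrow> nat" and n :: nat assume "strict_mono r" "?P n s"
      then show "?P n (s \<circ> r)" using eventually_subseq by fastforce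
    qed
    then obtain b where "\<forall>\<^sub>F m in sequentially. (t \<in> X (diagseq (m + Suc ?n))) = b" by (auto simp: add.commute)
    then show ?thesis using eventually_sequentially_seg[of "\<lambda>m. (t \<in> X (diagseq m)) = b" "Suc ?n"] by blast
  qed
  then have "\<exists>b. \<forall>t. \<forall>\<^sub>F m in sequentially. (t \<in> X (diagseq m)) = b t" by (intro choice allI)
  then obtain b where "\<And>t. \<forall>\<^sub>F m in sequentially. (t \<in> X (diagseq m)) = b t" by blast
  then show thesis using that[of diagseq "Collect b"] subseq_diagseq by simp
qed

text \<open>The points \<open>sum_list (drop i xs) + p\<close> form a path from \<open>p\<close>, at
  \<open>i = length xs\<close>, to the endpoint, at \<open>i = 0\<close>, adding one generator on
  the left at a time. The point just before the first exit from \<open>X\<close> is a boundary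
  point.\<close>

lemma bdry_Om_on_path:
  assumes "set xs \<subseteq> \<Omega>" "p \<in> X" "sum_list xs + p \<notin> X"
  shows "\<exists>i\<le>length xs. sum_list (drop i xs) + p \<in> bdry_Om \<Omega> X"
  using assms
proof (induction xs)
  case (Cons a xs)
  show ?case
  proof (cases "sum_list xs + p \<in> X")
    case True
    then have "sum_list (drop 1 (a # xs)) + p \<in> bdry_Om \<Omega> X"
      using Cons.prems by (auto simp: bdry_Om_def int_Om_def add.assoc)
    then show ?thesis by force
  next
    case False
    then obtain i where "i \<le> length xs" "sum_list (drop i xs) + p \<in> bdry_Om \<Omega> X" using Cons by auto
    then show ?thesis by (intro exI[of _ "Suc i"]) simp
  qed
qed simp

section \<open>Shifts along the inflating sequence\<close>

context inflated
begin

text \<open>From some index on, the value \<open>v (k m) + r m\<close> determines a point of block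
  \<open>k m\<close> by subtraction from \<open>f\<close>, and disjointness recovers
  \<open>k m\<close> and then \<open>m\<close>. Injectivity means that a finite set is visited only
  finitely often.\<close>

lemma tends_inf_inflated:
  assumes "strict_mono k" "\<forall>\<^sub>F m in sequentially. f - r m \<in> Y (k m)"
  shows "tends_inf (\<lambda>m. v (k m) + r m)"
  unfolding tends_inf_def
proof (intro allI impI)
  fix F :: "'g set" assume F: "finite F"
  obtain N where N: "\<And>m. N \<le> m \<Longrightarrow> f - r m \<in> Y (k m)" using assms(2) by (auto simp: eventually_sequentially)
  define M where "M = {m. N \<le> m \<and> v (k m) + r m \<in> F}"
  have sh: "f - (v (k m) + r m) + v (k m) = f - r m" for m
    by (simp add: diff_conv_add_uminus minus_add add.assoc del: add_uminus_conv_diff)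
  have "inj_on (\<lambda>m. v (k m) + r m) M"
  proof (rule inj_onI)
    fix m m' assume *: "m \<in> M" "m' \<in> M" "v (k m) + r m = v (k m') + r m'"
    have "f - (v (k m) + r m) + v (k m) \<in> Y (k m)" using * N unfolding sh M_def by blast
    moreover have "f - (v (k m') + r m') + v (k m') \<in> Y (k m')" using * N unfolding sh M_def by blast
    ultimately have "k m = k m'" using block_unique unfolding *(3) by blast
    then show "m = m'" using assms(1) by (simp add: strict_mono_eq)
  qed
  moreover have "finite ((\<lambda>m. v (k m) + r m) ` M)" by (rule finite_subset[OF _ F]) (auto simp: M_def)
  ultimately have "finite M" using finite_imageD by blast
  then obtain N' where "\<forall>m\<in>M. m < N'" using finite_nat_set_iff_bounded by blast
  then have "v (k m) + r m \<notin> F" if "max N N' \<le> m" for m using that unfolding M_def by force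
  then show "\<forall>\<^sub>F m in sequentially. v (k m) + r m \<notin> F" unfolding eventually_sequentially by blast
qed

text \<open>Every fixed point is eventually seen inside block \<open>k m\<close>; hence the block
  part is asymptotic to the shifts of \<open>C\<close>, and the projection onto
  \<open>Gamma'\<close> disappears strongly.\<close>

lemma inflated_deep:
  assumes "block_diag T D" "opb L D" "tame Y T" "opb K C"
    and "\<And>s t. (\<lambda>n. T n (delta s) t) \<longlonglongrightarrow> C (delta s) t"
    and "strict_mono k" "\<And>s. \<forall>\<^sub>F m in sequentially. s - r m \<in> Y (k m)"
  shows "sasym (\<lambda>m. shift_conj (v (k m) + r m) (D + Pr (Gamma' Y v))) (\<lambda>m. shift_conj (r m) C)"
proof -
  obtain M where M: "\<And>n. opb M (T n)" "\<And>n. localised (Y n) (T n)"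
    using tameE[OF assms(3)] by blast
  have 1: "sasym (\<lambda>m. shift_conj (v (k m) + r m) D) (\<lambda>m. shift_conj (r m) C)"
    by (rule sasym_trans[OF block_diag_sasym[OF assms(1,2) M assms(6,7)] deep_sasym[OF assms(3,4,5,7)]])
  have "\<forall>\<^sub>F m in sequentially. s \<in> {t. t - (v (k m) + r m) \<in> Gamma' Y v} \<longleftrightarrow> s \<in> {}" for s
    using assms(7)[of s]
  proof eventually_elim
    case (elim m)
    have "s - (v (k m) + r m) + v (k m) = s - r m"
      by (simp add: diff_conv_add_uminus minus_add add.assoc del: add_uminus_conv_diff)
    then have "s - (v (k m) + r m) + v (k m) \<in> Y (k m)" using elim by simp
    then have "s - (v (k m) + r m) \<notin> Gamma' Y v" unfolding Gamma'_iff by blast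
    then show ?case by simp
  qed
  then have "sconv (\<lambda>m. shift_conj (v (k m) + r m) (Pr (Gamma' Y v))) (Pr {})"
    unfolding shift_conj_Pr by (rule sconv_Pr)
  from sasym_add[OF 1 this[unfolded sconv_iff_sasym]] show ?thesis
    unfolding shift_conj_add by (rule sasym_cong) (simp_all add: op_eq_def fun_eq_iff)
qed

end

section \<open>Limit operators of the inflated operator\<close>

locale inflated_sequence = inflated +
  fixes AA :: "nat \<Rightarrow> ('a::{group_add,countable}) op" and A OpA :: "'a op"
  assumes AA: "AA \<in> SY Y" and A_def: "sconv (\<lambda>n. AA n \<circ> Pr (Y n)) A"
    and OpA_def: "sconv (\<lambda>N. \<Sum>n<N. Rop (v n) \<circ> AA n \<circ> Pr (Y n) \<circ> Rop (- v n)) OpA"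
begin

abbreviation "AAs \<equiv> \<lambda>n. adjY (Y n) (AA n)"
abbreviation "PG \<equiv> Pr (Gamma' Y v)"

lemma tame_AA: "tame Y AA" and tame_AAs: "tame Y AAs"
  using SY_tame[of Y AA] finY AA by blast+

lemma localised_AA: "localised (Y n) (AA n)"
  using tame_AA unfolding tame_def by blast

definition K where "K = (SOME K. \<forall>n. opb K (AA n))"

lemma opb_AA: "opb K (AA n)"
  using someI_ex[of "\<lambda>K. \<forall>n. opb K (AA n)"] tame_AA unfolding tame_def K_def by blast

lemma AA_tendsto: assumes "u \<in> l2" shows "(\<lambda>n. AA n u t) \<longlonglongrightarrow> A u t"
proof -
  have "AA n \<circ> Pr (Y n) = AA n" for n using localised_Pr(2)[OF localised_AA] by (simp add: fun_eq_iff)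
  then have "sconv AA A" using A_def by simp
  then show ?thesis using assms unfolding sconv_def by (intro l2_tendsto_pointwise) auto
qed

lemma opb_A: "opb K A"
  by (rule opb_limit[OF opb_AA AA_tendsto])

definition As where "As = (SOME C. is_adj A C)"
definition OpAs where "OpAs = (SOME C. is_adj OpA C)"

lemma block_diag_OpA: "block_diag AA OpA" and opb_OpA: "opb K OpA"
  using block_diag_of_sconv[of K AA OpA] opb_AA localised_AA OpA_def by blast+

lemma is_adj_A: "is_adj A As" and is_adj_OpA: "is_adj OpA OpAs"
  unfolding As_def OpAs_def using is_adj_exists opb_A opb_OpA by (metis someI_ex)+

text \<open>Strong convergence of \<open>AA\<close> transposes only to entrywise convergence of the
  adjoints, which is all that \<open>deep_sasym\<close> asks for.\<close>

lemma AAs_tendsto: "(\<lambda>n. AAs n (delta s) t) \<longlonglongrightarrow> As (delta s) t"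
proof -
  have "AAs n (delta s) t = cnj (AA n (delta t) s)" for n
    using is_adj_matrix[OF is_adj_adjY[OF finY opb_AA localised_AA] delta_l2] by simp
  moreover have "As (delta s) t = cnj (A (delta t) s)"
    using is_adj_matrix[OF is_adj_A delta_l2] by simp
  ultimately show ?thesis using tendsto_cnj[OF AA_tendsto[OF delta_l2]] by simp
qed

lemma block_diag_OpAs: "block_diag AAs OpAs"
  using block_diag_adj[of AA OpA K OpAs] block_diag_OpA opb_AA localised_AA is_adj_OpA by blast

lemma opb_As: "opb K As" and opb_OpAs: "opb K OpAs"
  using is_adj_opb is_adj_A is_adj_OpA opb_A opb_OpA by blast+

lemma bounded_op_total: "bounded_op (OpA + PG)"
  unfolding bounded_op_iff_opb using opb_add[OF opb_OpA opb_Pr] by blast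

lemma is_adj_total: "is_adj (OpA + PG) (OpAs + PG)"
  by (intro is_adj_add is_adj_OpA is_adj_Pr)

lemma deep_total:
  assumes "strict_mono k" "\<And>s. \<forall>\<^sub>F m in sequentially. s - r m \<in> Y (k m)"
  shows "sasym (\<lambda>m. shift_conj (v (k m) + r m) (OpA + PG)) (\<lambda>m. shift_conj (r m) A)"
    and "sasym (\<lambda>m. shift_conj (v (k m) + r m) (OpAs + PG)) (\<lambda>m. shift_conj (r m) As)"
  by (rule inflated_deep[OF block_diag_OpA opb_OpA tame_AA opb_A AA_tendsto[OF delta_l2] assms])
     (rule inflated_deep[OF block_diag_OpAs opb_OpAs tame_AAs opb_As AAs_tendsto assms])

text \<open>With \<open>k\<close> the identity and the constant shift \<open>w\<close>, every fixed
  point is eventually deep in the current block, and the limit is the fixed conjugate of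
  \<open>A\<close>.\<close>

lemma limit_op_translate_A: "\<exists>h. limit_op (OpA + PG) h (shift_conj w A)"
proof -
  have d: "\<forall>\<^sub>F m in sequentially. s - w \<in> Y (id m)" for s using Y_eventually by simp
  have id: "strict_mono (id :: nat \<Rightarrow> nat)" by (simp add: strict_mono_def)
  have "limit_op (OpA + PG) (\<lambda>m. v (id m) + w) (shift_conj w A)"
    unfolding limit_op_def sconv_iff_sasym
    using bounded_op_total tends_inf_inflated[OF id d] deep_total[OF id d] is_adj_total is_adj_conj[OF is_adj_A] by blast
  then show ?thesis by blast
qed

text \<open>A block index growing fast enough makes \<open>Y (k m)\<close> contain
  \<open>Y m\<close> translated by \<open>- r m\<close>. Since the sets \<open>Y m\<close> exhaust
  the group, the shifts \<open>r m\<close> remain deep inside their blocks.\<close>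

lemma limit_op_of_A:
  assumes "limit_op A r C" shows "\<exists>h. limit_op (OpA + PG) h C"
proof -
  have "\<exists>N. \<forall>m. \<forall>i\<ge>N m. \<forall>s\<in>Y m. s - r m \<in> Y i"
  proof (rule choice, rule allI)
    fix m
    have "\<forall>\<^sub>F i in sequentially. \<forall>s\<in>Y m. s - r m \<in> Y i"
      by (rule eventually_ball_finite[OF finY]) (use Y_eventually in blast)
    then show "\<exists>N. \<forall>i\<ge>N. \<forall>s\<in>Y m. s - r m \<in> Y i" unfolding eventually_sequentially .
  qed
  then obtain N where N: "\<And>m i s. N m \<le> i \<Longrightarrow> s \<in> Y m \<Longrightarrow> s - r m \<in> Y i" by blast
  \<comment> \<open>The summand \<open>m\<close> makes \<open>k\<close> strictly increasing, and the
    sum dominates \<open>N m\<close>.\<close>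
  define k where "k m = m + (\<Sum>i\<le>m. N i)" for m
  have k: "strict_mono k" unfolding strict_mono_Suc_iff k_def by simp
  have "N m \<le> k m" for m unfolding k_def using member_le_sum[of m "{..m}" N] by simp
  then have d: "\<forall>\<^sub>F m in sequentially. s - r m \<in> Y (k m)" for s
    by (rule eventually_mono[OF Y_eventually[of s] N])
  have "limit_op (OpA + PG) (\<lambda>m. v (k m) + r m) C"
    by (rule limit_op_transfer[OF assms is_adj_A bounded_op_total is_adj_total tends_inf_inflated[OF k d] deep_total[OF k d]])
  then show ?thesis by blast
qed

text \<open>On a basis vector located in \<open>Gamma'\<close> the block part vanishes and the
  projection acts as the identity, so the shifted operators eventually fix each
  \<open>delta s\<close>.\<close>

lemma limit_op_identity:
  assumes "sconv (\<lambda>m. shift_conj (h m) (OpA + PG)) B" "\<And>s. \<forall>\<^sub>F m in sequentially. s - h m \<in> Gamma' Y v"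
  shows "op_eq B id"
proof -
  have "opb 1 (id :: 'a op)" by (simp add: opb_def)
  have "sasym (\<lambda>m. shift_conj (h m) (OpA + PG)) (\<lambda>_. id)"
  proof (rule sasymI_delta[OF opb_conj[OF opb_add[OF opb_OpA opb_Pr]] \<open>opb 1 id\<close>])
    fix s
    have "\<forall>\<^sub>F m in sequentially. l2norm (shift_conj (h m) (OpA + PG) (delta s) - id (delta s)) = 0"
      using assms(2)[of s]
    proof eventually_elim
      case (elim m)
      have "OpA (delta (s - h m)) = Rop (v 0) (AA 0 (delta (s - h m + v 0)))"
        by (rule block_diag_delta[OF block_diag_OpA opb_AA localised_AA]) (use elim in \<open>simp add: Gamma'_iff\<close>)
      also have "AA 0 (delta (s - h m + v 0)) = 0"
        using localised_delta[OF opb_AA localised_AA] elim by (simp add: Gamma'_iff)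
      also have "Rop (v 0) 0 = 0" by (simp add: Rop_def fun_eq_iff)
      finally have "OpA (delta (s - h m)) = 0" .
      then have "(OpA + PG) (Rop (h m) (delta s)) = Rop (h m) (delta s)"
        using elim by (simp only: plus_fun_apply Rop_delta Pr_delta if_True add_0_left)
      then show ?case by (simp add: Rop_Rop)
    qed
    then show "(\<lambda>m. l2norm (shift_conj (h m) (OpA + PG) (delta s) - id (delta s))) \<longlonglongrightarrow> 0"
      by (rule tendsto_eventually)
  qed
  then show ?thesis using sconv_unique[OF assms(1)] unfolding sconv_iff_sasym by blast
qed

definition boundary_limit :: "'a op \<Rightarrow> bool" where
  "boundary_limit B \<longleftrightarrow> (\<exists>k \<eta> w S Pg. strict_mono k \<and> (\<forall>j. \<eta> j \<in> uminus ` bdry_Om \<Omega> (Y (k j)))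
     \<and> sconv (\<lambda>j. Rop (- w) \<circ> Rop (- \<eta> j) \<circ> AA (k j) \<circ> Pr (Y (k j)) \<circ> Rop (\<eta> j) \<circ> Rop w) S
     \<and> limit_op (Pr (Gamma' Y v)) (\<lambda>j. v (k j) + \<eta> j + w) Pg
     \<and> op_eq B (S + Pg))"

text \<open>Only the sum of block part and projection is known to converge. Compactness supplies a
  subsequence along which the shifted projections converge on their own; the block part then
  converges as a difference.\<close>

lemma boundary_limitI:
  assumes B: "limit_op (OpA + PG) (\<lambda>m. v (k m) + r m) B" and k: "strict_mono k"
    and f: "\<And>m. f - r m \<in> Y (k m)" and w: "\<And>m. w - r m \<in> bdry_Om \<Omega> (Y (k m))"
  shows "boundary_limit B"
proof -
  obtain \<kappa> Z where \<kappa>: "strict_mono \<kappa>"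
    "\<And>t. \<forall>\<^sub>F m in sequentially. t \<in> {t. t - (v (k (\<kappa> m)) + r (\<kappa> m)) \<in> Gamma' Y v} \<longleftrightarrow> t \<in> Z"
    using convergent_sets_subseq[of "\<lambda>m. {t. t - (v (k m) + r m) \<in> Gamma' Y v}"] by blast
  define k' where "k' m = k (\<kappa> m)" for m
  define r' where "r' m = r (\<kappa> m)" for m
  have k': "strict_mono k'" using k \<kappa>(1) by (simp add: k'_def strict_mono_def)
  have B': "limit_op (OpA + PG) (\<lambda>m. v (k' m) + r' m) B"
    using limit_op_subseq[OF B \<kappa>(1)] unfolding k'_def r'_def .
  have P: "sconv (\<lambda>m. shift_conj (v (k' m) + r' m) PG) (Pr Z)"
    unfolding shift_conj_Pr k'_def r'_def by (rule sconv_Pr[OF \<kappa>(2)])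
  have ev: "\<forall>\<^sub>F m in sequentially. f - r' m \<in> Y (k' m)" using f by (simp add: r'_def k'_def)
  have 1: "sasym (\<lambda>m. shift_conj (r' m) (AA (k' m))) (\<lambda>m. shift_conj (v (k' m) + r' m) OpA)"
    by (rule sasym_sym[OF block_diag_sasym[OF block_diag_OpA opb_OpA opb_AA localised_AA k' ev]])
  have "sasym (\<lambda>m. shift_conj (v (k' m) + r' m) (OpA + PG) - shift_conj (v (k' m) + r' m) PG) (\<lambda>_. B - Pr Z)"
    using sasym_diff[of "\<lambda>m. shift_conj (v (k' m) + r' m) (OpA + PG)" "\<lambda>_. B"
        "\<lambda>m. shift_conj (v (k' m) + r' m) PG" "\<lambda>_. Pr Z"] B' P
    unfolding limit_op_def sconv_iff_sasym by blast
  then have "sasym (\<lambda>m. shift_conj (v (k' m) + r' m) OpA) (\<lambda>_. B - Pr Z)"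
    unfolding shift_conj_add add_diff_cancel_right' .
  from sasym_trans[OF 1 this] have S: "sconv (\<lambda>m. shift_conj (r' m) (AA (k' m))) (B - Pr Z)"
    unfolding sconv_iff_sasym .
  \<comment> \<open>This splits off the fixed \<open>w\<close>: \<open>r' m = \<eta> m + w\<close>,
    and \<open>\<eta> m\<close> is the negative of the boundary point
    \<open>w - r' m\<close>.\<close>
  define \<eta> where "\<eta> m = r' m - w" for m
  have r: "r' m = \<eta> m + w" for m by (simp add: \<eta>_def)
  have "shift_conj (r' m) (AA (k' m)) = Rop (- w) \<circ> Rop (- \<eta> m) \<circ> AA (k' m) \<circ> Pr (Y (k' m)) \<circ> Rop (\<eta> m) \<circ> Rop w" for m
    by (simp add: fun_eq_iff Rop_Rop r minus_add localised_Pr(2)[OF localised_AA])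
  then have S': "sconv (\<lambda>m. Rop (- w) \<circ> Rop (- \<eta> m) \<circ> AA (k' m) \<circ> Pr (Y (k' m)) \<circ> Rop (\<eta> m) \<circ> Rop w) (B - Pr Z)"
    using S by simp
  have "limit_op PG (\<lambda>m. v (k' m) + r' m) (Pr Z)"
    unfolding limit_op_def using opb_Pr[of "Gamma' Y v"] tends_inf_inflated[OF k' ev] P is_adj_Pr
    by (auto simp: bounded_op_iff_opb)
  then have P': "limit_op PG (\<lambda>m. v (k' m) + \<eta> m + w) (Pr Z)" by (simp add: r add.assoc)
  have "\<eta> m \<in> uminus ` bdry_Om \<Omega> (Y (k' m))" for m
  proof -
    have "\<eta> m = - (w - r' m)" by (simp add: \<eta>_def)
    then show ?thesis using imageI[OF w[of "\<kappa> m"], of uminus] by (simp only: r'_def k'_def)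
  qed
  moreover have "op_eq B ((B - Pr Z) + Pr Z)" by (simp add: op_eq_def)
  ultimately show ?thesis unfolding boundary_limit_def using k' S' P' by blast
qed

lemma limit_op_cases:
  assumes L: "limit_op (OpA + PG) h B"
  shows "op_eq B id \<or> (\<exists>w. op_eq B (shift_conj w A)) \<or> (\<exists>h'. limit_op A h' B) \<or> boundary_limit B"
proof (cases "\<forall>s. \<forall>\<^sub>F m in sequentially. s - h m \<in> Gamma' Y v")
  case True
  then show ?thesis using limit_op_identity L unfolding limit_op_def by blast
next
  case False
  then obtain f where "\<not> (\<forall>\<^sub>F m in sequentially. f - h m \<in> Gamma' Y v)" by blast
  then obtain \<sigma> :: "nat \<Rightarrow> nat" where \<sigma>: "strict_mono \<sigma>" "\<And>m. f - h (\<sigma> m) \<notin> Gamma' Y v"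
    using not_eventually_sequentiallyD by blast
  then have "\<exists>n. \<forall>m. f - h (\<sigma> m) + v (n m) \<in> Y (n m)" by (intro choice) (simp add: Gamma'_iff)
  then obtain n where n: "\<And>m. f - h (\<sigma> m) + v (n m) \<in> Y (n m)" by blast
  \<comment> \<open>If \<open>n m\<close> stayed at most \<open>N\<close>, then
    \<open>h (\<sigma> m)\<close> could be recovered from a point of one of finitely many finite
    blocks, contradicting that \<open>h\<close> tends to infinity.\<close>
  have "\<forall>\<^sub>F m in sequentially. N < n m" for N
  proof -
    let ?F = "\<Union>i\<le>N. (\<lambda>y. v i - y + f) ` Y i"
    have "finite ?F" using finY by simp
    then have "\<forall>\<^sub>F m in sequentially. h (\<sigma> m) \<notin> ?F"
      using tends_inf_subseq[OF _ \<sigma>(1)] L unfolding limit_op_def tends_inf_def by blast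
    then show ?thesis
    proof eventually_elim
      case (elim m)
      show ?case
      proof (rule ccontr)
        assume N: "\<not> N < n m"
        have "h (\<sigma> m) = v (n m) - (f - h (\<sigma> m) + v (n m)) + f"
          by (simp add: diff_conv_add_uminus minus_add add.assoc del: add_uminus_conv_diff)
        then have "h (\<sigma> m) \<in> (\<lambda>y. v (n m) - y + f) ` Y (n m)" by (rule image_eqI) (rule n)
        moreover have "n m \<in> {..N}" using N by simp
        ultimately show False using elim by blast
      qed
    qed
  qed
  then obtain \<tau> :: "nat \<Rightarrow> nat" where \<tau>: "strict_mono \<tau>" "strict_mono (\<lambda>m. n (\<tau> m))" using strict_mono_subseq by blast
  define k where "k m = n (\<tau> m)" for m
  \<comment> \<open>The position of the shift relative to block \<open>k m\<close>; the choice of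
    \<open>n\<close> says precisely that \<open>f - r m\<close> lies in
    \<open>Y (k m)\<close>.\<close>
  define r where "r m = - v (k m) + h (\<sigma> (\<tau> m))" for m
  have k: "strict_mono k" using \<tau>(2) by (simp add: k_def[abs_def])
  have H: "h (\<sigma> (\<tau> m)) = v (k m) + r m" for m by (simp add: r_def add.assoc[symmetric])
  have fr: "f - r m \<in> Y (k m)" for m
  proof -
    have "f - r m = f - h (\<sigma> (\<tau> m)) + v (n (\<tau> m))"
      by (simp add: r_def k_def diff_conv_add_uminus minus_add add.assoc del: add_uminus_conv_diff)
    then show ?thesis using n by (simp add: k_def)
  qed
  have B: "limit_op (OpA + PG) (\<lambda>m. v (k m) + r m) B"
    using limit_op_subseq[OF limit_op_subseq[OF L \<sigma>(1)] \<tau>(1)] by (simp only: H)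
  show ?thesis
  proof (cases "tends_inf r")
    case False
    then obtain F where F: "finite F" "\<not> (\<forall>\<^sub>F m in sequentially. r m \<notin> F)"
      unfolding tends_inf_def by blast
    have "(r m \<notin> F) = (\<forall>c\<in>F. \<not> r m = c)" for m by auto
    with F(2) have "\<not> (\<forall>\<^sub>F m in sequentially. \<forall>c\<in>F. \<not> r m = c)" by (simp only: not_False_eq_True)
    \<comment> \<open>Some value \<open>c\<close> of \<open>r\<close> recurs infinitely often; along
      that subsequence the shift inside the block is constant, and the limit must be a translate of
      \<open>A\<close>.\<close>
    with F(1) obtain c and \<rho> :: "nat \<Rightarrow> nat" where \<rho>: "strict_mono \<rho>" "\<And>m. r (\<rho> m) = c"
      using pigeonhole_subseq[of F "\<lambda>m c. r m = c"] by blast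
    have k\<rho>: "strict_mono (\<lambda>m. k (\<rho> m))" using k \<rho>(1) by (simp add: strict_mono_def)
    have "\<forall>\<^sub>F m in sequentially. s - c \<in> Y (k (\<rho> m))" for s
      using eventually_subseq[OF k\<rho> Y_eventually] .
    then have "sconv (\<lambda>m. shift_conj (v (k (\<rho> m)) + c) (OpA + PG)) (shift_conj c A)"
      using deep_total(1)[OF k\<rho>, of "\<lambda>_. c"] unfolding sconv_iff_sasym by blast
    moreover have "sconv (\<lambda>m. shift_conj (v (k (\<rho> m)) + c) (OpA + PG)) B"
      using limit_op_subseq[OF B \<rho>(1)] unfolding limit_op_def \<rho>(2) by blast
    ultimately show ?thesis using sconv_unique by blast
  next
    case r: True
    show ?thesis
    proof (cases "\<forall>s. \<forall>\<^sub>F m in sequentially. s - r m \<in> Y (k m)")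
      case True
      then have "sasym (\<lambda>m. shift_conj (r m) A) (\<lambda>m. shift_conj (v (k m) + r m) (OpA + PG))"
        "sasym (\<lambda>m. shift_conj (r m) As) (\<lambda>m. shift_conj (v (k m) + r m) (OpAs + PG))"
        using deep_total[OF k] sasym_sym by blast+
      then have "limit_op A r B" using limit_op_transfer[OF B is_adj_total _ is_adj_A r] opb_A
        unfolding bounded_op_iff_opb by blast
      then show ?thesis by blast
    next
      case False
      then obtain s where "\<not> (\<forall>\<^sub>F m in sequentially. s - r m \<in> Y (k m))" by blast
      then obtain \<rho> :: "nat \<Rightarrow> nat" where \<rho>: "strict_mono \<rho>" "\<And>m. s - r (\<rho> m) \<notin> Y (k (\<rho> m))"
        using not_eventually_sequentiallyD by blast
      \<comment> \<open>A word for \<open>s - f\<close> gives a path from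
        \<open>f - r (\<rho> m)\<close> inside the block to \<open>s - r (\<rho> m)\<close> outside
        it. Its length does not depend on \<open>m\<close>, so the boundary is met at one of
        finitely many offsets \<open>?F\<close>, and the pigeonhole principle fixes one offset
        \<open>w\<close> along a subsequence.\<close>
      obtain xs where xs: "set xs \<subseteq> \<Omega>" "sum_list xs = s - f" using generates by blast
      let ?F = "(\<lambda>i. sum_list (drop i xs) + f) ` {..length xs}"
      have "\<exists>c\<in>?F. c - r (\<rho> m) \<in> bdry_Om \<Omega> (Y (k (\<rho> m)))" for m
      proof -
        have "sum_list xs + (f - r (\<rho> m)) \<notin> Y (k (\<rho> m))"
          using \<rho>(2) unfolding xs(2) by (simp only: add_diff_eq diff_add_cancel) blast
        from bdry_Om_on_path[OF xs(1) fr this] show ?thesis by (auto simp: add_diff_eq)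
      qed
      then have "\<not> (\<forall>\<^sub>F m in sequentially. \<forall>c\<in>?F. \<not> c - r (\<rho> m) \<in> bdry_Om \<Omega> (Y (k (\<rho> m))))"
        using eventually_happens'[OF sequentially_bot] by blast
      then obtain w and \<pi> :: "nat \<Rightarrow> nat" where \<pi>: "strict_mono \<pi>" "\<And>m. w - r (\<rho> (\<pi> m)) \<in> bdry_Om \<Omega> (Y (k (\<rho> (\<pi> m))))"
        using pigeonhole_subseq[of ?F "\<lambda>m c. c - r (\<rho> m) \<in> bdry_Om \<Omega> (Y (k (\<rho> m)))"] by blast
      have "strict_mono (\<lambda>m. k (\<rho> (\<pi> m)))" using k \<rho>(1) \<pi>(1) by (simp add: strict_mono_def)
      then have "boundary_limit B"
        using boundary_limitI[OF limit_op_subseq[OF limit_op_subseq[OF B \<rho>(1)] \<pi>(1)]] fr \<pi>(2) by blast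
      then show ?thesis by blast
    qed
  qed
qed

end

theorem mainTheorem11:
  fixes \<Omega> :: "'g::{group_add,countable} set" and Y :: "nat \<Rightarrow> 'g set" and v :: "nat \<Rightarrow> 'g"
    and AA :: "nat \<Rightarrow> 'g op" and A OpA :: "'g op"
  assumes "finite \<Omega>" and "0 \<in> \<Omega>" and "\<forall>g. \<exists>xs. set xs \<subseteq> \<Omega> \<and> sum_list xs = g"
    and "\<forall>n. finite (Y n)" and "\<forall>n. Y n \<subseteq> Y (Suc n)" and "(\<Union>n. Y n) = UNIV"
    and "inflating \<Omega> Y v"
    and "AA \<in> SY Y"
    and "sconv (\<lambda>n. AA n \<circ> Pr (Y n)) A"
    and "sconv (\<lambda>N. \<Sum>n<N. Rop (v n) \<circ> AA n \<circ> Pr (Y n) \<circ> Rop (- v n)) OpA"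
  shows "(\<forall>h B. limit_op (OpA + Pr (Gamma' Y v)) h B \<longrightarrow>
            op_eq B id
          \<or> (\<exists>vs. op_eq B (Rop (- vs) \<circ> A \<circ> Rop vs))
          \<or> (\<exists>h'. limit_op A h' B)
          \<or> (\<exists>k \<eta> w S Pg. strict_mono k \<and> (\<forall>j. \<eta> j \<in> uminus ` bdry_Om \<Omega> (Y (k j)))
               \<and> sconv (\<lambda>j. Rop (- w) \<circ> Rop (- \<eta> j) \<circ> AA (k j) \<circ> Pr (Y (k j)) \<circ> Rop (\<eta> j) \<circ> Rop w) S
               \<and> limit_op (Pr (Gamma' Y v)) (\<lambda>j. v (k j) + \<eta> j + w) Pg
               \<and> op_eq B (S + Pg)))
       \<and> (\<forall>vs. \<exists>h. limit_op (OpA + Pr (Gamma' Y v)) h (Rop (- vs) \<circ> A \<circ> Rop vs))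
       \<and> (\<forall>h C. limit_op A h C \<longrightarrow> (\<exists>h'. limit_op (OpA + Pr (Gamma' Y v)) h' C))"
proof -
  interpret inflated_sequence \<Omega> Y v AA A OpA
    using assms by unfold_locales blast+
  show ?thesis
    by (intro conjI allI impI limit_op_cases[unfolded boundary_limit_def] limit_op_translate_A limit_op_of_A)
qed

end
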